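(* Let $\mathfrak{M}$ be a minimal matchbox manifold, with transversal space $\mathfrak{X}$ and holonomy pseudogroup $\mathcal{G}_{\mathfrak{X}}$ associated to a regular foliated covering of $\mathfrak{M}$. Let $M$ be a smooth Riemannian manifold with a $C^1$-foliation $\mathcal{F}_M$, and let $\mathcal{Z}\subset M$ be an exceptional minimal set for $\mathcal{F}_M$. Suppose there exists a homeomorphism $f\colon\mathfrak{M}\to\mathcal{Z}$. Then there exists a metric $d_{\mathfrak{X}}$ on $\mathfrak{X}$, defining its topology, such that the action of the holonomy pseudogroup $\mathcal{G}_{\mathfrak{X}}$ on $\mathfrak{X}$ is Lipschitz with respect to $d_{\mathfrak{X}}$.
   Context: **Matchbox manifolds.** A foliated space of dimension $n$ is a compact metrizable space $\mathfrak{M}$ for which there is a separable metric space $\mathfrak{X}$ such that each $x\in\mathfrak{M}$ has an open neighborhood $U_x$, a compact set $\mathfrak{X}_x\subset\mathfrak{X}$ and a homeomorphism $\varphi_x\colon \overline{U}_x\to[-1,1]^n\times\mathfrak{X}_x$ with $\varphi_x(x)=(0,w_x)$, $w_x\in \mathrm{int}(\mathfrak{X}_x)$, which extends to a foliated homeomorphism $\widehat U_x\to(-2,2)^n\times\mathfrak{X}_x$ on some $\widehat U_x\supset\overline U_x$. Plaques are the sets $\varphi_x^{-1}([-1,1]^n\times\{w\})$. The sets $\varphi_x^{-1}(V\times\{w\})$, $V\subset(-1,1)^n$ open, form a basis of the fine topology, whose connected components are the leaves; they form the foliation $\mathcal{F}$ of $\mathfrak{M}$. The foliated space is smooth if the charts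 can be chosen so that the transition maps between plaques are smooth and depend continuously on the transverse parameter in the $C^\infty$-topology. A matchbox manifold is a connected smooth foliated space for which $\mathfrak{X}$ is totally disconnected and each $\mathfrak{X}_x$ is clopen in $\mathfrak{X}$. It is equipped with a leafwise Riemannian metric varying continuously. It is minimal if every leaf is dense. **Holonomy pseudogroup.** A regular foliated covering is a finite covering by charts $\varphi_i\colon\overline U_i\to[-1,1]^n\times\mathfrak{X}_i$, $1\le i\le\nu$, of small diameter, whose plaques are strongly convex in the leafwise metric and of uniformly small leafwise size (for some $\delta<\lambda/5$, where all leafwise balls of radius $\lambda$ are strongly convex, each plaque contains the leafwise $\delta/2$-ball, and is contained in the leafwise $\delta$-ball, about its center), and for which each $\mathfrak{X}_{i,j}=\pi_i(U_i\cap U_j)\subset\mathfrak{X}_i$ is clopen, where $\pi_i\colon \overline U_i\to\mathfrak{X}_i$ is the projection. Put $\mathfrak{X}=\mathfrak{X}_1\sqcup\cdots\sqcup\mathfrak{X}_\nu$. When $U_i\cap U_j\neq\emptyset$, intersection of plaques defines a homeomorphism $h_{i,j}\colon\mathfrak{X}_{i,j}\to\mathfrak{X}_{j,i}$. The holonomy pseudogroup $\mathcal{G}_{\mathfrak{X}}$ is the pseudogroup on $\mathfrak{X}$ generated by these maps. **Lipschitz.** A pseudogroup acting on $(\mathfrak{X},d)$ is Lipschitz if it has a finite generating set of homeomorphisms $h_i\colon U_i\to V_i$ between clopen sets and a constant $C\ge1$ with $C^{-1}d(w,w')\le d(h_i(w),h_i(w'))\le C\,d(w,w')$ for all $i$ and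 all $w,w'\in U_i$. **Exceptional minimal set.** A minimal set of $\mathcal{F}_M$ is a non-empty closed union of leaves in which every leaf is dense; it is exceptional if it meets local transversals to $\mathcal{F}_M$ in Cantor sets (so that, with the restricted foliation, it is a minimal matchbox manifold). *)

theory Defs
  imports "HOL-Analysis.Analysis"
begin

section \<open>Differentiability classes and charts\<close>

text \<open>\<open>C\<^sup>k\<close> on an open set. Testing the derivative on each vector keeps the
  value type fixed along the recursion; in finite dimension this is continuity of the derivative.\<close>

primrec Ck_on :: "nat \<Rightarrow> 'a::euclidean_space set \<Rightarrow> ('a \<Rightarrow> 'b::real_normed_vector) \<Rightarrow> bool" where
  "Ck_on 0 S f \<longleftrightarrow> continuous_on S f"
| "Ck_on (Suc k) S f \<longleftrightarrow> (\<forall>x\<in>S. f differentiable (at x)) \<and>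
     (\<forall>v. Ck_on k S (\<lambda>x. frechet_derivative f (at x) v))"

definition smooth_on :: "'a::euclidean_space set \<Rightarrow> ('a \<Rightarrow> 'b::real_normed_vector) \<Rightarrow> bool" where
  "smooth_on S f \<longleftrightarrow> (\<forall>k. Ck_on k S f)"

text \<open>The function is \<open>k\<close> times differentiable in the leaf variable \<open>x\<close>, and all leafwise derivatives
  up to order \<open>k\<close> are jointly continuous in \<open>(x, w)\<close>. For all \<open>k\<close> together this is smoothness in
  \<open>x\<close> with continuous dependence on the transverse parameter \<open>w\<close> in the \<open>C\<close>-infinity topology
  (uniform convergence of all derivatives on compact sets).\<close>

primrec leafwise_Ck_on ::
  "nat \<Rightarrow> 'x topology \<Rightarrow> ('a::euclidean_space \<times> 'x) set \<Rightarrow> ('a \<times> 'x \<Rightarrow> 'b::real_normed_vector) \<Rightarrow> bool" where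
  "leafwise_Ck_on 0 X W F \<longleftrightarrow>
     continuous_map (subtopology (prod_topology euclidean X) W) euclidean F"
| "leafwise_Ck_on (Suc k) X W F \<longleftrightarrow>
     continuous_map (subtopology (prod_topology euclidean X) W) euclidean F \<and>
     (\<forall>(x, w)\<in>W. (\<lambda>x'. F (x', w)) differentiable (at x)) \<and>
     (\<forall>v. leafwise_Ck_on k X W (\<lambda>(x, w). frechet_derivative (\<lambda>x'. F (x', w)) (at x) v))"

text \<open>A chart is a pair of an open set and a coordinate map; only the values of the map on the
  open set (for matchbox charts: on its closure) are meaningful.\<close>

type_synonym ('m, 'c) chart = "'m set \<times> ('m \<Rightarrow> 'c)"

definition transition :: "('m, 'c) chart \<Rightarrow> ('m, 'd) chart \<Rightarrow> 'c \<Rightarrow> 'd" where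
  "transition c c' = snd c' \<circ> inv_into (fst c) (snd c)"


section \<open>Leaves\<close>

text \<open>Both for foliated spaces and for foliated manifolds, \<open>x \<mapsto> (fst (\<phi> x), snd (\<phi> x))\<close>
  gives the leaf and the transverse coordinates, the former ranging over \<open>(-1,1)\<^sup>n\<close> on the chart
  domain.\<close>

definition leaf_topology :: "('m, (real^'n) \<times> 'x) chart set \<Rightarrow> 'm topology" where
  "leaf_topology A = topology_generated_by
     {{y \<in> U. fst (\<phi> y) \<in> V \<and> snd (\<phi> y) = w} | U \<phi> V w.
        (U, \<phi>) \<in> A \<and> open V \<and> V \<subseteq> box (-1) 1}"

definition leaves :: "('m, (real^'n) \<times> 'x) chart set \<Rightarrow> 'm set set" where
  "leaves A = connected_components_of (leaf_topology A)"

definition leaf_through :: "('m, (real^'n) \<times> 'x) chart set \<Rightarrow> 'm \<Rightarrow> 'm set" where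
  "leaf_through A x = connected_component_of_set (leaf_topology A) x"


section \<open>Matchbox manifolds\<close>

text \<open>The set \<open>\<XX>\<^sub>x\<close> of a chart is recovered as the set of its transverse coordinates.\<close>

definition local_transversal_model :: "('m, (real^'n) \<times> 'x) chart \<Rightarrow> 'x set" where
  "local_transversal_model c = (snd \<circ> snd c) ` fst c"

definition foliated_space ::
  "'m topology \<Rightarrow> 'x metric \<Rightarrow> ('m, (real^'n) \<times> 'x) chart set \<Rightarrow> bool" where
  "foliated_space MM X A \<longleftrightarrow>
     compact_space MM \<and> metrizable_space MM \<and> separable_space (mtopology_of X) \<and>
     (\<forall>(U, \<phi>)\<in>A. let T = local_transversal_model (U, \<phi>); K = MM closure_of U in
        openin MM U \<and> compactin (mtopology_of X) T \<and>
        homeomorphic_map (subtopology MM K)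
          (prod_topology (top_of_set (cbox (-1) 1)) (subtopology (mtopology_of X) T)) \<phi> \<and>
        U = {y \<in> K. fst (\<phi> y) \<in> box (-1) 1} \<and>
        (\<exists>x\<in>U. fst (\<phi> x) = 0 \<and> snd (\<phi> x) \<in> mtopology_of X interior_of T) \<and>
        \<comment> \<open>a foliated homeomorphism is one for the given and for the fine topologies\<close>
        (\<exists>U' \<phi>'. openin MM U' \<and> K \<subseteq> U' \<and> (\<forall>y\<in>K. \<phi>' y = \<phi> y) \<and>
           homeomorphic_map (subtopology MM U')
             (prod_topology (top_of_set (box (-2) 2)) (subtopology (mtopology_of X) T)) \<phi>' \<and>
           homeomorphic_map (subtopology (leaf_topology A) U')
             (prod_topology (top_of_set (box (-2) 2)) (discrete_topology T)) \<phi>')) \<and>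
     (\<forall>x\<in>topspace MM. \<exists>(U, \<phi>)\<in>A. x \<in> U \<and> fst (\<phi> x) = 0 \<and>
        snd (\<phi> x) \<in> mtopology_of X interior_of local_transversal_model (U, \<phi>))"

definition smooth_foliated_space ::
  "'m topology \<Rightarrow> 'x metric \<Rightarrow> ('m, (real^'n) \<times> 'x) chart set \<Rightarrow> bool" where
  "smooth_foliated_space MM X A \<longleftrightarrow> foliated_space MM X A \<and>
     (\<forall>c\<in>A. \<forall>c'\<in>A. \<forall>k.
        leafwise_Ck_on k (mtopology_of X) (snd c ` (fst c \<inter> fst c')) (fst \<circ> transition c c'))"

definition totally_disconnected_space :: "'a topology \<Rightarrow> bool" where
  "totally_disconnected_space X \<longleftrightarrow> (\<forall>S. connectedin X S \<longrightarrow> (\<exists>a. S \<subseteq> {a}))"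

definition clopenin :: "'a topology \<Rightarrow> 'a set \<Rightarrow> bool" where
  "clopenin X S \<longleftrightarrow> openin X S \<and> closedin X S"

definition matchbox_manifold ::
  "'m topology \<Rightarrow> 'x metric \<Rightarrow> ('m, (real^'n) \<times> 'x) chart set \<Rightarrow> bool" where
  "matchbox_manifold MM X A \<longleftrightarrow>
     smooth_foliated_space MM X A \<and> connected_space MM \<and>
     totally_disconnected_space (mtopology_of X) \<and>
     (\<forall>c\<in>A. clopenin (mtopology_of X) (local_transversal_model c))"

definition minimal_foliated_space :: "'m topology \<Rightarrow> ('m, (real^'n) \<times> 'x) chart set \<Rightarrow> bool" where
  "minimal_foliated_space MM A \<longleftrightarrow> (\<forall>L\<in>leaves A. MM closure_of L = topspace MM)"


section \<open>Leafwise Riemannian geometry\<close>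

definition inner_product :: "('a::real_vector \<Rightarrow> 'a \<Rightarrow> real) \<Rightarrow> bool" where
  "inner_product b \<longleftrightarrow> (\<forall>u. linear (b u)) \<and> (\<forall>u v. b u v = b v u) \<and> (\<forall>u. u \<noteq> 0 \<longrightarrow> b u u > 0)"

text \<open>\<open>g c p\<close> is the inner product on the tangent space of the leaf, written in the chart \<open>c\<close> at the
  point with coordinates \<open>p\<close>. It is smooth along the leaves and varies continuously.\<close>

type_synonym ('m, 'n, 'x) leaf_tensor =
  "('m, (real^'n) \<times> 'x) chart \<Rightarrow> (real^'n) \<times> 'x \<Rightarrow> real^'n \<Rightarrow> real^'n \<Rightarrow> real"

definition leafwise_riemannian_metric ::
  "'x metric \<Rightarrow> ('m, (real^'n) \<times> 'x) chart set \<Rightarrow> ('m, 'n, 'x) leaf_tensor \<Rightarrow> bool" where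
  "leafwise_riemannian_metric X A g \<longleftrightarrow>
     (\<forall>c\<in>A. let W = snd c ` fst c in
        (\<forall>p\<in>W. inner_product (g c p)) \<and>
        (\<forall>u v. continuous_map (subtopology (prod_topology euclidean (mtopology_of X)) W) euclideanreal
                  (\<lambda>p. g c p u v) \<and>
               (\<forall>w. smooth_on {x. (x, w) \<in> W} (\<lambda>x. g c (x, w) u v)))) \<and>
     (\<forall>c\<in>A. \<forall>c'\<in>A. \<forall>(x, w)\<in>snd c ` (fst c \<inter> fst c').
        let D = frechet_derivative (\<lambda>x'. fst (transition c c' (x', w))) (at x) in
        \<forall>u v. g c (x, w) u v = g c' (transition c c' (x, w)) (D u) (D v))"

text \<open>By the transformation law of the metric the speed does not depend on the selected chart.\<close>

definition leaf_speed ::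
  "('m, (real^'n) \<times> 'x) chart set \<Rightarrow> ('m, 'n, 'x) leaf_tensor \<Rightarrow> (real \<Rightarrow> 'm) \<Rightarrow> real \<Rightarrow> real" where
  "leaf_speed A g \<gamma> t =
     (let c = (SOME c. c \<in> A \<and> \<gamma> t \<in> fst c);
          v = vector_derivative (\<lambda>s. fst (snd c (\<gamma> s))) (at t)
      in sqrt (g c (snd c (\<gamma> t)) v v))"

text \<open>The library's piecewise \<open>C\<^sup>1\<close> curves may have unbounded derivative near the break points,
  where the integral would default to 0; hence the integrability requirement.\<close>

definition leafwise_curve ::
  "('m, (real^'n) \<times> 'x) chart set \<Rightarrow> ('m, 'n, 'x) leaf_tensor \<Rightarrow> (real \<Rightarrow> 'm) \<Rightarrow> bool" where
  "leafwise_curve A g \<gamma> \<longleftrightarrow> pathin (leaf_topology A) \<gamma> \<and>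
     (\<forall>(U, \<phi>)\<in>A. \<forall>a b. 0 \<le> a \<and> b \<le> 1 \<and> \<gamma> ` {a..b} \<subseteq> U \<longrightarrow>
        (\<lambda>s. fst (\<phi> (\<gamma> s))) piecewise_C1_differentiable_on {a..b}) \<and>
     leaf_speed A g \<gamma> integrable_on {0..1}"

definition leaf_length ::
  "('m, (real^'n) \<times> 'x) chart set \<Rightarrow> ('m, 'n, 'x) leaf_tensor \<Rightarrow> (real \<Rightarrow> 'm) \<Rightarrow> real \<Rightarrow> real" where
  "leaf_length A g \<gamma> t = integral {0..t} (leaf_speed A g \<gamma>)"

text \<open>Only meaningful for two points on the same leaf.\<close>

definition leaf_dist ::
  "('m, (real^'n) \<times> 'x) chart set \<Rightarrow> ('m, 'n, 'x) leaf_tensor \<Rightarrow> 'm \<Rightarrow> 'm \<Rightarrow> real" where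
  "leaf_dist A g x y = Inf {leaf_length A g \<gamma> 1 | \<gamma>. leafwise_curve A g \<gamma> \<and> \<gamma> 0 = x \<and> \<gamma> 1 = y}"

definition leaf_ball ::
  "('m, (real^'n) \<times> 'x) chart set \<Rightarrow> ('m, 'n, 'x) leaf_tensor \<Rightarrow> 'm \<Rightarrow> real \<Rightarrow> 'm set" where
  "leaf_ball A g x r = {y \<in> leaf_through A x. leaf_dist A g x y < r}"

text \<open>Shortest curves, parametrized on \<open>[0,1]\<close> proportionally to arc length.\<close>

definition shortest_geodesic ::
  "('m, (real^'n) \<times> 'x) chart set \<Rightarrow> ('m, 'n, 'x) leaf_tensor \<Rightarrow> 'm \<Rightarrow> 'm \<Rightarrow> (real \<Rightarrow> 'm) \<Rightarrow> bool" where
  "shortest_geodesic A g x y \<gamma> \<longleftrightarrow> leafwise_curve A g \<gamma> \<and> \<gamma> 0 = x \<and> \<gamma> 1 = y \<and>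
     (\<forall>t\<in>{0..1}. leaf_length A g \<gamma> t = t * leaf_dist A g x y)"

definition strongly_convex ::
  "('m, (real^'n) \<times> 'x) chart set \<Rightarrow> ('m, 'n, 'x) leaf_tensor \<Rightarrow> 'm set \<Rightarrow> bool" where
  "strongly_convex A g K \<longleftrightarrow> (\<forall>x\<in>K. \<forall>y\<in>K. \<exists>\<gamma>. shortest_geodesic A g x y \<gamma> \<and> \<gamma> ` {0..1} \<subseteq> K \<and>
     (\<forall>\<gamma>'. shortest_geodesic A g x y \<gamma>' \<longrightarrow> (\<forall>t\<in>{0..1}. \<gamma>' t = \<gamma> t)))"


section \<open>Regular foliated coverings\<close>

definition plaque :: "'m topology \<Rightarrow> ('m, (real^'n) \<times> 'x) chart \<Rightarrow> 'x \<Rightarrow> 'm set" where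
  "plaque MM c w = {y \<in> MM closure_of fst c. snd (snd c y) = w}"

definition overlap_transversal ::
  "(nat \<Rightarrow> ('m, (real^'n) \<times> 'x) chart) \<Rightarrow> nat \<Rightarrow> nat \<Rightarrow> 'x set" where
  "overlap_transversal \<phi> i j = (snd \<circ> snd (\<phi> i)) ` (fst (\<phi> i) \<inter> fst (\<phi> j))"

text \<open>The charts of the covering are \<open>\<phi> i\<close> for \<open>i < \<nu>\<close>. The bound on the diameter of the charts
  is there to make plaques of overlapping charts meet in a one-to-one way, so that they define the
  holonomy maps; this is the last condition.\<close>

definition regular_foliated_covering ::
  "'m topology \<Rightarrow> 'x metric \<Rightarrow> ('m, (real^'n) \<times> 'x) chart set \<Rightarrow> ('m, 'n, 'x) leaf_tensor \<Rightarrow>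
   nat \<Rightarrow> (nat \<Rightarrow> ('m, (real^'n) \<times> 'x) chart) \<Rightarrow> bool" where
  "regular_foliated_covering MM X A g \<nu> \<phi> \<longleftrightarrow>
     (\<forall>i<\<nu>. \<phi> i \<in> A) \<and>
     (\<Union>i<\<nu>. fst (\<phi> i)) = topspace MM \<and>
     (\<exists>lam del. 0 < del \<and> del < lam / 5 \<and>
        (\<forall>x\<in>topspace MM. strongly_convex A g (leaf_ball A g x lam)) \<and>
        (\<forall>i<\<nu>. \<forall>z\<in>fst (\<phi> i). fst (snd (\<phi> i) z) = 0 \<longrightarrow>
           (let P = plaque MM (\<phi> i) (snd (snd (\<phi> i) z)) in
            strongly_convex A g P \<and> leaf_ball A g z (del / 2) \<subseteq> P \<and> P \<subseteq> leaf_ball A g z del))) \<and>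
     (\<forall>i<\<nu>. \<forall>j<\<nu>.
        clopenin (subtopology (mtopology_of X) (local_transversal_model (\<phi> i))) (overlap_transversal \<phi> i j)) \<and>
     (\<forall>i<\<nu>. \<forall>j<\<nu>. \<forall>y\<in>fst (\<phi> i) \<inter> fst (\<phi> j). \<forall>z\<in>fst (\<phi> i) \<inter> fst (\<phi> j).
        snd (snd (\<phi> i) y) = snd (snd (\<phi> i) z) \<longleftrightarrow> snd (snd (\<phi> j) y) = snd (snd (\<phi> j) z))"

definition transversal_space ::
  "'x metric \<Rightarrow> nat \<Rightarrow> (nat \<Rightarrow> ('m, (real^'n) \<times> 'x) chart) \<Rightarrow> (nat \<times> 'x) topology" where
  "transversal_space X \<nu> \<phi> =
     sum_topology (\<lambda>i. subtopology (mtopology_of X) (local_transversal_model (\<phi> i))) {..<\<nu>}"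


section \<open>Pseudogroups\<close>

text \<open>Partially defined maps are identified with their graphs, so that inverse, composition and
  gluing become converse, relational composition and union; restriction to an open set is
  composition with a partial identity.\<close>

definition graph_on :: "'a set \<Rightarrow> ('a \<Rightarrow> 'b) \<Rightarrow> ('a \<times> 'b) set" where
  "graph_on U f = {(x, f x) | x. x \<in> U}"

definition local_homeomorphism :: "'a topology \<Rightarrow> ('a \<times> 'a) set \<Rightarrow> bool" where
  "local_homeomorphism X h \<longleftrightarrow> (\<exists>U V f. openin X U \<and> openin X V \<and>
     homeomorphic_map (subtopology X U) (subtopology X V) f \<and> h = graph_on U f)"

definition pseudogroup :: "'a topology \<Rightarrow> ('a \<times> 'a) set set \<Rightarrow> bool" where
  "pseudogroup X G \<longleftrightarrow>
     (\<forall>h\<in>G. local_homeomorphism X h) \<and>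
     (\<forall>U. openin X U \<longrightarrow> Id_on U \<in> G) \<and>
     (\<forall>h\<in>G. h\<inverse> \<in> G) \<and>
     (\<forall>h\<in>G. \<forall>k\<in>G. h O k \<in> G) \<and>
     (\<forall>H. H \<subseteq> G \<and> local_homeomorphism X (\<Union>H) \<longrightarrow> \<Union>H \<in> G)"

definition pseudogroup_generated :: "'a topology \<Rightarrow> ('a \<times> 'a) set set \<Rightarrow> ('a \<times> 'a) set set" where
  "pseudogroup_generated X S = \<Inter>{G. pseudogroup X G \<and> S \<subseteq> G}"

definition lipschitz_pseudogroup ::
  "'a topology \<Rightarrow> ('a \<Rightarrow> 'a \<Rightarrow> real) \<Rightarrow> ('a \<times> 'a) set set \<Rightarrow> bool" where
  "lipschitz_pseudogroup X d G \<longleftrightarrow>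
     (\<exists>S C. finite S \<and> pseudogroup_generated X S = G \<and> C \<ge> 1 \<and>
        (\<forall>h\<in>S. \<exists>U V f. clopenin X U \<and> clopenin X V \<and>
           homeomorphic_map (subtopology X U) (subtopology X V) f \<and> h = graph_on U f \<and>
           (\<forall>w\<in>U. \<forall>w'\<in>U. inverse C * d w w' \<le> d (f w) (f w') \<and> d (f w) (f w') \<le> C * d w w')))"

definition holonomy_map ::
  "(nat \<Rightarrow> ('m, (real^'n) \<times> 'x) chart) \<Rightarrow> nat \<Rightarrow> nat \<Rightarrow> ((nat \<times> 'x) \<times> (nat \<times> 'x)) set" where
  "holonomy_map \<phi> i j =
     {((i, snd (snd (\<phi> i) y)), (j, snd (snd (\<phi> j) y))) | y. y \<in> fst (\<phi> i) \<inter> fst (\<phi> j)}"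

definition holonomy_pseudogroup ::
  "'x metric \<Rightarrow> nat \<Rightarrow> (nat \<Rightarrow> ('m, (real^'n) \<times> 'x) chart) \<Rightarrow> ((nat \<times> 'x) \<times> (nat \<times> 'x)) set set" where
  "holonomy_pseudogroup X \<nu> \<phi> = pseudogroup_generated (transversal_space X \<nu> \<phi>)
     {holonomy_map \<phi> i j | i j. i < \<nu> \<and> j < \<nu> \<and> fst (\<phi> i) \<inter> fst (\<phi> j) \<noteq> {}}"


section \<open>Foliated Riemannian manifolds and exceptional minimal sets\<close>

definition smooth_manifold :: "'p topology \<Rightarrow> ('p, 'e::euclidean_space) chart set \<Rightarrow> bool" where
  "smooth_manifold M S \<longleftrightarrow> Hausdorff_space M \<and> second_countable M \<and>
     (\<forall>(U, \<psi>)\<in>S. openin M U \<and> open (\<psi> ` U) \<and> homeomorphic_map (subtopology M U) (top_of_set (\<psi> ` U)) \<psi>) \<and>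
     (\<Union>(U, \<psi>)\<in>S. U) = topspace M \<and>
     (\<forall>c\<in>S. \<forall>c'\<in>S. smooth_on (snd c ` (fst c \<inter> fst c')) (transition c c'))"

definition riemannian_metric ::
  "('p, 'e::euclidean_space) chart set \<Rightarrow> (('p, 'e) chart \<Rightarrow> 'e \<Rightarrow> 'e \<Rightarrow> 'e \<Rightarrow> real) \<Rightarrow> bool" where
  "riemannian_metric S G \<longleftrightarrow>
     (\<forall>c\<in>S. (\<forall>x\<in>snd c ` fst c. inner_product (G c x)) \<and>
             (\<forall>u v. smooth_on (snd c ` fst c) (\<lambda>x. G c x u v))) \<and>
     (\<forall>c\<in>S. \<forall>c'\<in>S. \<forall>x\<in>snd c ` (fst c \<inter> fst c').
        let D = frechet_derivative (transition c c') (at x) in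
        \<forall>u v. G c x u v = G c' (transition c c' x) (D u) (D v))"

definition C1_foliation ::
  "'p topology \<Rightarrow> ('p, 'e::euclidean_space) chart set \<Rightarrow> ('p, (real^'k) \<times> (real^'q)) chart set \<Rightarrow> bool" where
  "C1_foliation M S F \<longleftrightarrow>
     (\<forall>(U, \<phi>)\<in>F. openin M U \<and>
        homeomorphic_map (subtopology M U) (top_of_set (box (-1) 1 \<times> box (-1) 1)) \<phi>) \<and>
     (\<Union>(U, \<phi>)\<in>F. U) = topspace M \<and>
     (\<forall>c\<in>F. \<forall>s\<in>S. Ck_on 1 (snd c ` (fst c \<inter> fst s)) (transition c s) \<and>
                   Ck_on 1 (snd s ` (fst c \<inter> fst s)) (transition s c)) \<and>
     (\<forall>(U, \<phi>)\<in>F. \<forall>(U', \<phi>')\<in>F. \<forall>z\<in>U \<inter> U'. \<exists>W. openin M W \<and> z \<in> W \<and> W \<subseteq> U \<inter> U' \<and>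
        (\<forall>x\<in>W. \<forall>y\<in>W. snd (\<phi> x) = snd (\<phi> y) \<longrightarrow> snd (\<phi>' x) = snd (\<phi>' y)))"

text \<open>A \<open>C\<^sup>1\<close>-embedded submanifold of dimension \<open>q\<close> transverse to the foliation, given by a global
  parametrization: transversality is invertibility of the derivative of the transverse coordinates.\<close>

definition local_transversal ::
  "'p topology \<Rightarrow> ('p, (real^'k) \<times> (real^'q)) chart set \<Rightarrow> 'p set \<Rightarrow> bool" where
  "local_transversal M F T \<longleftrightarrow>
     (\<exists>(D :: (real^'q) set) \<tau>. open D \<and> T \<subseteq> topspace M \<and> homeomorphic_map (top_of_set D) (subtopology M T) \<tau> \<and>
        (\<forall>(U, \<phi>)\<in>F. Ck_on 1 {u \<in> D. \<tau> u \<in> U} (\<phi> \<circ> \<tau>) \<and>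
           (\<forall>u\<in>D. \<tau> u \<in> U \<longrightarrow> bij (frechet_derivative (snd \<circ> \<phi> \<circ> \<tau>) (at u)))))"

definition minimal_set ::
  "'p topology \<Rightarrow> ('p, (real^'k) \<times> (real^'q)) chart set \<Rightarrow> 'p set \<Rightarrow> bool" where
  "minimal_set M F Z \<longleftrightarrow> Z \<noteq> {} \<and> closedin M Z \<and>
     (\<exists>\<L>\<subseteq>leaves F. Z = \<Union>\<L>) \<and>
     (\<forall>L\<in>leaves F. L \<subseteq> Z \<longrightarrow> Z \<subseteq> M closure_of L)"

definition cantor_space :: "(nat \<Rightarrow> bool) topology" where
  "cantor_space = product_topology (\<lambda>_. discrete_topology UNIV) UNIV"

text \<open>A transversal has to be shrunk about a point of \<open>Z\<close> to meet \<open>Z\<close> in a compact set.\<close>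

definition exceptional_minimal_set ::
  "'p topology \<Rightarrow> ('p, (real^'k) \<times> (real^'q)) chart set \<Rightarrow> 'p set \<Rightarrow> bool" where
  "exceptional_minimal_set M F Z \<longleftrightarrow> minimal_set M F Z \<and>
     (\<forall>T z. local_transversal M F T \<and> z \<in> T \<inter> Z \<longrightarrow>
        (\<exists>T'\<subseteq>T. local_transversal M F T' \<and> z \<in> T' \<and>
           subtopology M (T' \<inter> Z) homeomorphic_space cantor_space))"

end

theory Submission
  imports Defs
begin

text \<open>Since \<open>Z\<close> meets transversals in Cantor sets and is a union of leaves, locally a connected subset
  of \<open>Z\<close> lies in one plaque; as the transversals of the matchbox manifold are totally disconnected too,
  \<open>f\<close> locally maps plaques to plaques, injectively on the set of plaques. So near a point of \<open>\<XX>\<close> the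
  transverse coordinate in \<open>\<real>\<^sup>q\<close> of a foliation chart of \<open>M\<close>, composed with \<open>f\<close>, is an embedding of a
  transversal, and a metric on \<open>\<XX>\<close> is obtained by glueing finitely many pulled back Euclidean
  metrics along a clopen partition. In these coordinates the holonomy along a plaque is locally Lipschitz:
  for nearby points of the plaque it is a change of foliation charts of \<open>M\<close>, which is \<open>C\<^sup>1\<close> transversely,
  and plaques are connected. Compactness makes the constants uniform.\<close>

section \<open>Maps of class \<open>C\<^sup>1\<close>\<close>

text \<open>Since \<open>f\<close> is only a homeomorphism, leaf and transverse directions have to
  be recognised topologically on both sides: connected sets stand for plaques, total
  disconnectedness for the transverse direction. All differentiability comes from \<open>M\<close>.
  The distances compared are between images under the same \<open>f\<close>, so \<open>f\<close> is
  never differentiated and only coordinate changes of the foliation are estimated. A plaque of a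
  matchbox chart may be mapped across many foliation charts of \<open>M\<close>, and plaques of two
  overlapping foliation charts correspond only near a common point. The estimate is therefore
  phrased for neighbourhoods of two points of one plaque; it holds for nearby points and is
  transitive, and so spreads over the whole plaque. The exceptional hypothesis replaces a given
  transversal by an unspecified smaller one; invariance of domain shows that this one still covers
  an open set of transverse coordinates. The lower Lipschitz bound comes for free, because the
  inverse of a generator is again a generator.\<close>

lemma C1_on_iff:
  "Ck_on 1 S f \<longleftrightarrow> (\<forall>x\<in>S. f differentiable (at x)) \<and>
     (\<forall>v. continuous_on S (\<lambda>x. frechet_derivative f (at x) v))"
  by (simp add: numeral_nat)

lemma frechet_derivative_compose_at:
  assumes "f differentiable (at x)" "g differentiable (at (f x))"
  shows "frechet_derivative (g \<circ> f) (at x) =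
    frechet_derivative g (at (f x)) \<circ> frechet_derivative f (at x)"
  by (rule frechet_derivative_at[symmetric], rule diff_chain_at)
     (use assms frechet_derivative_works in auto)

lemma frechet_derivative_cong_at:
  assumes "open O'" "x \<in> O'" "\<And>y. y \<in> O' \<Longrightarrow> f y = g y" "g differentiable (at x)"
  shows "f differentiable (at x)" "frechet_derivative f (at x) = frechet_derivative g (at x)"
proof -
  have "(g has_derivative frechet_derivative g (at x)) (at x)"
    using assms(4) frechet_derivative_works by blast
  then have "(f has_derivative frechet_derivative g (at x)) (at x)"
    by (rule has_derivative_transform_within_open[OF _ assms(1,2)]) (simp add: assms(3))
  then show "f differentiable (at x)" "frechet_derivative f (at x) = frechet_derivative g (at x)"
    using frechet_derivative_at[symmetric] by (auto simp: differentiable_def)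
qed

text \<open>Continuity of the derivative is available only on a fixed vector, while the chain rule
  feeds the varying vector \<open>frechet_derivative f (at x) v\<close> into the derivative of
  \<open>g\<close>. Expanding that vector in \<open>Basis\<close> leaves fixed vectors with
  continuous coefficients.\<close>

lemma C1_on_compose:
  fixes f :: "'a::euclidean_space \<Rightarrow> 'b::euclidean_space" and g :: "'b \<Rightarrow> 'c::real_normed_vector"
  assumes f: "Ck_on 1 S f" and g: "Ck_on 1 T g" and "f ` S \<subseteq> T"
  shows "Ck_on 1 S (g \<circ> f)"
  unfolding C1_on_iff
proof (intro conjI ballI allI)
  have d: "f differentiable (at x)" "g differentiable (at (f x))" if "x \<in> S" for x
    using assms that unfolding C1_on_iff by auto
  show "g \<circ> f differentiable at x" if "x \<in> S" for x
    using d[OF that] differentiable_chain_at by blast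
  fix v
  have cf: "continuous_on S f"
    using d(1) by (meson continuous_at_imp_continuous_on differentiable_imp_continuous_within)
  have "continuous_on S (\<lambda>x. \<Sum>b\<in>Basis. (frechet_derivative f (at x) v \<bullet> b) *\<^sub>R
          frechet_derivative g (at (f x)) b)"
    using f g cf \<open>f ` S \<subseteq> T\<close> unfolding C1_on_iff
    by (intro continuous_on_sum continuous_on_scaleR continuous_on_inner continuous_on_const)
       (auto intro!: continuous_on_compose2[of T _ S f])
  moreover have "frechet_derivative (g \<circ> f) (at x) v =
      (\<Sum>b\<in>Basis. (frechet_derivative f (at x) v \<bullet> b) *\<^sub>R frechet_derivative g (at (f x)) b)"
    if "x \<in> S" for x
  proof -
    have lin: "linear (frechet_derivative g (at (f x)))"
      using d[OF that] linear_frechet_derivative by blast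
    have "frechet_derivative (g \<circ> f) (at x) v =
        frechet_derivative g (at (f x)) (\<Sum>b\<in>Basis. (frechet_derivative f (at x) v \<bullet> b) *\<^sub>R b)"
      using frechet_derivative_compose_at[OF d[OF that]] by (simp add: euclidean_representation)
    then show ?thesis
      by (simp add: linear_sum[OF lin] linear_scale[OF lin])
  qed
  ultimately show "continuous_on S (\<lambda>x. frechet_derivative (g \<circ> f) (at x) v)"
    by (force intro: continuous_on_eq)
qed

lemma C1_on_subset: "Ck_on 1 S f \<Longrightarrow> T \<subseteq> S \<Longrightarrow> Ck_on 1 T f"
  unfolding C1_on_iff using continuous_on_subset by blast

text \<open>Derivatives are taken at a point of the whole space, so agreement on \<open>S\<close>
  determines them only because \<open>S\<close> is open.\<close>

lemma C1_on_cong_open: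
  assumes "open S" "Ck_on 1 S g" "\<And>x. x \<in> S \<Longrightarrow> f x = g x"
  shows "Ck_on 1 S f"
  unfolding C1_on_iff
proof (intro conjI ballI allI)
  have *: "f differentiable (at x)" "frechet_derivative f (at x) = frechet_derivative g (at x)"
    if "x \<in> S" for x
    using frechet_derivative_cong_at[of S x f g] assms that C1_on_iff by blast+
  show "f differentiable (at x)" if "x \<in> S" for x using * that by blast
  show "continuous_on S (\<lambda>x. frechet_derivative f (at x) v)" for v
    using assms(2) * continuous_on_cong[of S S] unfolding C1_on_iff by simp
qed

lemma C1_on_locally:
  assumes "\<And>x. x \<in> S \<Longrightarrow> \<exists>O'. open O' \<and> x \<in> O' \<and> Ck_on 1 O' f"
  shows "Ck_on 1 S f"
  unfolding C1_on_iff
proof (intro conjI ballI allI)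
  show "f differentiable at x" if "x \<in> S" for x using assms[OF that] C1_on_iff by blast
  have "isCont (\<lambda>x. frechet_derivative f (at x) v) x" if "x \<in> S" for x v
    using assms[OF that] C1_on_iff continuous_on_eq_continuous_at by blast
  then show "continuous_on S (\<lambda>x. frechet_derivative f (at x) v)" for v
    using continuous_at_imp_continuous_on by blast
qed

text \<open>Mean value inequality on a convex set. Compactness of the ball bounds the sum of the
  norms of the derivative on basis vectors, and this sum dominates the operator norm.\<close>

lemma C1_on_imp_Lipschitz_on_cball:
  fixes f :: "'a::euclidean_space \<Rightarrow> 'b::real_normed_vector"
  assumes f: "Ck_on 1 (cball a r) f"
  shows "\<exists>C\<ge>0. \<forall>x\<in>cball a r. \<forall>y\<in>cball a r. dist (f x) (f y) \<le> C * dist x y"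
proof -
  define D where "D x = frechet_derivative f (at x)" for x
  have D: "(f has_derivative D x) (at x)" if "x \<in> cball a r" for x
    using f that frechet_derivative_works unfolding C1_on_iff D_def by blast
  have "continuous_on (cball a r) (\<lambda>x. \<Sum>b\<in>Basis. norm (D x b))"
    using f unfolding C1_on_iff D_def by (intro continuous_on_sum continuous_on_norm) auto
  then have "bounded ((\<lambda>x. \<Sum>b\<in>Basis. norm (D x b)) ` cball a r)"
    by (intro compact_imp_bounded compact_continuous_image compact_cball)
  then obtain B where B: "B > 0" "\<And>x. x \<in> cball a r \<Longrightarrow> norm (\<Sum>b\<in>Basis. norm (D x b)) \<le> B"
    unfolding bounded_pos by auto
  have "onorm (D x) \<le> B" if "x \<in> cball a r" for x
  proof (rule onorm_le)
    fix v
    have lin: "linear (D x)" using D[OF that] has_derivative_linear by blast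
    have "D x v = D x (\<Sum>b\<in>Basis. (v \<bullet> b) *\<^sub>R b)" by (simp add: euclidean_representation)
    also have "\<dots> = (\<Sum>b\<in>Basis. (v \<bullet> b) *\<^sub>R D x b)"
      by (simp add: linear_sum[OF lin] linear_scale[OF lin])
    also have "norm \<dots> \<le> (\<Sum>b\<in>Basis. norm v * norm (D x b))"
      by (rule norm_sum[THEN order_trans])
         (auto intro!: sum_mono mult_right_mono simp: Basis_le_norm)
    also have "\<dots> = norm (\<Sum>b\<in>Basis. norm (D x b)) * norm v"
      by (simp add: sum_distrib_left[symmetric] sum_nonneg mult.commute)
    also have "\<dots> \<le> B * norm v" using B(2)[OF that] mult_right_mono norm_ge_zero by blast
    finally show "norm (D x v) \<le> B * norm v" .
  qed
  then have "norm (f x - f y) \<le> B * norm (x - y)" if "x \<in> cball a r" "y \<in> cball a r" for x y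
    using differentiable_bound[of "cball a r" f D B] D has_derivative_at_withinI that by blast
  then show ?thesis using B(1) by (auto simp: dist_norm intro!: exI[of _ B])
qed

lemma C1_on_Pair_right:
  fixes a :: "'a::euclidean_space"
  shows "Ck_on 1 S (\<lambda>t::'b::euclidean_space. (a, t))"
proof -
  have D: "((\<lambda>t. (a, t)) has_derivative (\<lambda>v. (0, v))) (at t)" for t :: 'b
    by (auto intro!: derivative_eq_intros)
  then show ?thesis
    using frechet_derivative_at[OF D, symmetric] unfolding C1_on_iff
    by (auto simp: differentiable_def)
qed

lemma C1_on_snd: "Ck_on 1 S (snd :: 'a::euclidean_space \<times> 'b::euclidean_space \<Rightarrow> 'b)"
proof -
  have D: "(snd has_derivative snd) (at t)" for t :: "'a \<times> 'b"
    by (auto intro!: derivative_eq_intros)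
  then show ?thesis
    using frechet_derivative_at[OF D, symmetric] unfolding C1_on_iff
    by (auto simp: differentiable_def)
qed

section \<open>Charts of a foliated manifold\<close>

text \<open>The target is an arbitrary topology \<open>Y\<close>, so that the same facts serve the
  smooth charts and the foliation charts of \<open>M\<close> as well as the matchbox charts.\<close>

locale topological_chart =
  fixes M :: "'p topology" and U :: "'p set" and Y :: "'c topology" and \<phi> :: "'p \<Rightarrow> 'c"
  assumes openin_domain: "openin M U"
    and homeomorphic_chart: "homeomorphic_map (subtopology M U) Y \<phi>"
begin

abbreviation \<sigma> :: "'c \<Rightarrow> 'p" where "\<sigma> \<equiv> inv_into U \<phi>"

lemma domain_subset: "U \<subseteq> topspace M"
  using openin_domain openin_subset by blast

lemma chart_image: "\<phi> ` U = topspace Y"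
  using homeomorphic_imp_surjective_map[OF homeomorphic_chart] domain_subset
  by (simp add: Int_absorb1)

lemma inj_on_chart: "inj_on \<phi> U"
  using homeomorphic_imp_injective_map[OF homeomorphic_chart] domain_subset
  by (simp add: Int_absorb1)

lemma chart_in [simp]: "a \<in> U \<Longrightarrow> \<phi> a \<in> topspace Y"
  using chart_image by blast

lemma inverse_in [simp]: "p \<in> topspace Y \<Longrightarrow> \<sigma> p \<in> U"
  by (simp add: chart_image[symmetric] inv_into_into)

lemma chart_inverse [simp]: "p \<in> topspace Y \<Longrightarrow> \<phi> (\<sigma> p) = p"
  using chart_image by (simp add: f_inv_into_f)

lemma inverse_chart [simp]: "a \<in> U \<Longrightarrow> \<sigma> (\<phi> a) = a"
  using inj_on_chart by simp

lemma continuous_chart: "continuous_map (subtopology M U) Y \<phi>"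
  using homeomorphic_chart homeomorphic_imp_continuous_map by blast

lemma openin_chart_image:
  assumes "openin M N" "N \<subseteq> U" shows "openin Y (\<phi> ` N)"
  using assms homeomorphic_map_openness[OF homeomorphic_chart, of N] domain_subset openin_domain
  by (auto simp: openin_open_subtopology)

lemma openin_chart_preimage:
  assumes "openin Y P" shows "openin M {a \<in> U. \<phi> a \<in> P}"
  using openin_continuous_map_preimage[OF continuous_chart assms] openin_domain domain_subset
  by (simp add: openin_open_subtopology Int_absorb1)

lemma continuous_inverse: "continuous_map Y M \<sigma>"
proof -
  have "openin Y {p \<in> topspace Y. \<sigma> p \<in> N}" if "openin M N" for N
  proof -
    have "{p \<in> topspace Y. \<sigma> p \<in> N} = \<phi> ` (N \<inter> U)"
      using chart_image by (force simp: image_iff)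
    then show ?thesis
      using openin_chart_image[of "N \<inter> U"] that openin_domain by auto
  qed
  then show ?thesis
    using domain_subset inverse_in by (auto simp: continuous_map_def)
qed

end

locale foliated_manifold =
  fixes M :: "'p topology" and S :: "('p, 'e::euclidean_space) chart set"
    and F :: "('p, (real^'k) \<times> (real^'q)) chart set"
  assumes smooth_manifold: "smooth_manifold M S" and C1_foliation: "C1_foliation M S F"
begin

abbreviation chart_box :: "((real^'k) \<times> (real^'q)) set" where
  "chart_box \<equiv> box (-1) 1 \<times> box (-1) 1"

lemma chart: "(U, \<phi>) \<in> F \<Longrightarrow> topological_chart M U (top_of_set chart_box) \<phi>"
  using C1_foliation unfolding C1_foliation_def by unfold_locales auto

lemma charts_cover: "z \<in> topspace M \<Longrightarrow> \<exists>U \<phi>. (U, \<phi>) \<in> F \<and> z \<in> U"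
  using C1_foliation unfolding C1_foliation_def by blast

lemma manifold_charts_cover: "z \<in> topspace M \<Longrightarrow> \<exists>V \<psi>. (V, \<psi>) \<in> S \<and> z \<in> V"
proof -
  assume "z \<in> topspace M"
  also have "topspace M = (\<Union>(U, \<psi>)\<in>S. U)"
    using smooth_manifold unfolding smooth_manifold_def by simp
  finally show ?thesis by auto
qed

lemma manifold_chart: "(V, \<psi>) \<in> S \<Longrightarrow> topological_chart M V (top_of_set (\<psi> ` V)) \<psi>"
  using smooth_manifold unfolding smooth_manifold_def by unfold_locales auto

lemma open_chart_image:
  assumes "(U, \<phi>) \<in> F" "openin M N" "N \<subseteq> U" shows "open (\<phi> ` N)"
proof -
  interpret topological_chart M U "top_of_set chart_box" \<phi> using chart assms(1) .
  show ?thesis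
    using openin_chart_image[OF assms(2,3)] by (simp add: openin_open_eq open_Times open_box)
qed

lemma openin_chart_vimage:
  assumes "(U, \<phi>) \<in> F" "open P" shows "openin M {a \<in> U. \<phi> a \<in> P}"
proof -
  interpret topological_chart M U "top_of_set chart_box" \<phi> using chart assms(1) .
  have "openin (top_of_set chart_box) (chart_box \<inter> P)"
    using assms(2) by (simp add: openin_open_Int)
  from openin_chart_preimage[OF this] show ?thesis
    using chart_in by (auto elim: back_subst[of "openin M"])
qed

text \<open>The product shape matters: it allows the leaf coordinate to be moved to a prescribed
  value while the transverse one is kept, without leaving \<open>N\<close>.\<close>

lemma product_ball_in_chart:
  assumes F: "(U, \<phi>) \<in> F" and "openin M N" "z \<in> N" "N \<subseteq> U"
  obtains r where "r > 0" "ball (fst (\<phi> z)) r \<times> ball (snd (\<phi> z)) r \<subseteq> \<phi> ` N"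
proof -
  have "open (\<phi> ` N)" using open_chart_image assms by blast
  then obtain A B where AB: "open A" "open B" "\<phi> z \<in> A \<times> B" "A \<times> B \<subseteq> \<phi> ` N"
    using \<open>z \<in> N\<close> by (metis imageI open_prod_elim)
  obtain r s where "r > 0" "ball (fst (\<phi> z)) r \<subseteq> A" "s > 0" "ball (snd (\<phi> z)) s \<subseteq> B"
    using openE[OF AB(1)] openE[OF AB(2)] AB(3) by (metis mem_Times_iff)
  then have "ball (fst (\<phi> z)) (min r s) \<times> ball (snd (\<phi> z)) (min r s) \<subseteq> A \<times> B"
    by (intro Sigma_mono) auto
  then show thesis
    using AB(4) \<open>r > 0\<close> \<open>s > 0\<close> by (intro that[of "min r s"]) auto
qed

lemma transition_manifold_C1:
  assumes "(U, \<phi>) \<in> F" "(V, \<psi>) \<in> S"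
  shows "Ck_on 1 (\<phi> ` (U \<inter> V)) (transition (U, \<phi>) (V, \<psi>))"
    and "Ck_on 1 (\<psi> ` (U \<inter> V)) (transition (V, \<psi>) (U, \<phi>))"
proof -
  have "\<forall>c\<in>F. \<forall>s\<in>S. Ck_on 1 (snd c ` (fst c \<inter> fst s)) (transition c s) \<and>
                   Ck_on 1 (snd s ` (fst c \<inter> fst s)) (transition s c)"
    using C1_foliation unfolding C1_foliation_def by (elim conjE) assumption
  from bspec[OF bspec[OF this assms(1)] assms(2)]
  show "Ck_on 1 (\<phi> ` (U \<inter> V)) (transition (U, \<phi>) (V, \<psi>))"
    "Ck_on 1 (\<psi> ` (U \<inter> V)) (transition (V, \<psi>) (U, \<phi>))"
    by (simp_all only: fst_conv snd_conv)
qed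

text \<open>The foliation relates its charts only to those of the smooth structure, so near each
  point the transition is factored through a smooth chart.\<close>

lemma transition_C1:
  assumes F: "(U, \<phi>) \<in> F" "(U', \<phi>') \<in> F"
  shows "Ck_on 1 (\<phi> ` (U \<inter> U')) (transition (U, \<phi>) (U', \<phi>'))"
proof (rule C1_on_locally)
  fix p assume "p \<in> \<phi> ` (U \<inter> U')"
  then obtain z where z: "z \<in> U" "z \<in> U'" "p = \<phi> z" by blast
  interpret c: topological_chart M U "top_of_set chart_box" \<phi> using chart F(1) .
  interpret c': topological_chart M U' "top_of_set chart_box" \<phi>' using chart F(2) .
  obtain V \<psi> where V: "(V, \<psi>) \<in> S" "z \<in> V"
    using manifold_charts_cover z c.domain_subset by blast
  interpret s: topological_chart M V "top_of_set (\<psi> ` V)" \<psi> using manifold_chart V(1) .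
  define N where "N = U \<inter> U' \<inter> V"
  have N: "openin M N" "N \<subseteq> U"
    unfolding N_def using c.openin_domain c'.openin_domain s.openin_domain by auto
  have "open (\<phi> ` N)" using open_chart_image F N by blast
  note CS = transition_manifold_C1(1)[OF F(1) V(1)] transition_manifold_C1(2)[OF F(2) V(1)]
  have "Ck_on 1 (\<phi> ` N) (transition (V, \<psi>) (U', \<phi>') \<circ> transition (U, \<phi>) (V, \<psi>))"
    by (rule C1_on_compose[OF C1_on_subset[OF CS(1)] CS(2)])
       (auto simp: N_def transition_def)
  then have "Ck_on 1 (\<phi> ` N) (transition (U, \<phi>) (U', \<phi>'))"
    by (rule C1_on_cong_open[OF \<open>open (\<phi> ` N)\<close>]) (auto simp: N_def transition_def)
  then show "\<exists>O'. open O' \<and> p \<in> O' \<and> Ck_on 1 O' (transition (U, \<phi>) (U', \<phi>'))"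
    using \<open>open (\<phi> ` N)\<close> V z unfolding N_def by blast
qed

lemma transverse_coordinate_locally:
  assumes "(U, \<phi>) \<in> F" "(U', \<phi>') \<in> F" "z \<in> U \<inter> U'"
  shows "\<exists>W. openin M W \<and> z \<in> W \<and> W \<subseteq> U \<inter> U' \<and>
        (\<forall>x\<in>W. \<forall>y\<in>W. snd (\<phi> x) = snd (\<phi> y) \<longrightarrow> snd (\<phi>' x) = snd (\<phi>' y))"
proof -
  have "\<forall>(U, \<phi>)\<in>F. \<forall>(U', \<phi>')\<in>F. \<forall>z\<in>U \<inter> U'. \<exists>W. openin M W \<and> z \<in> W \<and> W \<subseteq> U \<inter> U' \<and>
        (\<forall>x\<in>W. \<forall>y\<in>W. snd (\<phi> x) = snd (\<phi> y) \<longrightarrow> snd (\<phi>' x) = snd (\<phi>' y))"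
    using C1_foliation unfolding C1_foliation_def by (rule conjunct2[OF conjunct2[OF conjunct2]])
  from bspec[OF bspec[OF bspec[OF this assms(1), unfolded prod.case] assms(2), unfolded prod.case] assms(3)]
  show ?thesis .
qed

text \<open>The foliation axiom gives one implication near \<open>z\<close>; it is applied in both
  orders of the charts and the neighbourhoods are intersected. The equivalence stays local because a
  plaque of \<open>U\<close> can meet several plaques of \<open>U'\<close> in the whole
  overlap.\<close>

lemma same_plaque_locally:
  assumes F: "(U, \<phi>) \<in> F" "(U', \<phi>') \<in> F" and z: "z \<in> U" "z \<in> U'"
  obtains W where "openin M W" "z \<in> W" "W \<subseteq> U \<inter> U'"
    "\<And>x y. x \<in> W \<Longrightarrow> y \<in> W \<Longrightarrow> snd (\<phi> x) = snd (\<phi> y) \<longleftrightarrow> snd (\<phi>' x) = snd (\<phi>' y)"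
proof -
  obtain W where W: "openin M W \<and> z \<in> W \<and> W \<subseteq> U \<inter> U' \<and>
        (\<forall>x\<in>W. \<forall>y\<in>W. snd (\<phi> x) = snd (\<phi> y) \<longrightarrow> snd (\<phi>' x) = snd (\<phi>' y))"
    using transverse_coordinate_locally[OF F IntI[OF z]] ..
  obtain W' where W': "openin M W' \<and> z \<in> W' \<and> W' \<subseteq> U' \<inter> U \<and>
        (\<forall>x\<in>W'. \<forall>y\<in>W'. snd (\<phi>' x) = snd (\<phi>' y) \<longrightarrow> snd (\<phi> x) = snd (\<phi> y))"
    using transverse_coordinate_locally[OF F(2,1) IntI[OF z(2,1)]] ..
  show thesis
  proof (rule that[of "W \<inter> W'"])
    show "snd (\<phi> x) = snd (\<phi> y) \<longleftrightarrow> snd (\<phi>' x) = snd (\<phi>' y)" if "x \<in> W \<inter> W'" "y \<in> W \<inter> W'" for x y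
      using that W W' by blast
  qed (use W W' in auto)
qed

lemma transverse_Lipschitz:
  assumes F: "(U, \<phi>) \<in> F" "(U', \<phi>') \<in> F" and z: "z \<in> U" "z \<in> U'"
  obtains W C where "openin M W" "z \<in> W" "W \<subseteq> U \<inter> U'" "C \<ge> 0"
    "\<And>x y. x \<in> W \<Longrightarrow> y \<in> W \<Longrightarrow>
       dist (snd (\<phi>' x)) (snd (\<phi>' y)) \<le> C * dist (snd (\<phi> x)) (snd (\<phi> y))"
proof -
  interpret c: topological_chart M U "top_of_set chart_box" \<phi> using chart F(1) .
  obtain W where W: "openin M W" "z \<in> W" "W \<subseteq> U \<inter> U'"
    "\<And>x y. x \<in> W \<Longrightarrow> y \<in> W \<Longrightarrow> snd (\<phi> x) = snd (\<phi> y) \<longleftrightarrow> snd (\<phi>' x) = snd (\<phi>' y)"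
    using same_plaque_locally[OF F z] by metis
  obtain r where r: "r > 0" "ball (fst (\<phi> z)) r \<times> ball (snd (\<phi> z)) r \<subseteq> \<phi> ` W"
    using product_ball_in_chart[OF F(1) W(1,2)] W(3) by (metis le_inf_iff)
  define x0 t0 where "x0 = fst (\<phi> z)" and "t0 = snd (\<phi> z)"
  define \<gamma> where "\<gamma> t = snd (transition (U, \<phi>) (U', \<phi>') (x0, t))" for t
  have sub: "Pair x0 ` cball t0 (r/2) \<subseteq> \<phi> ` W"
  proof -
    have "Pair x0 ` cball t0 (r/2) \<subseteq> ball x0 r \<times> ball t0 r" using r(1) by auto
    then show ?thesis using r(2) unfolding x0_def t0_def by blast
  qed
  have "Ck_on 1 (cball t0 (r/2)) (snd \<circ> (transition (U, \<phi>) (U', \<phi>') \<circ> Pair x0))"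
    by (rule C1_on_compose[OF C1_on_compose[OF C1_on_Pair_right transition_C1[OF F]] C1_on_snd[of UNIV]])
       (use subset_trans[OF sub image_mono[OF W(3)]] in simp_all)
  moreover have "snd \<circ> (transition (U, \<phi>) (U', \<phi>') \<circ> Pair x0) = \<gamma>"
    by (simp add: \<gamma>_def fun_eq_iff)
  ultimately have "Ck_on 1 (cball t0 (r/2)) \<gamma>" by (simp only:)
  then obtain C where C: "C \<ge> 0" "\<And>s t. s \<in> cball t0 (r/2) \<Longrightarrow> t \<in> cball t0 (r/2) \<Longrightarrow>
      dist (\<gamma> s) (\<gamma> t) \<le> C * dist s t"
    using C1_on_imp_Lipschitz_on_cball by metis
  define W' where "W' = W \<inter> {a \<in> U. \<phi> a \<in> UNIV \<times> ball t0 (r/2)}"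
  have "openin M W'"
    unfolding W'_def by (intro openin_Int W openin_chart_vimage[OF F(1)] open_Times) auto
  \<comment> \<open>\<open>b\<close> is the point over \<open>x0\<close> on the \<phi>-plaque of
    \<open>a\<close>. Since both lie in \<open>W\<close>, they also share their
    \<phi>'-plaque.\<close>
  have \<gamma>: "snd (\<phi>' a) = \<gamma> (snd (\<phi> a))" if "a \<in> W'" for a
  proof -
    have "(x0, snd (\<phi> a)) \<in> \<phi> ` W" using that sub by (auto simp: W'_def mem_Times_iff)
    then obtain b where b: "b \<in> W" "\<phi> b = (x0, snd (\<phi> a))" by auto
    then have "snd (\<phi>' b) = snd (\<phi>' a)" using W(4)[of b a] that by (auto simp: W'_def)
    moreover have "\<gamma> (snd (\<phi> a)) = snd (\<phi>' b)"
      using b W(3) unfolding \<gamma>_def transition_def b(2)[symmetric] by auto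
    ultimately show ?thesis by simp
  qed
  show thesis
  proof (rule that[OF \<open>openin M W'\<close>])
    show "dist (snd (\<phi>' x)) (snd (\<phi>' y)) \<le> C * dist (snd (\<phi> x)) (snd (\<phi> y))"
      if "x \<in> W'" "y \<in> W'" for x y
      using C(2)[of "snd (\<phi> x)" "snd (\<phi> y)"] that \<gamma> by (auto simp: W'_def mem_Times_iff)
  qed (use W z r C in \<open>auto simp: W'_def t0_def mem_Times_iff\<close>)
qed

end

section \<open>Slices of constant leaf coordinate as transversals\<close>

context foliated_manifold
begin

lemma transversal_coordinate_C1:
  assumes F: "(U, \<phi>) \<in> F" "(U', \<phi>') \<in> F"
  shows "Ck_on 1 {t. (x, t) \<in> \<phi> ` (U \<inter> U')} (transition (U, \<phi>) (U', \<phi>') \<circ> Pair x)"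
    and "Ck_on 1 {t. (x, t) \<in> \<phi> ` (U \<inter> U')} (snd \<circ> (transition (U, \<phi>) (U', \<phi>') \<circ> Pair x))"
proof -
  show *: "Ck_on 1 {t. (x, t) \<in> \<phi> ` (U \<inter> U')} (transition (U, \<phi>) (U', \<phi>') \<circ> Pair x)"
    by (rule C1_on_compose[OF C1_on_Pair_right transition_C1[OF F]]) blast
  show "Ck_on 1 {t. (x, t) \<in> \<phi> ` (U \<inter> U')} (snd \<circ> (transition (U, \<phi>) (U', \<phi>') \<circ> Pair x))"
    by (rule C1_on_compose[OF * C1_on_snd[of UNIV]]) simp
qed

lemma continuous_slices:
  assumes F: "(U, \<phi>) \<in> F"
  shows "x \<in> box (-1) 1 \<Longrightarrow> continuous_map (top_of_set (box (-1) 1)) M (\<lambda>t. inv_into U \<phi> (x, t))"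
    and "t \<in> box (-1) 1 \<Longrightarrow> continuous_map (top_of_set (box (-1) 1)) M (\<lambda>x. inv_into U \<phi> (x, t))"
proof -
  interpret c: topological_chart M U "top_of_set chart_box" \<phi> using chart F .
  show "continuous_map (top_of_set (box (-1) 1)) M (\<lambda>t. inv_into U \<phi> (x, t))" if "x \<in> box (-1) 1"
  proof -
    have "continuous_map (top_of_set (box (-1) 1)) (top_of_set chart_box) (Pair x)"
      using that by (auto intro: continuous_on_Pair continuous_on_const continuous_on_id)
    from continuous_map_compose[OF this c.continuous_inverse] show ?thesis by (simp add: comp_def)
  qed
  show "continuous_map (top_of_set (box (-1) 1)) M (\<lambda>x. inv_into U \<phi> (x, t))" if "t \<in> box (-1) 1"
  proof -
    have "continuous_map (top_of_set (box (-1) 1)) (top_of_set chart_box) (\<lambda>x. (x, t))"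
      using that by (auto intro: continuous_on_Pair continuous_on_const continuous_on_id)
    from continuous_map_compose[OF this c.continuous_inverse] show ?thesis by (simp add: comp_def)
  qed
qed

lemma open_slice_preimage:
  assumes F: "(U, \<phi>) \<in> F" and "openin M N"
  shows "x \<in> box (-1) 1 \<Longrightarrow> open {t \<in> box (-1) 1. inv_into U \<phi> (x, t) \<in> N}"
    and "t \<in> box (-1) 1 \<Longrightarrow> open {x \<in> box (-1) 1. inv_into U \<phi> (x, t) \<in> N}"
  using openin_continuous_map_preimage[OF continuous_slices(1)[OF F] \<open>openin M N\<close>]
    openin_continuous_map_preimage[OF continuous_slices(2)[OF F] \<open>openin M N\<close>]
  by (simp_all add: openin_open_eq open_box)

text \<open>The two transverse coordinate changes are inverse to each other.\<close>

lemma bij_transverse_derivative: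
  assumes F: "(U, \<phi>) \<in> F" "(U', \<phi>') \<in> F" and x: "x \<in> box (-1) 1" and u: "u \<in> box (-1) 1"
    and uU': "inv_into U \<phi> (x, u) \<in> U'"
  shows "bij (frechet_derivative (snd \<circ> (transition (U, \<phi>) (U', \<phi>') \<circ> Pair x)) (at u))"
proof -
  interpret c: topological_chart M U "top_of_set chart_box" \<phi> using chart F(1) .
  interpret c': topological_chart M U' "top_of_set chart_box" \<phi>' using chart F(2) .
  define z where "z = c.\<sigma> (x, u)"
  have zU: "z \<in> U" and zU': "z \<in> U'" and \<phi>z: "\<phi> z = (x, u)"
    using x u uU' by (simp_all add: z_def)
  obtain W where W: "openin M W" "z \<in> W" "W \<subseteq> U \<inter> U'"
    "\<And>x y. x \<in> W \<Longrightarrow> y \<in> W \<Longrightarrow> snd (\<phi> x) = snd (\<phi> y) \<longleftrightarrow> snd (\<phi>' x) = snd (\<phi>' y)"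
    using same_plaque_locally[OF F zU zU'] by metis
  obtain r where r: "r > 0" "ball (fst (\<phi>' z)) r \<times> ball (snd (\<phi>' z)) r \<subseteq> \<phi>' ` W"
    using product_ball_in_chart[OF F(2) W(1,2)] W(3) by (metis le_inf_iff)
  define x' where "x' = fst (\<phi>' z)"
  define \<gamma> where "\<gamma> = snd \<circ> (transition (U, \<phi>) (U', \<phi>') \<circ> Pair x)"
  define \<delta> where "\<delta> = snd \<circ> (transition (U', \<phi>') (U, \<phi>) \<circ> Pair x')"
  \<comment> \<open>In \<open>N\<close> the \<phi>'-transverse coordinate stays in the ball, so
    every plaque through \<open>N\<close> has a point of \<open>W\<close> over the leaf coordinate
    \<open>x'\<close>, where \<delta> is evaluated.\<close>
  define N where "N = W \<inter> {a \<in> U'. \<phi>' a \<in> UNIV \<times> ball (snd (\<phi>' z)) r}"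
  have "openin M N"
    unfolding N_def by (intro openin_Int W openin_chart_vimage[OF F(2)] open_Times) auto
  then have "open {t \<in> box (-1) 1. c.\<sigma> (x, t) \<in> N}"
    using open_slice_preimage(1)[OF F(1) _ x] by simp
  moreover have "u \<in> {t \<in> box (-1) 1. c.\<sigma> (x, t) \<in> N}"
    using u W r zU' z_def by (simp add: N_def mem_Times_iff)
  moreover have \<delta>\<gamma>: "(\<delta> \<circ> \<gamma>) t = id t" if "t \<in> {t \<in> box (-1) 1. c.\<sigma> (x, t) \<in> N}" for t
  proof -
    define a where "a = c.\<sigma> (x, t)"
    have a: "a \<in> N" "a \<in> W" "a \<in> U" "a \<in> U'" "\<phi> a = (x, t)" using that x W(3) by (auto simp: a_def N_def)
    then have "(x', snd (\<phi>' a)) \<in> ball (fst (\<phi>' z)) r \<times> ball (snd (\<phi>' z)) r"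
      using r(1) unfolding x'_def by (simp add: N_def mem_Times_iff)
    then obtain b where b: "b \<in> W" "\<phi>' b = (x', snd (\<phi>' a))" using r(2) by fastforce
    then have "snd (\<phi> b) = snd (\<phi> a)" using W(4)[of b a] a by simp
    moreover have "\<delta> (\<gamma> t) = snd (\<phi> b)"
      using b W(3) a unfolding \<delta>_def \<gamma>_def
      by (auto simp: transition_def a_def[symmetric] b(2)[symmetric])
    ultimately show ?thesis using a by simp
  qed
  ultimately have D\<delta>\<gamma>: "((\<delta> \<circ> \<gamma>) has_derivative id) (at u)"
    by (intro has_derivative_transform_within_open[OF has_derivative_id]) (assumption | rule sym)+
  have \<gamma>u: "\<gamma> u = snd (\<phi>' z)"
    unfolding \<gamma>_def transition_def z_def by simp
  have "u \<in> {t. (x, t) \<in> \<phi> ` (U \<inter> U')}"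
    using zU zU' \<phi>z by (auto intro!: image_eqI[of _ _ z])
  then have d\<gamma>: "\<gamma> differentiable (at u)"
    using transversal_coordinate_C1(2)[OF F, of x] unfolding \<gamma>_def[symmetric] C1_on_iff by (elim conjE bspec)
  moreover have "snd (\<phi>' z) \<in> {t. (x', t) \<in> \<phi>' ` (U' \<inter> U)}"
    using zU zU' by (auto simp: x'_def intro!: image_eqI[of _ _ z])
  then have "\<delta> differentiable (at (\<gamma> u))"
    using transversal_coordinate_C1(2)[OF F(2,1), of x'] unfolding \<delta>_def[symmetric] C1_on_iff \<gamma>u
    by (elim conjE bspec)
  ultimately have "frechet_derivative (\<delta> \<circ> \<gamma>) (at u) =
      frechet_derivative \<delta> (at (\<gamma> u)) \<circ> frechet_derivative \<gamma> (at u)"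
    by (rule frechet_derivative_compose_at)
  \<comment> \<open>The composite derivative is the identity, so the inner one is injective; as a
    linear map of \<open>real^'q\<close> to itself it is then bijective.\<close>
  with frechet_derivative_at[OF D\<delta>\<gamma>]
  have "inj (frechet_derivative \<gamma> (at u))" by (metis inj_on_id inj_on_imageI2)
  moreover have "linear (frechet_derivative \<gamma> (at u))" using d\<gamma> linear_frechet_derivative by blast
  ultimately show ?thesis
    unfolding \<gamma>_def[symmetric] using linear_injective_imp_surjective bij_def by blast
qed

text \<open>Supplies the transversal to which exceptionality is applied. Transversality has to be
  checked in every foliation chart, not just in \<phi>, which is the purpose of
  \<open>bij_transverse_derivative\<close>.\<close>

lemma local_transversal_slice:
  assumes F: "(U, \<phi>) \<in> F" and x: "x \<in> box (-1) 1"
  shows "local_transversal M F {a \<in> U. fst (\<phi> a) = x}"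
proof -
  interpret c: topological_chart M U "top_of_set chart_box" \<phi> using chart F .
  define T where "T = {a \<in> U. fst (\<phi> a) = x}"
  define \<tau> where "\<tau> t = c.\<sigma> (x, t)" for t
  have box: "snd (\<phi> a) \<in> box (-1) 1" if "a \<in> U" for a
    using c.chart_in[OF that] by (simp add: mem_Times_iff)
  have "homeomorphic_maps (top_of_set (box (-1) 1)) (subtopology M T) \<tau> (snd \<circ> \<phi>)"
    unfolding homeomorphic_maps_def
  proof (intro conjI ballI)
    show "continuous_map (top_of_set (box (-1) 1)) (subtopology M T) \<tau>"
      using continuous_slices(1)[OF F x] x
      by (auto simp: continuous_map_in_subtopology \<tau>_def[abs_def] T_def)
    have "continuous_map (subtopology M U) euclidean (snd \<circ> \<phi>)"
      using c.continuous_chart continuous_map_compose[of _ euclidean \<phi> euclidean snd]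
      by (auto simp: continuous_map_in_subtopology continuous_on_snd intro: continuous_on_id)
    then have "continuous_map (subtopology M T) euclidean (snd \<circ> \<phi>)"
      by (rule continuous_map_from_subtopology_mono) (auto simp: T_def)
    then show "continuous_map (subtopology M T) (top_of_set (box (-1) 1)) (snd \<circ> \<phi>)"
      using box by (auto simp: continuous_map_in_subtopology T_def)
    show "(snd \<circ> \<phi>) (\<tau> t) = t" if "t \<in> topspace (top_of_set (box (-1) 1))" for t
      using that x by (simp add: \<tau>_def)
    show "\<tau> ((snd \<circ> \<phi>) a) = a" if "a \<in> topspace (subtopology M T)" for a
      using that by (auto simp: \<tau>_def T_def)
  qed
  then have hom: "homeomorphic_map (top_of_set (box (-1) 1)) (subtopology M T) \<tau>"
    using homeomorphic_map_maps by blast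
  have "Ck_on 1 {u \<in> box (-1) 1. \<tau> u \<in> U'} (\<phi>' \<circ> \<tau>) \<and>
      (\<forall>u\<in>box (-1) 1. \<tau> u \<in> U' \<longrightarrow> bij (frechet_derivative (snd \<circ> \<phi>' \<circ> \<tau>) (at u)))"
    if F': "(U', \<phi>') \<in> F" for U' \<phi>'
  proof -
    have eq: "\<phi>' \<circ> \<tau> = transition (U, \<phi>) (U', \<phi>') \<circ> Pair x"
      by (auto simp: \<tau>_def transition_def)
    have sub: "{u \<in> box (-1) 1. \<tau> u \<in> U'} \<subseteq> {t. (x, t) \<in> \<phi> ` (U \<inter> U')}"
    proof clarify
      fix u assume "u \<in> box (-1) 1" "\<tau> u \<in> U'"
      then have "\<tau> u \<in> U \<inter> U'" "\<phi> (\<tau> u) = (x, u)" using x by (simp_all add: \<tau>_def)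
      then show "(x, u) \<in> \<phi> ` (U \<inter> U')" by (metis imageI)
    qed
    show ?thesis
      unfolding eq comp_assoc
      using C1_on_subset[OF transversal_coordinate_C1(1)[OF F F'] sub]
        bij_transverse_derivative[OF F F' x] unfolding \<tau>_def by blast
  qed
  then show ?thesis
    unfolding local_transversal_def T_def[symmetric]
    using hom c.domain_subset T_def
    by (intro exI[of _ "box (-1) 1"] exI[of _ \<tau>]) (auto simp: open_box)
qed

text \<open>Exceptionality yields a Cantor set only on some smaller transversal inside a slice. Its
  parametrization followed by the transverse coordinate is a continuous injection between subsets of
  \<open>real^'q\<close>, so by invariance of domain it still covers an open set of plaques.\<close>

lemma open_coordinates_of_transversal:
  assumes F: "(U, \<phi>) \<in> F" and T: "local_transversal M F T" and sub: "T \<subseteq> {a \<in> U. fst (\<phi> a) = x}"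
  shows "open ((snd \<circ> \<phi>) ` T)"
proof -
  interpret c: topological_chart M U "top_of_set chart_box" \<phi> using chart F .
  obtain D :: "(real^'q) set" and \<tau> where D: "open D" "T \<subseteq> topspace M"
    "homeomorphic_map (top_of_set D) (subtopology M T) \<tau>"
    and C1: "\<forall>(U, \<phi>)\<in>F. Ck_on 1 {u \<in> D. \<tau> u \<in> U} (\<phi> \<circ> \<tau>) \<and>
           (\<forall>u\<in>D. \<tau> u \<in> U \<longrightarrow> bij (frechet_derivative (snd \<circ> \<phi> \<circ> \<tau>) (at u)))"
    using T unfolding local_transversal_def by blast
  have \<tau>: "\<tau> ` D = T" "inj_on \<tau> D"
    using homeomorphic_imp_surjective_map[OF D(3)] homeomorphic_imp_injective_map[OF D(3)] D(2)
    by (auto simp: Int_absorb1)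
  have "{u \<in> D. \<tau> u \<in> U} = D" using \<tau>(1) sub by blast
  then have "Ck_on 1 D (\<phi> \<circ> \<tau>)" using bspec[OF C1 F] by (simp only: prod.case)
  then have "continuous_on D (\<phi> \<circ> \<tau>)"
    unfolding C1_on_iff
    by (meson continuous_at_imp_continuous_on differentiable_imp_continuous_within)
  then have "continuous_on D (\<lambda>u. snd ((\<phi> \<circ> \<tau>) u))" by (rule continuous_on_snd)
  moreover have "inj_on (\<lambda>u. snd ((\<phi> \<circ> \<tau>) u)) D"
  proof (rule inj_onI)
    fix u v assume uv: "u \<in> D" "v \<in> D" "snd ((\<phi> \<circ> \<tau>) u) = snd ((\<phi> \<circ> \<tau>) v)"
    then have "\<tau> u \<in> U" "\<tau> v \<in> U" "fst (\<phi> (\<tau> u)) = fst (\<phi> (\<tau> v))" using \<tau>(1) sub by blast+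
    then have "\<tau> u = \<tau> v" using uv(3) c.inj_on_chart by (auto simp: inj_on_def prod_eq_iff)
    then show "u = v" using uv \<tau>(2) by (simp add: inj_on_eq_iff)
  qed
  ultimately have "open ((\<lambda>u. snd ((\<phi> \<circ> \<tau>) u)) ` D)"
    using invariance_of_domain D(1) by blast
  also have "(\<lambda>u. snd ((\<phi> \<circ> \<tau>) u)) ` D = (snd \<circ> \<phi>) ` T" using \<tau>(1) by (auto simp: image_image)
  finally show ?thesis .
qed

section \<open>The Cantor condition, plaques and saturation in a foliation chart\<close>

lemma connectedin_cantor_space:
  assumes "connectedin cantor_space E" "a \<in> E" "b \<in> E" shows "a = b"
proof
  fix i
  have "continuous_map cantor_space (discrete_topology UNIV) (\<lambda>x. x i)"
    unfolding cantor_space_def by (rule continuous_map_product_projection) simp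
  then have "connectedin (discrete_topology UNIV) ((\<lambda>x. x i) ` E)"
    using assms(1) connectedin_continuous_map_image by blast
  then show "a i = b i" using assms(2,3) unfolding connectedin_discrete_topology by blast
qed

text \<open>Puts the Cantor condition into coordinates. \<open>B\<close> is the set of transverse
  coordinates of the smaller transversal \<open>T\<close>; a connected \<open>C\<close> lifts to the
  slice through \<open>z\<close> as a connected subset of \<open>T \<inter> Z\<close>, which is a
  Cantor set.\<close>

lemma transversally_totally_disconnected:
  assumes Z: "exceptional_minimal_set M F Z" and F: "(U, \<phi>) \<in> F" and z: "z \<in> U" "z \<in> Z"
  obtains B where "open B" "snd (\<phi> z) \<in> B" "B \<subseteq> box (-1) 1"
    "\<And>C s t. \<lbrakk>connected C; C \<subseteq> B; \<And>t. t \<in> C \<Longrightarrow> inv_into U \<phi> (fst (\<phi> z), t) \<in> Z; s \<in> C; t \<in> C\<rbrakk> \<Longrightarrow> s = t"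
proof -
  interpret c: topological_chart M U "top_of_set chart_box" \<phi> using chart F .
  define x where "x = fst (\<phi> z)"
  have x: "x \<in> box (-1) 1" using c.chart_in[OF z(1)] by (simp add: mem_Times_iff x_def)
  have "local_transversal M F {a \<in> U. fst (\<phi> a) = x} \<and> z \<in> {a \<in> U. fst (\<phi> a) = x} \<inter> Z"
    using local_transversal_slice[OF F x] z by (simp add: x_def)
  moreover have "\<forall>T z. local_transversal M F T \<and> z \<in> T \<inter> Z \<longrightarrow>
      (\<exists>T'\<subseteq>T. local_transversal M F T' \<and> z \<in> T' \<and>
         subtopology M (T' \<inter> Z) homeomorphic_space cantor_space)"
    using Z unfolding exceptional_minimal_set_def by (rule conjunct2)
  ultimately have "\<exists>T'\<subseteq>{a \<in> U. fst (\<phi> a) = x}. local_transversal M F T' \<and> z \<in> T' \<and>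
      subtopology M (T' \<inter> Z) homeomorphic_space cantor_space"
    by (elim allE impE)
  then obtain T where
    T: "T \<subseteq> {a \<in> U. fst (\<phi> a) = x}" "local_transversal M F T" "z \<in> T"
      "subtopology M (T \<inter> Z) homeomorphic_space cantor_space"
    by (elim exE conjE)
  obtain h where h: "homeomorphic_map (subtopology M (T \<inter> Z)) cantor_space h"
    using T(4) unfolding homeomorphic_space ..
  show thesis
  proof (rule that[of "(snd \<circ> \<phi>) ` T"])
    show "open ((snd \<circ> \<phi>) ` T)" using open_coordinates_of_transversal[OF F T(2,1)] .
    show sub: "(snd \<circ> \<phi>) ` T \<subseteq> box (-1) 1"
    proof
      fix t assume "t \<in> (snd \<circ> \<phi>) ` T"
      then obtain a where "a \<in> U" "t = snd (\<phi> a)" using T(1) by auto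
      then show "t \<in> box (-1) 1" using c.chart_in[of a] by (simp add: mem_Times_iff)
    qed
    fix C s t
    assume C: "connected C" "C \<subseteq> (snd \<circ> \<phi>) ` T" "\<And>t. t \<in> C \<Longrightarrow> c.\<sigma> (fst (\<phi> z), t) \<in> Z"
      and st: "s \<in> C" "t \<in> C"
    define E where "E = (\<lambda>t. c.\<sigma> (x, t)) ` C"
    have Cbox: "C \<subseteq> box (-1) 1" using C(2) sub by (rule subset_trans)
    have "connectedin (top_of_set (box (-1) 1)) C"
      using C(1) Cbox by (simp add: connectedin_subtopology)
    then have "connectedin M E"
      unfolding E_def by (rule connectedin_continuous_map_image[OF continuous_slices(1)[OF F x]])
    \<comment> \<open>A lifted point has the coordinates of a point of \<open>T\<close>, and the
      chart is injective.\<close>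
    moreover have "E \<subseteq> T \<inter> Z"
    proof
      fix e assume "e \<in> E"
      then obtain t where t: "t \<in> C" "e = c.\<sigma> (x, t)" unfolding E_def by blast
      then obtain a where a: "a \<in> T" "t = snd (\<phi> a)" using C(2) by auto
      then have "a \<in> U" "fst (\<phi> a) = x" using T(1) by blast+
      then have "e = a" using t a by (metis c.inverse_chart prod.collapse)
      then show "e \<in> T \<inter> Z" using C(3)[OF t(1)] t a unfolding x_def by simp
    qed
    ultimately have "connectedin (subtopology M (T \<inter> Z)) E" by (simp add: connectedin_subtopology)
    then have "connectedin cantor_space (h ` E)"
      using h homeomorphic_imp_continuous_map connectedin_continuous_map_image by blast
    then have "h (c.\<sigma> (x, s)) = h (c.\<sigma> (x, t))"
      by (rule connectedin_cantor_space) (use st in \<open>simp_all add: E_def\<close>)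
    moreover have "E \<subseteq> topspace (subtopology M (T \<inter> Z))"
      using \<open>connectedin (subtopology M (T \<inter> Z)) E\<close> connectedin_subset_topspace by blast
    ultimately have "c.\<sigma> (x, s) = c.\<sigma> (x, t)"
      using homeomorphic_imp_injective_map[OF h] st unfolding E_def inj_on_def by blast
    then have "(x, s) = (x, t)"
      using st Cbox x by (metis (no_types, lifting) c.chart_inverse mem_Sigma_iff subsetD topspace_euclidean_subtopology)
    then show "s = t" by simp
  qed (use T(3) in auto)
qed

text \<open>The work is continuity of the plaque parametrization into the leaf topology, whose
  generators come from all charts. By \<open>same_plaque_locally\<close>, a plaque of \<phi> stays
  near each of its points in a single plaque of any other chart.\<close>

lemma connectedin_plaque:
  assumes F: "(U, \<phi>) \<in> F" and t: "t \<in> box (-1) 1"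
  shows "connectedin (leaf_topology F) ((\<lambda>x. inv_into U \<phi> (x, t)) ` box (-1) 1)"
proof -
  interpret c: topological_chart M U "top_of_set chart_box" \<phi> using chart F .
  define \<B> where "\<B> = {{y \<in> U. fst (\<phi> y) \<in> V \<and> snd (\<phi> y) = w} | U \<phi> V w.
        (U, \<phi>) \<in> F \<and> open V \<and> V \<subseteq> box (-1) 1}"
  have "continuous_map (top_of_set (box (-1) 1)) (topology_generated_by \<B>) (\<lambda>x. c.\<sigma> (x, t))"
  proof (rule continuous_on_generated_topo)
    fix P assume "P \<in> \<B>"
    then obtain U' \<phi>' V w where P: "P = {y \<in> U'. fst (\<phi>' y) \<in> V \<and> snd (\<phi>' y) = w}"
      and F': "(U', \<phi>') \<in> F" and V: "open V"
      unfolding \<B>_def by blast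
    have "\<exists>Q. open Q \<and> x \<in> Q \<and> Q \<subseteq> {x \<in> box (-1) 1. c.\<sigma> (x, t) \<in> P}"
      if x: "x \<in> box (-1) 1" "c.\<sigma> (x, t) \<in> P" for x
    proof -
      have z: "c.\<sigma> (x, t) \<in> U" "c.\<sigma> (x, t) \<in> U'" using x t P by simp_all
      obtain W where W: "openin M W" "c.\<sigma> (x, t) \<in> W" "W \<subseteq> U \<inter> U'"
        "\<And>x y. x \<in> W \<Longrightarrow> y \<in> W \<Longrightarrow> snd (\<phi> x) = snd (\<phi> y) \<longleftrightarrow> snd (\<phi>' x) = snd (\<phi>' y)"
        using same_plaque_locally[OF F F' z] by metis
      define N where "N = W \<inter> {a \<in> U'. \<phi>' a \<in> V \<times> UNIV}"
      have "openin M N"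
        unfolding N_def by (intro openin_Int W openin_chart_vimage[OF F'] open_Times V) auto
      then have "open {x \<in> box (-1) 1. c.\<sigma> (x, t) \<in> N}"
        using open_slice_preimage(2)[OF F _ t] by simp
      moreover have "x \<in> {x \<in> box (-1) 1. c.\<sigma> (x, t) \<in> N}"
        using x W z P by (simp add: N_def mem_Times_iff)
      moreover have "c.\<sigma> (x', t) \<in> P" if x': "x' \<in> box (-1) 1" "c.\<sigma> (x', t) \<in> N" for x'
      proof -
        have "snd (\<phi>' (c.\<sigma> (x', t))) = snd (\<phi>' (c.\<sigma> (x, t)))"
          using W(4)[of "c.\<sigma> (x', t)" "c.\<sigma> (x, t)"] W(2) x x' t by (simp add: N_def)
        then show ?thesis using x x' unfolding P N_def by (simp add: mem_Times_iff)
      qed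
      ultimately show ?thesis by (intro exI[of _ "{x \<in> box (-1) 1. c.\<sigma> (x, t) \<in> N}"]) blast
    qed
    then have "open {x \<in> box (-1) 1. c.\<sigma> (x, t) \<in> P}"
      by (subst open_subopen) blast
    moreover have "{x \<in> box (-1) 1. c.\<sigma> (x, t) \<in> P} =
        (\<lambda>x. c.\<sigma> (x, t)) -` P \<inter> topspace (top_of_set (box (-1) 1))" by auto
    ultimately show "openin (top_of_set (box (-1) 1))
        ((\<lambda>x. c.\<sigma> (x, t)) -` P \<inter> topspace (top_of_set (box (-1) 1)))"
      by (simp add: openin_open_eq open_box)
  next
    show "(\<lambda>x. c.\<sigma> (x, t)) ` topspace (top_of_set (box (-1) 1)) \<subseteq> \<Union>\<B>"
    proof clarsimp
      fix x :: "real^'k" assume "x \<in> box (-1) 1"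
      then have "c.\<sigma> (x, t) \<in> {y \<in> U. fst (\<phi> y) \<in> box (-1) 1 \<and> snd (\<phi> y) = t}" using t by simp
      moreover have "{y \<in> U. fst (\<phi> y) \<in> box (-1) 1 \<and> snd (\<phi> y) = t} \<in> \<B>"
        unfolding \<B>_def
        by (rule CollectI, rule exI[of _ U], rule exI[of _ \<phi>], rule exI[of _ "box (-1) 1"], rule exI[of _ t])
           (simp add: F open_box)
      ultimately show "\<exists>P\<in>\<B>. c.\<sigma> (x, t) \<in> P" by (rule bexI)
    qed
  qed
  then have "continuous_map (top_of_set (box (-1) 1)) (leaf_topology F) (\<lambda>x. c.\<sigma> (x, t))"
    unfolding leaf_topology_def \<B>_def .
  then show ?thesis
    by (rule connectedin_continuous_map_image)
       (simp add: connectedin_subtopology convex_connected)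
qed

text \<open>A plaque is connected in the leaf topology, hence contained in one leaf, and
  \<open>Z\<close> is a union of leaves. This is how points of \<open>Z\<close> are moved along
  plaques.\<close>

lemma saturated:
  assumes Z: "minimal_set M F Z" and F: "(U, \<phi>) \<in> F" and a: "a \<in> U" "a \<in> Z" and b: "b \<in> U"
    and eq: "snd (\<phi> a) = snd (\<phi> b)"
  shows "b \<in> Z"
proof -
  interpret c: topological_chart M U "top_of_set chart_box" \<phi> using chart F .
  obtain \<L> where \<L>: "\<L> \<subseteq> leaves F" "Z = \<Union>\<L>" using Z unfolding minimal_set_def by blast
  then obtain L where L: "L \<in> \<L>" "a \<in> L" using a by blast
  define P where "P = (\<lambda>x. c.\<sigma> (x, snd (\<phi> a))) ` box (-1) 1"
  have box: "fst (\<phi> a) \<in> box (-1) 1" "snd (\<phi> a) \<in> box (-1) 1" "fst (\<phi> b) \<in> box (-1) 1"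
    using c.chart_in[OF a(1)] c.chart_in[OF b] by (simp_all add: mem_Times_iff)
  have "a = c.\<sigma> (fst (\<phi> a), snd (\<phi> a))" "b = c.\<sigma> (fst (\<phi> b), snd (\<phi> a))"
    using a(1) by simp (use b in \<open>simp add: eq\<close>)
  then have "a \<in> P" "b \<in> P" unfolding P_def using box by blast+
  moreover have "connectedin (leaf_topology F) P"
    unfolding P_def using connectedin_plaque[OF F box(2)] .
  moreover have "L \<in> connected_components_of (leaf_topology F)"
    using L \<L> unfolding leaves_def by blast
  ultimately have "P \<subseteq> L"
    using L(2) connected_components_of_maximal disjnt_iff by metis
  then show ?thesis using \<open>b \<in> P\<close> L \<L> by blast
qed

end

section \<open>Transverse coordinates of an embedded matchbox manifold\<close>

text \<open>The open part of a matchbox chart, seen purely topologically: since \<open>K\<close> is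
  totally disconnected, every connected subset of the domain lies in a single plaque.\<close>

locale flat_chart =
  topological_chart MM U "prod_topology (top_of_set (box (-1) 1)) K" \<phi>
  for MM :: "'m topology" and U :: "'m set" and K :: "'x topology" and \<phi> :: "'m \<Rightarrow> (real^'n) \<times> 'x" +
  assumes totally_disconnected: "totally_disconnected_space K"
begin

lemma coordinates [simp]:
  assumes "a \<in> U" shows "fst (\<phi> a) \<in> box (-1) 1" "snd (\<phi> a) \<in> topspace K"
  using chart_in[OF assms] by (auto simp: mem_Times_iff)

lemma openin_product_neighborhood:
  assumes "openin MM N" "y \<in> N" "N \<subseteq> U"
  obtains r W where "r > 0" "openin K W" "snd (\<phi> y) \<in> W" "ball (fst (\<phi> y)) r \<subseteq> box (-1) 1"
    "ball (fst (\<phi> y)) r \<times> W \<subseteq> \<phi> ` N"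
proof -
  have "openin (prod_topology (top_of_set (box (-1) 1)) K) (\<phi> ` N)"
    using openin_chart_image assms by blast
  moreover have "(fst (\<phi> y), snd (\<phi> y)) \<in> \<phi> ` N" using assms(2) by simp
  ultimately obtain R W where RW: "openin (top_of_set (box (-1) 1)) R" "openin K W"
    "fst (\<phi> y) \<in> R" "snd (\<phi> y) \<in> W" "R \<times> W \<subseteq> \<phi> ` N"
    unfolding openin_prod_topology_alt by metis
  have R: "open R" "R \<subseteq> box (-1) 1" using RW(1) by (auto simp: openin_open_eq open_box)
  obtain r where r: "r > 0" "ball (fst (\<phi> y)) r \<subseteq> R" using openE[OF R(1) RW(3)] by metis
  show thesis
    by (rule that[OF r(1) RW(2,4)]) (use r R RW(5) in auto)
qed

end

locale exceptional_embedding = foliated_manifold M S F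
  for M :: "'p topology" and S :: "('p, 'e::euclidean_space) chart set"
    and F :: "('p, (real^'k) \<times> (real^'q)) chart set" +
  fixes Z :: "'p set" and MM :: "'m topology" and f :: "'m \<Rightarrow> 'p"
  assumes exceptional: "exceptional_minimal_set M F Z"
    and homeomorphism: "homeomorphic_map MM (subtopology M Z) f"
begin

section \<open>Local correspondence of plaques under the homeomorphism\<close>

lemma minimal: "minimal_set M F Z"
  using exceptional unfolding exceptional_minimal_set_def by blast

lemma continuous_f: "continuous_map MM M f"
  using homeomorphism homeomorphic_imp_continuous_map continuous_map_in_subtopology by blast

lemma f_in: "y \<in> topspace MM \<Longrightarrow> f y \<in> Z" "y \<in> topspace MM \<Longrightarrow> f y \<in> topspace M"
  using homeomorphic_imp_surjective_map[OF homeomorphism] by auto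

lemma f_in_chart: "y \<in> topspace MM \<Longrightarrow> \<exists>V \<psi>. (V, \<psi>) \<in> F \<and> f y \<in> V"
  using charts_cover f_in by blast

lemma openin_preimage: "openin M P \<Longrightarrow> openin MM {a \<in> topspace MM. f a \<in> P}"
  using openin_continuous_map_preimage[OF continuous_f] .

text \<open>A piece of a plaque is connected, so its image has a connected set of transverse
  coordinates. Saturation moves this set onto the slice through \<open>f y\<close>, where the Cantor
  condition reduces it to one point.\<close>

lemma leaf_implies_transverse_constant:
  assumes ch: "flat_chart MM U K \<phi>" and F: "(V, \<psi>) \<in> F" and y: "y \<in> U" "f y \<in> V"
  obtains N where "openin MM N" "y \<in> N" "N \<subseteq> U" "f ` N \<subseteq> V"
    "\<And>a b. \<lbrakk>a \<in> N; b \<in> N; snd (\<phi> a) = snd (\<phi> b)\<rbrakk> \<Longrightarrow> snd (\<psi> (f a)) = snd (\<psi> (f b))"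
proof -
  interpret u: flat_chart MM U K \<phi> using ch .
  interpret v: topological_chart M V "top_of_set chart_box" \<psi> using chart F .
  have fyZ: "f y \<in> Z" using y u.domain_subset f_in by blast
  obtain B where B: "open B" "snd (\<psi> (f y)) \<in> B" "B \<subseteq> box (-1) 1"
    "\<And>C s t. \<lbrakk>connected C; C \<subseteq> B; \<And>t. t \<in> C \<Longrightarrow> v.\<sigma> (fst (\<psi> (f y)), t) \<in> Z; s \<in> C; t \<in> C\<rbrakk> \<Longrightarrow> s = t"
    using transversally_totally_disconnected[OF exceptional F y(2) fyZ] by metis
  define N where "N = U \<inter> {a \<in> topspace MM. f a \<in> {c \<in> V. \<psi> c \<in> UNIV \<times> B}}"
  have "openin MM N"
    unfolding N_def
    by (intro openin_Int u.openin_domain openin_preimage openin_chart_vimage[OF F] open_Times B) auto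
  moreover have "y \<in> N" using y B u.domain_subset by (auto simp: N_def mem_Times_iff)
  moreover have "N \<subseteq> U" by (auto simp: N_def)
  ultimately obtain r W where rW: "r > 0" "openin K W" "snd (\<phi> y) \<in> W" "ball (fst (\<phi> y)) r \<subseteq> box (-1) 1"
    "ball (fst (\<phi> y)) r \<times> W \<subseteq> \<phi> ` N"
    using u.openin_product_neighborhood by metis
  \<comment> \<open>\<open>N\<close> may meet a plaque in a disconnected set; the product
    neighbourhood \<open>N'\<close> meets it in a ball.\<close>
  define N' where "N' = {a \<in> U. \<phi> a \<in> ball (fst (\<phi> y)) r \<times> W}"
  have N'N: "N' \<subseteq> N"
  proof
    fix a assume "a \<in> N'"
    then have "a \<in> U" "\<phi> a \<in> \<phi> ` N" using rW(5) by (auto simp: N'_def)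
    then show "a \<in> N" using u.inj_on_chart \<open>N \<subseteq> U\<close> by (metis inj_on_image_mem_iff)
  qed
  show thesis
  proof (rule that)
    show "openin MM N'"
      unfolding N'_def using rW
      by (intro u.openin_chart_preimage) (auto simp: openin_prod_Times_iff openin_open_eq open_box)
    show "y \<in> N'" using y rW by (simp add: N'_def mem_Times_iff)
    show "N' \<subseteq> U" by (auto simp: N'_def)
    show "f ` N' \<subseteq> V" using N'N by (auto simp: N_def)
    fix a b assume ab: "a \<in> N'" "b \<in> N'" "snd (\<phi> a) = snd (\<phi> b)"
    define w where "w = snd (\<phi> a)"
    have w: "w \<in> W" "w \<in> topspace K" using ab(1) rW by (auto simp: w_def N'_def mem_Times_iff)
    define D where "D = u.\<sigma> ` (ball (fst (\<phi> y)) r \<times> {w})"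
    have "connectedin (prod_topology (top_of_set (box (-1) 1)) K) (ball (fst (\<phi> y)) r \<times> {w})"
      using w rW by (auto simp: connectedin_Times connectedin_subtopology)
    then have "connectedin MM D"
      unfolding D_def using connectedin_continuous_map_image u.continuous_inverse by blast
    then have conn: "connectedin M (f ` D)"
      using connectedin_continuous_map_image continuous_f by blast
    have DN: "D \<subseteq> N"
    proof
      fix d assume "d \<in> D"
      then obtain p where p: "d = u.\<sigma> p" "p \<in> \<phi> ` N" using rW(5) w unfolding D_def by blast
      then show "d \<in> N" using \<open>N \<subseteq> U\<close> u.inverse_chart by (metis imageE subsetD)
    qed
    then have "f ` D \<subseteq> V" by (auto simp: N_def)
    with conn have "connectedin (subtopology M V) (f ` D)" by (simp add: connectedin_subtopology)
    then have "connectedin (top_of_set chart_box) (\<psi> ` f ` D)"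
      using connectedin_continuous_map_image v.continuous_chart by blast
    then have "connected (\<psi> ` f ` D)" by (simp add: connectedin_subtopology)
    then have "connected (snd ` \<psi> ` f ` D)"
      by (rule connected_continuous_image[rotated]) (intro continuous_on_snd continuous_on_id)
    moreover have "snd ` \<psi> ` f ` D \<subseteq> B" using DN by (auto simp: N_def)
    \<comment> \<open>This point of the slice lies on the \<psi>-plaque of \<open>f d\<close>, which
      belongs to \<open>Z\<close>.\<close>
    moreover have "v.\<sigma> (fst (\<psi> (f y)), t) \<in> Z" if t: "t \<in> snd ` \<psi> ` f ` D" for t
    proof -
      obtain d where d: "d \<in> D" "t = snd (\<psi> (f d))" using t by blast
      then have "f d \<in> V" "f d \<in> Z" using DN f_in by (auto simp: N_def)
      moreover have "(fst (\<psi> (f y)), t) \<in> chart_box"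
        using v.chart_in[OF y(2)] v.chart_in[OF \<open>f d \<in> V\<close>] d(2) by (auto simp: mem_Times_iff)
      then have "v.\<sigma> (fst (\<psi> (f y)), t) \<in> V" "snd (\<psi> (f d)) = snd (\<psi> (v.\<sigma> (fst (\<psi> (f y)), t)))"
        by (simp_all add: d(2)[symmetric])
      ultimately show ?thesis by (rule saturated[OF minimal F])
    qed
    moreover have "a \<in> D" "b \<in> D"
    proof -
      have "a \<in> U" "b \<in> U" using ab(1,2) by (simp_all add: N'_def)
      then have "a = u.\<sigma> (fst (\<phi> a), w)" "b = u.\<sigma> (fst (\<phi> b), w)"
        by (simp add: w_def) (simp add: w_def ab(3) \<open>b \<in> U\<close>)
      moreover have "fst (\<phi> a) \<in> ball (fst (\<phi> y)) r" "fst (\<phi> b) \<in> ball (fst (\<phi> y)) r"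
        using ab(1,2) unfolding N'_def by (simp_all only: mem_Collect_eq mem_Times_iff)
      ultimately show "a \<in> D" "b \<in> D" unfolding D_def by blast+
    qed
    ultimately show "snd (\<psi> (f a)) = snd (\<psi> (f b))"
      using B(4)[of "snd ` \<psi> ` f ` D" "snd (\<psi> (f a))" "snd (\<psi> (f b))"] by blast
  qed
qed

text \<open>Here the connected set starts in \<open>M\<close>: a piece of the \<psi>-plaque of
  \<open>f a\<close> lies in \<open>Z\<close> by saturation, and the inverse of \<open>f\<close>
  carries it to a connected subset of \<open>U\<close>, whose projection to \<open>K\<close> is a
  single point.\<close>

lemma transverse_implies_leaf_constant:
  assumes ch: "flat_chart MM U K \<phi>" and F: "(V, \<psi>) \<in> F" and y: "y \<in> U" "f y \<in> V"
  obtains N where "openin MM N" "y \<in> N" "N \<subseteq> U" "f ` N \<subseteq> V"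
    "\<And>a b. \<lbrakk>a \<in> N; b \<in> N; snd (\<psi> (f a)) = snd (\<psi> (f b))\<rbrakk> \<Longrightarrow> snd (\<phi> a) = snd (\<phi> b)"
proof -
  interpret u: flat_chart MM U K \<phi> using ch .
  interpret v: topological_chart M V "top_of_set chart_box" \<psi> using chart F .
  obtain g where g: "homeomorphic_maps MM (subtopology M Z) f g"
    using homeomorphism homeomorphic_map_maps by blast
  have cg: "continuous_map (subtopology M Z) MM g" and gf: "\<And>a. a \<in> U \<Longrightarrow> g (f a) = a"
    using g u.domain_subset by (auto simp: homeomorphic_maps_def)
  \<comment> \<open>The image of \<open>U\<close> is open only relative to \<open>Z\<close>. Working
    inside the ambient open set \<open>Q\<close> ensures that the plaque piece, once known to lie in
    \<open>Z\<close>, is in the image of \<open>U\<close>.\<close>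
  have "openin (subtopology M Z) (f ` U)"
    using homeomorphic_map_openness[OF homeomorphism] u.openin_domain u.domain_subset by blast
  then obtain Q where Q: "openin M Q" "f ` U = Q \<inter> Z"
    by (auto simp: openin_subtopology)
  have "openin M (Q \<inter> V)" "f y \<in> Q \<inter> V" "Q \<inter> V \<subseteq> V" using Q y v.openin_domain by auto
  then obtain r where r: "r > 0" "ball (fst (\<psi> (f y))) r \<times> ball (snd (\<psi> (f y))) r \<subseteq> \<psi> ` (Q \<inter> V)"
    using product_ball_in_chart[OF F] by metis
  define R where "R = ball (fst (\<psi> (f y))) r"
  define N where "N = U \<inter> {a \<in> topspace MM. f a \<in> {c \<in> V. \<psi> c \<in> R \<times> ball (snd (\<psi> (f y))) r}}"
  show thesis
  proof (rule that)
    show "openin MM N"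
      unfolding N_def R_def
      by (intro openin_Int u.openin_domain openin_preimage openin_chart_vimage[OF F] open_Times) auto
    show "y \<in> N" using y r u.domain_subset by (auto simp: N_def R_def mem_Times_iff)
    show "N \<subseteq> U" "f ` N \<subseteq> V" by (auto simp: N_def)
    fix a b assume ab: "a \<in> N" "b \<in> N" "snd (\<psi> (f a)) = snd (\<psi> (f b))"
    define t where "t = snd (\<psi> (f a))"
    have t: "t \<in> ball (snd (\<psi> (f y))) r" using ab by (simp add: t_def N_def mem_Times_iff)
    have aV: "f a \<in> V" "f a \<in> Z" "a \<in> U" "b \<in> U" "f b \<in> V" using ab f_in by (auto simp: N_def)
    define E where "E = v.\<sigma> ` (R \<times> {t})"
    have sub: "R \<times> {t} \<subseteq> \<psi> ` (Q \<inter> V)" using r t unfolding R_def by blast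
    also have "\<dots> \<subseteq> chart_box" using v.chart_image by auto
    finally have Rt: "R \<times> {t} \<subseteq> chart_box" .
    moreover have "connected (R \<times> {t})" unfolding R_def by (intro connected_Times) auto
    ultimately have "connectedin (top_of_set chart_box) (R \<times> {t})"
      by (simp add: connectedin_subtopology)
    then have "connectedin M E"
      unfolding E_def using connectedin_continuous_map_image v.continuous_inverse by blast
    have EV: "e \<in> Q \<and> e \<in> V \<and> snd (\<psi> e) = t" if e: "e \<in> E" for e
    proof -
      obtain p where p: "p \<in> R \<times> {t}" "e = v.\<sigma> p" using e unfolding E_def by (elim imageE)
      then obtain c where c: "c \<in> Q \<inter> V" "p = \<psi> c" using sub by blast
      then have "e = c" using p by simp
      then show ?thesis using c p by auto
    qed
    then have "e \<in> Z" if "e \<in> E" for e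
      using saturated[OF minimal F aV(1,2), of e] that t_def by simp
    then have EU: "E \<subseteq> f ` U" "E \<subseteq> Z" using EV Q by blast+
    then have "connectedin MM (g ` E)"
      using \<open>connectedin M E\<close> by (intro connectedin_continuous_map_image[OF cg]) (simp add: connectedin_subtopology)
    moreover have "g ` E \<subseteq> U" using EU gf by fastforce
    ultimately have "connectedin (subtopology MM U) (g ` E)" by (simp add: connectedin_subtopology)
    then have "connectedin (prod_topology (top_of_set (box (-1) 1)) K) (\<phi> ` g ` E)"
      using connectedin_continuous_map_image u.continuous_chart by blast
    then have "connectedin K (snd ` \<phi> ` g ` E)"
      using connectedin_continuous_map_image continuous_map_snd by blast
    then obtain c where c: "snd ` \<phi> ` g ` E \<subseteq> {c}"
      using u.totally_disconnected unfolding totally_disconnected_space_def by blast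
    have "fst (\<psi> (f a)) \<in> R" "fst (\<psi> (f b)) \<in> R" using ab by (auto simp: N_def mem_Times_iff)
    moreover have "f a = v.\<sigma> (fst (\<psi> (f a)), t)" "f b = v.\<sigma> (fst (\<psi> (f b)), t)"
      using aV by (simp add: t_def) (simp add: t_def ab(3) aV)
    ultimately have "f a \<in> E" "f b \<in> E" unfolding E_def by blast+
    then have "snd (\<phi> (g (f a))) = c" "snd (\<phi> (g (f b))) = c" using c by blast+
    then show "snd (\<phi> a) = snd (\<phi> b)" using gf aV by simp
  qed
qed

lemma transverse_iff_leaf_constant:
  assumes ch: "flat_chart MM U K \<phi>" and F: "(V, \<psi>) \<in> F" and y: "y \<in> U" "f y \<in> V"
  obtains N where "openin MM N" "y \<in> N" "N \<subseteq> U" "f ` N \<subseteq> V"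
    "\<And>a b. \<lbrakk>a \<in> N; b \<in> N\<rbrakk> \<Longrightarrow> snd (\<psi> (f a)) = snd (\<psi> (f b)) \<longleftrightarrow> snd (\<phi> a) = snd (\<phi> b)"
proof -
  obtain N where N: "openin MM N" "y \<in> N" "N \<subseteq> U" "f ` N \<subseteq> V"
    "\<And>a b. \<lbrakk>a \<in> N; b \<in> N; snd (\<psi> (f a)) = snd (\<psi> (f b))\<rbrakk> \<Longrightarrow> snd (\<phi> a) = snd (\<phi> b)"
    using transverse_implies_leaf_constant[OF ch F y] by metis
  obtain N' where N': "openin MM N'" "y \<in> N'"
    "\<And>a b. \<lbrakk>a \<in> N'; b \<in> N'; snd (\<phi> a) = snd (\<phi> b)\<rbrakk> \<Longrightarrow> snd (\<psi> (f a)) = snd (\<psi> (f b))"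
    using leaf_implies_transverse_constant[OF ch F y] by metis
  show thesis
  proof (rule that[of "N \<inter> N'"])
    show "snd (\<psi> (f a)) = snd (\<psi> (f b)) \<longleftrightarrow> snd (\<phi> a) = snd (\<phi> b)" if "a \<in> N \<inter> N'" "b \<in> N \<inter> N'" for a b
      using that N(5)[of a b] N'(3)[of a b] by (intro iffI) simp_all
  qed (use N N' in auto)
qed

section \<open>Lipschitz estimates for sliding along a plaque\<close>

text \<open>Says that sliding along plaques from near \<open>y\<close> to near \<open>y'\<close> is
  Lipschitz when measured in transverse coordinates of \<open>M\<close>. Sliding is expressed by
  pairs of points with equal \<open>snd \<circ> \<phi>\<close>, so no map has to be constructed. All
  foliation charts at both ends are allowed, so that intermediate charts can be chosen freely in
  compositions.\<close>

definition transversely_Lipschitz :: "'m set \<Rightarrow> ('m \<Rightarrow> (real^'n) \<times> 'x) \<Rightarrow> 'm \<Rightarrow> 'm \<Rightarrow> bool" where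
  "transversely_Lipschitz U \<phi> y y' \<longleftrightarrow>
     (\<forall>V \<psi> V' \<psi>'. (V, \<psi>) \<in> F \<longrightarrow> (V', \<psi>') \<in> F \<longrightarrow> f y \<in> V \<longrightarrow> f y' \<in> V' \<longrightarrow>
       (\<exists>N N' C. openin MM N \<and> openin MM N' \<and> y \<in> N \<and> y' \<in> N' \<and> N \<subseteq> U \<and> N' \<subseteq> U \<and> C \<ge> 0 \<and>
          (\<forall>a\<in>N. \<forall>b\<in>N. \<forall>a'\<in>N'. \<forall>b'\<in>N'. snd (\<phi> a) = snd (\<phi> a') \<longrightarrow> snd (\<phi> b) = snd (\<phi> b') \<longrightarrow>
             dist (snd (\<psi>' (f a'))) (snd (\<psi>' (f b'))) \<le> C * dist (snd (\<psi> (f a))) (snd (\<psi> (f b))))))"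

lemma transversely_LipschitzE:
  assumes "transversely_Lipschitz U \<phi> y y'" "(V, \<psi>) \<in> F" "(V', \<psi>') \<in> F" "f y \<in> V" "f y' \<in> V'"
  obtains N N' C where "openin MM N" "openin MM N'" "y \<in> N" "y' \<in> N'" "N \<subseteq> U" "N' \<subseteq> U" "C \<ge> 0"
    "\<And>a b a' b'. \<lbrakk>a \<in> N; b \<in> N; a' \<in> N'; b' \<in> N'; snd (\<phi> a) = snd (\<phi> a'); snd (\<phi> b) = snd (\<phi> b')\<rbrakk>
       \<Longrightarrow> dist (snd (\<psi>' (f a'))) (snd (\<psi>' (f b'))) \<le> C * dist (snd (\<psi> (f a))) (snd (\<psi> (f b)))"
  using assms(1)[unfolded transversely_Lipschitz_def, rule_format, OF assms(2-5)] by metis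

text \<open>Near \<open>y\<close> a single foliation chart \<psi>0 suffices, and its transverse
  coordinate does not change under sliding. What remains is the change from \<psi> to \<psi>0 at one
  end and from \<psi>0 to \<psi>' at the other.\<close>

lemma transversely_Lipschitz_locally:
  assumes ch: "flat_chart MM U K \<phi>" and y: "y \<in> U"
  obtains N where "openin MM N" "y \<in> N" "N \<subseteq> U"
    "\<And>y1 y2. \<lbrakk>y1 \<in> N; y2 \<in> N\<rbrakk> \<Longrightarrow> transversely_Lipschitz U \<phi> y1 y2"
proof -
  interpret u: flat_chart MM U K \<phi> using ch .
  obtain V0 \<psi>0 where V0: "(V0, \<psi>0) \<in> F" "f y \<in> V0"
    using f_in_chart y u.domain_subset by blast
  obtain N where N: "openin MM N" "y \<in> N" "N \<subseteq> U" "f ` N \<subseteq> V0"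
    "\<And>a b. \<lbrakk>a \<in> N; b \<in> N\<rbrakk> \<Longrightarrow> snd (\<psi>0 (f a)) = snd (\<psi>0 (f b)) \<longleftrightarrow> snd (\<phi> a) = snd (\<phi> b)"
    using transverse_iff_leaf_constant[OF ch V0(1) y V0(2)] by metis
  show thesis
  proof (rule that[OF N(1-3)])
    fix y1 y2 assume y12: "y1 \<in> N" "y2 \<in> N"
    show "transversely_Lipschitz U \<phi> y1 y2"
      unfolding transversely_Lipschitz_def
    proof (intro allI impI)
      fix V \<psi> V' \<psi>' assume V: "(V, \<psi>) \<in> F" "(V', \<psi>') \<in> F" "f y1 \<in> V" "f y2 \<in> V'"
      have "f y1 \<in> V0" "f y2 \<in> V0" using N y12 by blast+
      obtain W1 C1 where W1: "openin M W1" "f y1 \<in> W1" "C1 \<ge> 0"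
        "\<And>x y. x \<in> W1 \<Longrightarrow> y \<in> W1 \<Longrightarrow> dist (snd (\<psi>0 x)) (snd (\<psi>0 y)) \<le> C1 * dist (snd (\<psi> x)) (snd (\<psi> y))"
        using transverse_Lipschitz[OF V(1) V0(1) V(3) \<open>f y1 \<in> V0\<close>] by metis
      obtain W2 C2 where W2: "openin M W2" "f y2 \<in> W2" "C2 \<ge> 0"
        "\<And>x y. x \<in> W2 \<Longrightarrow> y \<in> W2 \<Longrightarrow> dist (snd (\<psi>' x)) (snd (\<psi>' y)) \<le> C2 * dist (snd (\<psi>0 x)) (snd (\<psi>0 y))"
        using transverse_Lipschitz[OF V0(1) V(2) \<open>f y2 \<in> V0\<close> V(4)] by metis
      define N1 where "N1 = N \<inter> {a \<in> topspace MM. f a \<in> W1}"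
      define N2 where "N2 = N \<inter> {a \<in> topspace MM. f a \<in> W2}"
      have "openin MM N1" "openin MM N2"
        unfolding N1_def N2_def using N(1) openin_preimage W1(1) W2(1) by blast+
      moreover have "y1 \<in> N1" "y2 \<in> N2" "N1 \<subseteq> U" "N2 \<subseteq> U"
        using y12 W1 W2 N(3) u.domain_subset by (auto simp: N1_def N2_def)
      moreover have "dist (snd (\<psi>' (f a'))) (snd (\<psi>' (f b'))) \<le> C2 * C1 * dist (snd (\<psi> (f a))) (snd (\<psi> (f b)))"
        if "a \<in> N1" "b \<in> N1" "a' \<in> N2" "b' \<in> N2" "snd (\<phi> a) = snd (\<phi> a')" "snd (\<phi> b) = snd (\<phi> b')" for a b a' b'
      proof -
        have in': "a \<in> N" "b \<in> N" "a' \<in> N" "b' \<in> N" "f a \<in> W1" "f b \<in> W1" "f a' \<in> W2" "f b' \<in> W2"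
          using that(1-4) by (simp_all add: N1_def N2_def)
        have "dist (snd (\<psi>' (f a'))) (snd (\<psi>' (f b'))) \<le> C2 * dist (snd (\<psi>0 (f a'))) (snd (\<psi>0 (f b')))"
          using W2(4) in' by blast
        also have "snd (\<psi>0 (f a')) = snd (\<psi>0 (f a))" using N(5)[OF in'(3,1)] that(5) by simp
        also have "snd (\<psi>0 (f b')) = snd (\<psi>0 (f b))" using N(5)[OF in'(4,2)] that(6) by simp
        also have "C2 * dist (snd (\<psi>0 (f a))) (snd (\<psi>0 (f b))) \<le> C2 * (C1 * dist (snd (\<psi> (f a))) (snd (\<psi> (f b))))"
          using W1(4)[OF in'(5,6)] W2(3) by (rule mult_left_mono)
        finally show ?thesis by (simp add: mult.assoc)
      qed
      ultimately show "\<exists>N N' C. openin MM N \<and> openin MM N' \<and> y1 \<in> N \<and> y2 \<in> N' \<and> N \<subseteq> U \<and> N' \<subseteq> U \<and> C \<ge> 0 \<and>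
          (\<forall>a\<in>N. \<forall>b\<in>N. \<forall>a'\<in>N'. \<forall>b'\<in>N'. snd (\<phi> a) = snd (\<phi> a') \<longrightarrow> snd (\<phi> b) = snd (\<phi> b') \<longrightarrow>
             dist (snd (\<psi>' (f a'))) (snd (\<psi>' (f b'))) \<le> C * dist (snd (\<psi> (f a))) (snd (\<psi> (f b))))"
        using W1(3) W2(3) by (intro exI[of _ N1] exI[of _ N2] exI[of _ "C2 * C1"] conjI ballI impI) simp_all
    qed
  qed
qed

text \<open>The constants multiply; the point to settle is that intermediate points exist in the
  neighbourhoods of \<open>y'\<close> used by both estimates.\<close>

lemma transversely_Lipschitz_trans:
  assumes ch: "flat_chart MM U K \<phi>" and U: "y \<in> U" "y' \<in> U"
    and plaque: "snd (\<phi> y) = snd (\<phi> y')"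
    and 1: "transversely_Lipschitz U \<phi> y y'" and 2: "transversely_Lipschitz U \<phi> y' y''"
  shows "transversely_Lipschitz U \<phi> y y''"
  unfolding transversely_Lipschitz_def
proof (intro allI impI)
  interpret u: flat_chart MM U K \<phi> using ch .
  fix V \<psi> V'' \<psi>'' assume V: "(V, \<psi>) \<in> F" "(V'', \<psi>'') \<in> F" "f y \<in> V" "f y'' \<in> V''"
  obtain V' \<psi>' where V': "(V', \<psi>') \<in> F" "f y' \<in> V'"
    using f_in_chart U u.domain_subset by blast
  obtain N N' C where N: "openin MM N" "openin MM N'" "y \<in> N" "y' \<in> N'" "N \<subseteq> U" "N' \<subseteq> U" "C \<ge> 0"
    "\<And>a b a' b'. \<lbrakk>a \<in> N; b \<in> N; a' \<in> N'; b' \<in> N'; snd (\<phi> a) = snd (\<phi> a'); snd (\<phi> b) = snd (\<phi> b')\<rbrakk>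
       \<Longrightarrow> dist (snd (\<psi>' (f a'))) (snd (\<psi>' (f b'))) \<le> C * dist (snd (\<psi> (f a))) (snd (\<psi> (f b)))"
    using transversely_LipschitzE[OF 1 V(1) V'(1) V(3) V'(2)] by metis
  obtain P P' C' where P: "openin MM P" "openin MM P'" "y' \<in> P" "y'' \<in> P'" "P \<subseteq> U" "P' \<subseteq> U" "C' \<ge> 0"
    "\<And>a b a' b'. \<lbrakk>a \<in> P; b \<in> P; a' \<in> P'; b' \<in> P'; snd (\<phi> a) = snd (\<phi> a'); snd (\<phi> b) = snd (\<phi> b')\<rbrakk>
       \<Longrightarrow> dist (snd (\<psi>'' (f a'))) (snd (\<psi>'' (f b'))) \<le> C' * dist (snd (\<psi>' (f a))) (snd (\<psi>' (f b)))"
    using transversely_LipschitzE[OF 2 V'(1) V(2) V'(2) V(4)] by metis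
  have "openin MM (N' \<inter> P)" "y' \<in> N' \<inter> P" "N' \<inter> P \<subseteq> U" using N P by auto
  then obtain r W where rW: "r > 0" "openin K W" "snd (\<phi> y') \<in> W" "ball (fst (\<phi> y')) r \<subseteq> box (-1) 1"
    "ball (fst (\<phi> y')) r \<times> W \<subseteq> \<phi> ` (N' \<inter> P)"
    using u.openin_product_neighborhood by metis
  \<comment> \<open>Only plaques with transverse coordinate in \<open>W\<close> are kept: each of
    them has a point in \<open>N' \<inter> P\<close>, namely the one with the leaf coordinate of
    \<open>y'\<close>.\<close>
  define N0 where "N0 = N \<inter> {a \<in> U. \<phi> a \<in> box (-1) 1 \<times> W}"
  have "openin MM N0"
    unfolding N0_def using rW(2)
    by (intro openin_Int N u.openin_chart_preimage) (auto simp: openin_prod_Times_iff)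
  moreover have "y \<in> N0" using N(3) U rW(3) plaque by (simp add: N0_def mem_Times_iff)
  moreover have "N0 \<subseteq> U" by (auto simp: N0_def)
  moreover have "dist (snd (\<psi>'' (f a''))) (snd (\<psi>'' (f b''))) \<le> C' * C * dist (snd (\<psi> (f a))) (snd (\<psi> (f b)))"
    if ab: "a \<in> N0" "b \<in> N0" "a'' \<in> P'" "b'' \<in> P'" "snd (\<phi> a) = snd (\<phi> a'')" "snd (\<phi> b) = snd (\<phi> b'')" for a b a'' b''
  proof -
    have ex: "\<exists>c'. c' \<in> N' \<and> c' \<in> P \<and> snd (\<phi> c) = snd (\<phi> c')" if "c \<in> N0" for c
    proof -
      have "(fst (\<phi> y'), snd (\<phi> c)) \<in> ball (fst (\<phi> y')) r \<times> W"
        using that rW(1) by (simp add: N0_def mem_Times_iff)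
      then obtain c' where "c' \<in> N' \<inter> P" "(fst (\<phi> y'), snd (\<phi> c)) = \<phi> c'" using rW(5) by blast
      then have "c' \<in> N'" "c' \<in> P" "snd (\<phi> c) = snd (\<phi> c')" by (simp_all add: prod_eq_iff)
      then show ?thesis by blast
    qed
    obtain a' where a': "a' \<in> N'" "a' \<in> P" "snd (\<phi> a) = snd (\<phi> a')" using ex[OF ab(1)] by blast
    obtain b' where b': "b' \<in> N'" "b' \<in> P" "snd (\<phi> b) = snd (\<phi> b')" using ex[OF ab(2)] by blast
    have "a \<in> N" "b \<in> N" using ab(1,2) by (simp_all add: N0_def)
    have "dist (snd (\<psi>'' (f a''))) (snd (\<psi>'' (f b''))) \<le> C' * dist (snd (\<psi>' (f a'))) (snd (\<psi>' (f b')))"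
      using a'(3) b'(3) ab(5,6) by (intro P(8)[OF a'(2) b'(2) ab(3,4)]) simp_all
    also have "\<dots> \<le> C' * (C * dist (snd (\<psi> (f a))) (snd (\<psi> (f b))))"
      by (rule mult_left_mono[OF N(8)[OF \<open>a \<in> N\<close> \<open>b \<in> N\<close> a'(1) b'(1) a'(3) b'(3)] P(7)])
    finally show ?thesis by (simp add: mult.assoc)
  qed
  ultimately show "\<exists>N N' C. openin MM N \<and> openin MM N' \<and> y \<in> N \<and> y'' \<in> N' \<and> N \<subseteq> U \<and> N' \<subseteq> U \<and> C \<ge> 0 \<and>
      (\<forall>a\<in>N. \<forall>b\<in>N. \<forall>a'\<in>N'. \<forall>b'\<in>N'. snd (\<phi> a) = snd (\<phi> a') \<longrightarrow> snd (\<phi> b) = snd (\<phi> b') \<longrightarrow>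
         dist (snd (\<psi>'' (f a'))) (snd (\<psi>'' (f b'))) \<le> C * dist (snd (\<psi> (f a))) (snd (\<psi> (f b))))"
    using N(7) P(2,4,6,7) by (intro exI[of _ N0] exI[of _ P'] exI[of _ "C' * C"] conjI ballI impI) simp_all
qed

text \<open>No chain of charts along the plaque is chosen: points close to each other are related,
  the relation is transitive, and the box parametrizing the plaque is connected.\<close>

lemma transversely_Lipschitz_plaque:
  assumes ch: "flat_chart MM U K \<phi>" and U: "y \<in> U" "y' \<in> U" and plaque: "snd (\<phi> y) = snd (\<phi> y')"
  shows "transversely_Lipschitz U \<phi> y y'"
proof -
  interpret u: flat_chart MM U K \<phi> using ch .
  define w where "w = snd (\<phi> y)"
  have w: "w \<in> topspace K" using U by (simp add: w_def)
  define s where "s x = u.\<sigma> (x, w)" for x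
  \<comment> \<open>\<open>transversely_Lipschitz\<close> is directed from its first point to its
    second, so it is symmetrized to become an equivalence relation.\<close>
  define R where "R x x' \<longleftrightarrow> transversely_Lipschitz U \<phi> (s x) (s x') \<and> transversely_Lipschitz U \<phi> (s x') (s x)" for x x'
  have s: "s x \<in> U" "snd (\<phi> (s x)) = w" "\<phi> (s x) = (x, w)" if "x \<in> box (-1) 1" for x
    using that w by (simp_all add: s_def)
  have "R (fst (\<phi> y)) (fst (\<phi> y'))"
  proof (rule connected_equivalence_relation[where S = "box (-1) 1"])
    show "connected (box (-1) 1 :: (real^'b) set)" by (simp add: convex_connected)
    show "fst (\<phi> y) \<in> box (-1) 1" "fst (\<phi> y') \<in> box (-1) 1" using U by simp_all
    show "R b a" if "R a b" for a b using that unfolding R_def by blast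
    show "R a c" if "R a b" "R b c" and abc: "a \<in> box (-1) 1" "b \<in> box (-1) 1" "c \<in> box (-1) 1" for a b c
      using that(1,2) transversely_Lipschitz_trans[OF ch s(1)[OF abc(1)] s(1)[OF abc(2)], of "s c"]
        transversely_Lipschitz_trans[OF ch s(1)[OF abc(3)] s(1)[OF abc(2)], of "s a"]
      unfolding R_def by (simp add: s(2) abc)
    fix a :: "real^'b" assume a: "a \<in> box (-1) 1"
    obtain N where N: "openin MM N" "s a \<in> N" "N \<subseteq> U"
      "\<And>y1 y2. \<lbrakk>y1 \<in> N; y2 \<in> N\<rbrakk> \<Longrightarrow> transversely_Lipschitz U \<phi> y1 y2"
      using transversely_Lipschitz_locally[OF ch s(1)[OF a]] by metis
    obtain r W where rW: "r > 0" "w \<in> W" "ball a r \<subseteq> box (-1) 1" "ball a r \<times> W \<subseteq> \<phi> ` N"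
      using u.openin_product_neighborhood[OF N(1-3)] s(3)[OF a] by (metis fst_conv snd_conv)
    have "s x \<in> N" if "x \<in> ball a r" for x
    proof -
      have "(x, w) \<in> \<phi> ` N" by (rule subsetD[OF rW(4)], rule SigmaI[OF that rW(2)])
      then obtain c where "c \<in> N" "\<phi> c = (x, w)" by (elim imageE) simp
      then show ?thesis using N(3) u.inverse_chart[of c] unfolding s_def by auto
    qed
    then have "\<forall>x\<in>ball a r. R a x" unfolding R_def using N by blast
    then show "\<exists>T. openin (top_of_set (box (-1) 1)) T \<and> a \<in> T \<and> (\<forall>x\<in>T. R a x)"
      using rW by (intro exI[of _ "ball a r"]) (simp add: openin_open_eq open_box)
  qed
  moreover have "s (fst (\<phi> y)) = y" "s (fst (\<phi> y')) = y'"
    using U by (simp_all add: s_def w_def) (simp add: plaque)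
  ultimately show ?thesis unfolding R_def by simp
qed

end

section \<open>Metrics from local embeddings\<close>

text \<open>In a compact Hausdorff space a component is separated by a clopen partition from any
  disjoint closed set; here the component is \<open>{p}\<close> and the closed set is the complement
  of \<open>N\<close>.\<close>

lemma totally_disconnected_compact_imp_clopen_neighborhood:
  assumes Y: "compact_space Y" "Hausdorff_space Y" "totally_disconnected_space Y"
    and N: "openin Y N" "p \<in> N"
  obtains P where "openin Y P" "closedin Y P" "p \<in> P" "P \<subseteq> N"
proof -
  have p: "p \<in> topspace Y" using N openin_subset by blast
  have "connectedin Y (connected_component_of_set Y p)" by (rule connectedin_connected_component_of)
  then obtain a where "connected_component_of_set Y p \<subseteq> {a}"
    using Y(3) unfolding totally_disconnected_space_def by blast
  moreover have "p \<in> connected_component_of_set Y p" using p by (simp add: connected_component_of_refl)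
  ultimately have "connected_component_of_set Y p = {p}" by blast
  then have "{p} \<in> connected_components_of Y"
    using p unfolding connected_components_of_def by force
  then have "separated_between Y {p} (topspace Y - N)"
    using Y N p by (intro separated_between_compact_connected_component)
      (auto simp: compact_imp_locally_compact_space disjnt_def)
  then obtain U V where UV: "openin Y U" "openin Y V" "U \<union> V = topspace Y" "disjnt U V" "{p} \<subseteq> U" "topspace Y - N \<subseteq> V"
    unfolding separated_between_def by metis
  have "U = topspace Y - V" using UV by (auto simp: disjnt_def)
  then show thesis using UV p by (intro that[of U]) (auto simp: disjnt_def)
qed

text \<open>A finite clopen subcover need not be disjoint. Choosing by \<open>sig x\<close>, the set
  of all members containing \<open>x\<close>, makes the fibres of \<kappa> unions of atoms of the
  finite algebra generated by the cover, and these atoms are open.\<close>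

lemma finite_locally_constant_selection:
  assumes Y: "compact_space Y" "Hausdorff_space Y" "totally_disconnected_space Y"
    and N: "\<And>p. p \<in> topspace Y \<Longrightarrow> openin Y (N p) \<and> p \<in> N p"
  obtains \<kappa> where "\<And>x. x \<in> topspace Y \<Longrightarrow> \<kappa> x \<in> topspace Y" "\<And>x. x \<in> topspace Y \<Longrightarrow> x \<in> N (\<kappa> x)"
    "\<And>x. x \<in> topspace Y \<Longrightarrow> openin Y {y \<in> topspace Y. \<kappa> y = \<kappa> x}"
proof -
  have "\<exists>P. openin Y P \<and> closedin Y P \<and> p \<in> P \<and> P \<subseteq> N p" if "p \<in> topspace Y" for p
    using totally_disconnected_compact_imp_clopen_neighborhood[OF Y] N[OF that] by metis
  then obtain P where P: "openin Y (P p)" "closedin Y (P p)" "p \<in> P p" "P p \<subseteq> N p"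
    if "p \<in> topspace Y" for p by metis
  have "compactin Y (topspace Y)" using Y(1) unfolding compact_space_def .
  moreover have "\<forall>U\<in>P ` topspace Y. openin Y U" "topspace Y \<subseteq> \<Union> (P ` topspace Y)" using P by auto
  ultimately obtain \<F> where \<F>: "finite \<F>" "\<F> \<subseteq> P ` topspace Y" "topspace Y \<subseteq> \<Union>\<F>"
    unfolding compactin_def by meson
  obtain I where I: "I \<subseteq> topspace Y" "finite I" "\<F> = P ` I"
    using finite_subset_image[OF \<F>(1,2)] by metis
  define sig where "sig x = {c \<in> I. x \<in> P c}" for x
  define \<kappa> where "\<kappa> x = (SOME c. c \<in> sig x)" for x
  have \<kappa>: "\<kappa> x \<in> sig x" if "x \<in> topspace Y" for x
  proof -
    have "\<exists>c. c \<in> sig x" using \<F>(3) I(3) that unfolding sig_def by blast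
    then show ?thesis unfolding \<kappa>_def by (rule someI_ex)
  qed
  have sig_open: "openin Y {y \<in> topspace Y. sig y = sig x}" for x
  proof -
    have "{y \<in> topspace Y. sig y = sig x} =
        topspace Y \<inter> (\<Inter>c\<in>I. if c \<in> sig x then P c else topspace Y - P c)"
      by (auto simp: sig_def split: if_splits)
    also have "openin Y \<dots>"
    \<comment> \<open>For empty \<open>I\<close> the indexed intersection is \<open>UNIV\<close>;
      the factor \<open>topspace Y\<close> takes care of this case.\<close>
    proof (cases "I = {}")
      case False
      have "openin Y (\<Inter>c\<in>I. if c \<in> sig x then P c else topspace Y - P c)"
        using I P False by (intro openin_INT2) (auto simp: closedin_def)
      then show ?thesis by (intro openin_Int) auto
    qed simp
    finally show ?thesis .
  qed
  show thesis
  proof (rule that)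
    show "\<kappa> x \<in> topspace Y" "x \<in> N (\<kappa> x)" if "x \<in> topspace Y" for x
      using \<kappa>[OF that] I P unfolding sig_def by blast+
    show "openin Y {y \<in> topspace Y. \<kappa> y = \<kappa> x}" if "x \<in> topspace Y" for x
    proof (subst openin_subopen, rule ballI)
      fix y assume y: "y \<in> {y \<in> topspace Y. \<kappa> y = \<kappa> x}"
      have "{y' \<in> topspace Y. sig y' = sig y} \<subseteq> {y \<in> topspace Y. \<kappa> y = \<kappa> x}"
        using y by (auto simp: \<kappa>_def)
      then show "\<exists>T. openin Y T \<and> y \<in> T \<and> T \<subseteq> {y \<in> topspace Y. \<kappa> y = \<kappa> x}"
        using sig_open[of y] y by (intro exI[of _ "{y' \<in> topspace Y. sig y' = sig y}"]) auto
    qed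
  qed
qed

text \<open>On each piece of a clopen partition the metric is pulled back by one of the \<open>e p\<close>; distances are
  cut off at 1, which is the distance of different pieces.\<close>

lemma metric_from_local_embeddings:
  fixes e :: "'y \<Rightarrow> 'y \<Rightarrow> 'b::metric_space"
  assumes Y: "compact_space Y" "Hausdorff_space Y" "totally_disconnected_space Y"
    and N: "\<And>p. p \<in> topspace Y \<Longrightarrow> openin Y (N p) \<and> p \<in> N p"
    and cont: "\<And>p. p \<in> topspace Y \<Longrightarrow> continuous_map (subtopology Y (N p)) euclidean (e p)"
    and inj: "\<And>p. p \<in> topspace Y \<Longrightarrow> inj_on (e p) (N p)"
  obtains d where "Metric_space (topspace Y) d" "Metric_space.mtopology (topspace Y) d = Y"
    "\<And>x y. d x y \<le> 1"
    "\<And>p. p \<in> topspace Y \<Longrightarrow> \<exists>c W. c \<in> topspace Y \<and> openin Y W \<and> p \<in> W \<and> W \<subseteq> N c \<and>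
       (\<forall>a\<in>W. \<forall>b\<in>W. d a b = dist (e c a) (e c b))"
proof -
  obtain \<kappa> where \<kappa>: "\<And>x. x \<in> topspace Y \<Longrightarrow> \<kappa> x \<in> topspace Y" "\<And>x. x \<in> topspace Y \<Longrightarrow> x \<in> N (\<kappa> x)"
    "\<And>x. x \<in> topspace Y \<Longrightarrow> openin Y {y \<in> topspace Y. \<kappa> y = \<kappa> x}"
    using finite_locally_constant_selection[OF Y N] by metis
  define d where "d a b = (if \<kappa> a = \<kappa> b then min 1 (dist (e (\<kappa> a) a) (e (\<kappa> a) b)) else 1)" for a b
  have ms: "Metric_space (topspace Y) d"
  proof
    show "0 \<le> d x y" for x y by (simp add: d_def)
    show "d x y = d y x" for x y by (simp add: d_def dist_commute)
    show "d x y = 0 \<longleftrightarrow> x = y" if xy: "x \<in> topspace Y" "y \<in> topspace Y" for x y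
    proof
      assume "d x y = 0"
      then have eq: "\<kappa> x = \<kappa> y" "e (\<kappa> x) x = e (\<kappa> x) y"
        by (auto simp: d_def min_def split: if_splits)
      then show "x = y" using inj[OF \<kappa>(1)[OF xy(1)]] \<kappa>(2) xy by (metis inj_onD)
    qed (simp add: d_def)
    show "d x z \<le> d x y + d y z" for x y z
    proof -
      have m: "min 1 p \<le> min 1 q + min 1 r" if "p \<le> q + r" "0 \<le> q" "0 \<le> r" for p q r :: real
        using that by (simp add: min_def)
      show ?thesis
      proof (cases "\<kappa> x = \<kappa> y \<and> \<kappa> y = \<kappa> z")
        case True
        then show ?thesis
          using m[OF dist_triangle[of "e (\<kappa> x) x" "e (\<kappa> x) z" "e (\<kappa> x) y"]] by (simp add: d_def)
      next
        \<comment> \<open>One of the two distances on the right is 1, the largest value of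
          \<open>d\<close>.\<close>
        case False
        then show ?thesis by (auto simp: d_def)
      qed
    qed
  qed
  interpret Metric_space "topspace Y" d using ms .
  have small: "\<exists>W. openin Y W \<and> p \<in> W \<and> W \<subseteq> {y \<in> topspace Y. \<kappa> y = \<kappa> p} \<and> (\<forall>a\<in>W. dist (e (\<kappa> p) p) (e (\<kappa> p) a) < \<epsilon>)"
    if p: "p \<in> topspace Y" and "\<epsilon> > 0" for p \<epsilon>
  proof -
    define c where "c = \<kappa> p"
    have c: "c \<in> topspace Y" using \<kappa>(1)[OF p] by (simp add: c_def)
    have "openin (subtopology Y (N c)) {a \<in> topspace (subtopology Y (N c)). e c a \<in> ball (e c p) \<epsilon>}"
      by (rule openin_continuous_map_preimage[OF cont[OF c]]) simp
    then have "openin Y {a \<in> topspace (subtopology Y (N c)). e c a \<in> ball (e c p) \<epsilon>}"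
      using N[OF c] by (simp add: openin_open_subtopology)
    then have "openin Y ({y \<in> topspace Y. \<kappa> y = \<kappa> p} \<inter> {a \<in> topspace (subtopology Y (N c)). e c a \<in> ball (e c p) \<epsilon>})"
      using \<kappa>(3)[OF p] by (rule openin_Int[rotated])
    then show ?thesis
      using p \<open>\<epsilon> > 0\<close> \<kappa>(2)[OF p] unfolding c_def
      by (intro exI[of _ "{y \<in> topspace Y. \<kappa> y = \<kappa> p} \<inter>
          {a \<in> topspace (subtopology Y (N (\<kappa> p))). e (\<kappa> p) a \<in> ball (e (\<kappa> p) p) \<epsilon>}"] conjI) auto
  qed
  \<comment> \<open>A continuous bijection from a compact space to a Hausdorff space is a
    homeomorphism. Hence continuity and injectivity of the maps \<open>e c\<close> suffice for
    recovering the topology.\<close>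
  have "continuous_map Y mtopology id"
    unfolding continuous_map_to_metric
  proof (intro ballI allI impI)
    fix p and \<epsilon> :: real assume p: "p \<in> topspace Y" and "\<epsilon> > 0"
    obtain W where W: "openin Y W" "p \<in> W" "W \<subseteq> {y \<in> topspace Y. \<kappa> y = \<kappa> p}"
      "\<forall>a\<in>W. dist (e (\<kappa> p) p) (e (\<kappa> p) a) < \<epsilon>"
      using small[OF p \<open>\<epsilon> > 0\<close>] by metis
    have "id y \<in> mball (id p) \<epsilon>" if y: "y \<in> W" for y
    proof -
      have "y \<in> topspace Y" "\<kappa> p = \<kappa> y" "dist (e (\<kappa> p) p) (e (\<kappa> p) y) < \<epsilon>" using W y by auto
      then show ?thesis using p by (simp add: in_mball d_def)
    qed
    then show "\<exists>U. openin Y U \<and> p \<in> U \<and> (\<forall>y\<in>U. id y \<in> mball (id p) \<epsilon>)" using W by blast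
  qed
  then have "homeomorphic_map Y mtopology id"
    using Y(1) by (intro continuous_imp_homeomorphic_map) (auto simp: Hausdorff_space_mtopology)
  then have top: "mtopology = Y" by simp
  show thesis
  proof (rule that[OF ms top])
    show "d x y \<le> 1" for x y by (simp add: d_def)
    fix p assume p: "p \<in> topspace Y"
    \<comment> \<open>Radius 1/2 about \<open>p\<close> keeps distances within \<open>W\<close>
      below the cutoff, so there \<open>d\<close> is exactly the pulled back distance.\<close>
    obtain W where W: "openin Y W" "p \<in> W" "W \<subseteq> {y \<in> topspace Y. \<kappa> y = \<kappa> p}"
      "\<forall>a\<in>W. dist (e (\<kappa> p) p) (e (\<kappa> p) a) < 1/2"
      using small[OF p, of "1/2"] by auto
    have "d a b = dist (e (\<kappa> p) a) (e (\<kappa> p) b)" if ab: "a \<in> W" "b \<in> W" for a b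
    proof -
      have "\<kappa> a = \<kappa> p" "\<kappa> b = \<kappa> p" using subsetD[OF W(3)] ab by simp_all
      moreover have "dist (e (\<kappa> p) a) (e (\<kappa> p) b) < 1"
        by (rule dist_triangle_half_r[of "e (\<kappa> p) p"]) (use W(4) ab in simp_all)
      ultimately show ?thesis by (simp add: d_def)
    qed
    moreover have "W \<subseteq> N (\<kappa> p)"
    proof
      fix a assume "a \<in> W"
      then have "a \<in> topspace Y" "\<kappa> a = \<kappa> p" using W(3) by blast+
      then show "a \<in> N (\<kappa> p)" using \<kappa>(2)[of a] by simp
    qed
    ultimately show "\<exists>c W. c \<in> topspace Y \<and> openin Y W \<and> p \<in> W \<and> W \<subseteq> N c \<and>
       (\<forall>a\<in>W. \<forall>b\<in>W. d a b = dist (e c a) (e c b))"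
      using W(1,2) \<kappa>(1)[OF p] by (intro exI[of _ "\<kappa> p"] exI[of _ W]) simp
  qed
qed

text \<open>A Lebesgue number argument: pairs closer than \<epsilon> lie in one neighbourhood with a
  local constant, and for all other pairs the bound \<open>B\<close> is absorbed by a distance of at
  least \<epsilon>.\<close>

lemma (in Metric_space) locally_Lipschitz_imp_Lipschitz:
  assumes U: "compactin mtopology U"
    and bounded: "\<And>a b. \<lbrakk>a \<in> U; b \<in> U\<rbrakk> \<Longrightarrow> d (h a) (h b) \<le> B"
    and local: "\<And>p. p \<in> U \<Longrightarrow> \<exists>W C. openin mtopology W \<and> p \<in> W \<and> C \<ge> 0 \<and>
      (\<forall>a\<in>W \<inter> U. \<forall>b\<in>W \<inter> U. d (h a) (h b) \<le> C * d a b)"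
  shows "\<exists>C\<ge>0. \<forall>a\<in>U. \<forall>b\<in>U. d (h a) (h b) \<le> C * d a b"
proof -
  have UM: "U \<subseteq> M" using compactin_subset_topspace[OF U] by simp
  have "\<exists>r C. r > 0 \<and> C \<ge> 0 \<and> (\<forall>a\<in>U. \<forall>b\<in>U. d p a < r \<longrightarrow> d a b < r \<longrightarrow> d (h a) (h b) \<le> C * d a b)"
    if p: "p \<in> U" for p
  proof -
    obtain W C where W: "openin mtopology W" "p \<in> W" "C \<ge> 0"
      "\<forall>a\<in>W \<inter> U. \<forall>b\<in>W \<inter> U. d (h a) (h b) \<le> C * d a b"
      using local[OF p] by metis
    obtain r where r: "r > 0" "mball p r \<subseteq> W" using W(1,2) unfolding openin_mtopology by blast
    \<comment> \<open>Two distances below \<open>r/2\<close> place \<open>b\<close> in the ball of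
      radius \<open>r\<close> about \<open>p\<close> as well.\<close>
    have "d (h a) (h b) \<le> C * d a b" if ab: "a \<in> U" "b \<in> U" "d p a < r/2" "d a b < r/2" for a b
    proof -
      have M: "p \<in> M" "a \<in> M" "b \<in> M" using p ab UM by blast+
      then have "d p b < r" using triangle[of p a b] ab by linarith
      then have "a \<in> mball p r" "b \<in> mball p r" using M ab r(1) by (simp_all add: in_mball)
      then show ?thesis using W(4) r(2) ab by blast
    qed
    then show ?thesis using r(1) W(3) by (intro exI[of _ "r/2"] exI[of _ C]) auto
  qed
  then obtain r C where rC: "\<And>p. p \<in> U \<Longrightarrow> r p > 0" "\<And>p. p \<in> U \<Longrightarrow> C p \<ge> 0"
    "\<And>p a b. \<lbrakk>p \<in> U; a \<in> U; b \<in> U; d p a < r p; d a b < r p\<rbrakk> \<Longrightarrow> d (h a) (h b) \<le> C p * d a b"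
    by metis
  have "\<forall>V\<in>(\<lambda>p. mball p (r p)) ` U. openin mtopology V" by auto
  moreover have "U \<subseteq> \<Union> ((\<lambda>p. mball p (r p)) ` U)" using rC(1) UM by auto
  ultimately obtain \<F> where \<F>: "finite \<F>" "\<F> \<subseteq> (\<lambda>p. mball p (r p)) ` U" "U \<subseteq> \<Union>\<F>"
    using U unfolding compactin_def by meson
  obtain I where I: "I \<subseteq> U" "finite I" "\<F> = (\<lambda>p. mball p (r p)) ` I"
    using finite_subset_image[OF \<F>(1,2)] by metis
  \<comment> \<open>Inserting 1 gives \<open>Min\<close> a nonempty set even when the subcover is
    empty.\<close>
  define \<epsilon> where "\<epsilon> = Min (insert 1 (r ` I))"
  have \<epsilon>: "\<epsilon> > 0" "\<And>p. p \<in> I \<Longrightarrow> \<epsilon> \<le> r p"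
    using I rC(1) by (auto simp: \<epsilon>_def)
  \<comment> \<open>The sum dominates every single \<open>C p\<close>. The absolute value keeps
    \<open>K\<close> nonnegative for empty \<open>U\<close>, where \<open>B\<close> may be
    negative.\<close>
  define K where "K = (\<Sum>p\<in>I. C p) + \<bar>B\<bar> / \<epsilon>"
  have sumC: "(\<Sum>p\<in>I. C p) \<ge> 0" using I rC(2) by (intro sum_nonneg) blast
  have "d (h a) (h b) \<le> K * d a b" if ab: "a \<in> U" "b \<in> U" for a b
  proof (cases "d a b < \<epsilon>")
    case True
    obtain p where p: "p \<in> I" "a \<in> mball p (r p)" using \<F>(3) I(3) ab by blast
    have "d (h a) (h b) \<le> C p * d a b"
      using p I ab True \<epsilon>(2)[OF p(1)] by (intro rC(3)) (auto simp: in_mball)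
    also have "C p \<le> K"
    proof -
      have "C p \<le> (\<Sum>p\<in>I. C p)" using p I rC(2) by (intro member_le_sum) auto
      then show ?thesis using \<epsilon>(1) unfolding K_def by (simp add: add_increasing2)
    qed
    then have "C p * d a b \<le> K * d a b" by (rule mult_right_mono) simp
    finally show ?thesis .
  next
    case False
    have "d (h a) (h b) \<le> \<bar>B\<bar> / \<epsilon> * \<epsilon>" using bounded[OF ab] \<epsilon>(1) by simp
    also have "\<dots> \<le> \<bar>B\<bar> / \<epsilon> * d a b" using False \<epsilon>(1) by (intro mult_left_mono) auto
    also have "\<dots> \<le> K * d a b" using sumC by (intro mult_right_mono) (auto simp: K_def)
    finally show ?thesis .
  qed
  then show ?thesis using sumC \<epsilon>(1) by (intro exI[of _ K]) (auto simp: K_def)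
qed

section \<open>The transversal space and its holonomy maps\<close>

lemma (in flat_chart) continuous_section:
  assumes "x \<in> box (-1) 1"
  shows "continuous_map K MM (\<lambda>w. \<sigma> (x, w))"
proof -
  have "continuous_map K (prod_topology (top_of_set (box (-1) 1)) K) (Pair x)"
    using assms by (simp add: continuous_map_pairwise comp_def)
  from continuous_map_compose[OF this continuous_inverse] show ?thesis by (simp add: comp_def)
qed

lemma (in flat_chart) openin_transverse_preimage:
  assumes "openin K W" shows "openin MM {a \<in> U. snd (\<phi> a) \<in> W}"
proof -
  have "openin MM {a \<in> U. \<phi> a \<in> box (-1) 1 \<times> W}"
    using assms by (intro openin_chart_preimage) (simp add: openin_prod_Times_iff)
  also have "{a \<in> U. \<phi> a \<in> box (-1) 1 \<times> W} = {a \<in> U. snd (\<phi> a) \<in> W}"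
    by (auto simp: mem_Times_iff)
  finally show ?thesis .
qed

lemma (in flat_chart) openin_section_preimage:
  assumes "openin MM P" "x \<in> box (-1) 1" shows "openin MM {a \<in> U. \<sigma> (x, snd (\<phi> a)) \<in> P}"
proof -
  have "openin MM {a \<in> U. snd (\<phi> a) \<in> {w \<in> topspace K. \<sigma> (x, w) \<in> P}}"
    by (rule openin_transverse_preimage[OF openin_continuous_map_preimage[OF continuous_section[OF assms(2)] assms(1)]])
  then show ?thesis by (rule back_subst[of "openin MM"]) auto
qed

lemma zero_in_box [simp]: "(0 :: real^'n) \<in> box (-1) 1"
  by (simp add: mem_box_cart)

text \<open>The chart axioms concern the closure of \<open>U\<close> and the closed cube; the clause
  that \<open>U\<close> is the part over the open box permits restricting the homeomorphism.\<close>

lemma matchbox_chart: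
  fixes A :: "('m, (real^'n) \<times> 'x) chart set"
  assumes mm: "matchbox_manifold MM X A" and c: "(U, \<phi>) \<in> A"
  shows "flat_chart MM U (subtopology (mtopology_of X) (local_transversal_model (U, \<phi>))) \<phi>"
    and "compactin (mtopology_of X) (local_transversal_model (U, \<phi>))"
proof -
  define T where "T = local_transversal_model (U, \<phi>)"
  define K where "K = MM closure_of U"
  have "foliated_space MM X A" using mm unfolding matchbox_manifold_def smooth_foliated_space_def by blast
  then have "\<forall>(U, \<phi>)\<in>A. let T = local_transversal_model (U, \<phi>); K = MM closure_of U in
        openin MM U \<and> compactin (mtopology_of X) T \<and>
        homeomorphic_map (subtopology MM K)
          (prod_topology (top_of_set (cbox (-1) 1)) (subtopology (mtopology_of X) T)) \<phi> \<and>
        U = {y \<in> K. fst (\<phi> y) \<in> box (-1) 1}"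
    unfolding foliated_space_def Let_def by blast
  from bspec[OF this c] have U: "openin MM U" and T: "compactin (mtopology_of X) T"
    and hom: "homeomorphic_map (subtopology MM K)
        (prod_topology (top_of_set (cbox (-1) 1)) (subtopology (mtopology_of X) T)) \<phi>"
    and Ueq: "U = {y \<in> K. fst (\<phi> y) \<in> box (-1) 1}"
    unfolding T_def K_def Let_def prod.case by blast+
  show "compactin (mtopology_of X) (local_transversal_model (U, \<phi>))" using T unfolding T_def .
  have "homeomorphic_map (subtopology (subtopology MM K) U)
      (subtopology (prod_topology (top_of_set (cbox (-1) 1)) (subtopology (mtopology_of X) T)) (box (-1) 1 \<times> UNIV)) \<phi>"
    by (rule homeomorphic_map_subtopologies_alt[OF hom]) (simp add: Ueq mem_Times_iff)
  moreover have "K \<inter> U = U" using Ueq by blast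
  moreover have "cbox (-1) 1 \<inter> box (-1) 1 = (box (-1) 1 :: (real^'n) set)"
    using box_subset_cbox by (rule Int_absorb1)
  ultimately have "homeomorphic_map (subtopology MM U)
      (prod_topology (top_of_set (box (-1) 1)) (subtopology (mtopology_of X) T)) \<phi>"
    by (simp add: subtopology_subtopology subtopology_Times)
  moreover have "totally_disconnected_space (subtopology (mtopology_of X) T)"
    using mm unfolding matchbox_manifold_def totally_disconnected_space_def connectedin_subtopology by blast
  ultimately show "flat_chart MM U (subtopology (mtopology_of X) (local_transversal_model (U, \<phi>))) \<phi>"
    using U unfolding T_def by unfold_locales
qed

lemma continuous_map_sum_topology_fst:
  "continuous_map (sum_topology Y I) (discrete_topology I) fst"
proof -
  have "{x. (i, x) \<in> {p \<in> Sigma I (topspace \<circ> Y). fst p \<in> U}} = (if i \<in> U then topspace (Y i) else {})"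
    if "i \<in> I" for i U
    using that by auto
  then show ?thesis by (auto simp: continuous_map_def openin_sum_topology)
qed

lemma continuous_map_sum_topology_snd:
  assumes "\<And>i. i \<in> I \<Longrightarrow> continuous_map (Y i) Z id"
  shows "continuous_map (sum_topology Y I) Z snd"
proof -
  have "{x. (i, x) \<in> {p \<in> Sigma I (topspace \<circ> Y). snd p \<in> U}} = {x \<in> topspace (Y i). x \<in> U}"
    if "i \<in> I" for i U
    using that by auto
  then show ?thesis
    using assms by (auto simp: continuous_map_def openin_sum_topology Pi_iff)
qed

locale transversal_embedding = exceptional_embedding M S F Z MM f
  for M :: "'p topology" and S :: "('p, 'e::euclidean_space) chart set"
    and F :: "('p, (real^'k) \<times> (real^'q)) chart set"
    and Z :: "'p set" and MM :: "'m topology" and f :: "'m \<Rightarrow> 'p" +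
  fixes X :: "'x metric" and \<nu> :: nat and \<phi> :: "nat \<Rightarrow> ('m, (real^'n) \<times> 'x) chart"
  assumes flat: "\<And>i. i < \<nu> \<Longrightarrow> flat_chart MM (fst (\<phi> i))
      (subtopology (mtopology_of X) (local_transversal_model (\<phi> i))) (snd (\<phi> i))"
    and compact_model: "\<And>i. i < \<nu> \<Longrightarrow> compactin (mtopology_of X) (local_transversal_model (\<phi> i))"
    and totally_disconnected_X: "totally_disconnected_space (mtopology_of X)"
    and clopen_overlap: "\<And>i j. i < \<nu> \<Longrightarrow> j < \<nu> \<Longrightarrow>
      clopenin (subtopology (mtopology_of X) (local_transversal_model (\<phi> i))) (overlap_transversal \<phi> i j)"
    and plaques_meet: "\<And>i j y z. \<lbrakk>i < \<nu>; j < \<nu>; y \<in> fst (\<phi> i) \<inter> fst (\<phi> j); z \<in> fst (\<phi> i) \<inter> fst (\<phi> j)\<rbrakk> \<Longrightarrow>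
      snd (snd (\<phi> i) y) = snd (snd (\<phi> i) z) \<longleftrightarrow> snd (snd (\<phi> j) y) = snd (snd (\<phi> j) z)"
begin

abbreviation "U i \<equiv> fst (\<phi> i)"
abbreviation "\<pi> i y \<equiv> snd (snd (\<phi> i) y)"
abbreviation "K i \<equiv> subtopology (mtopology_of X) (local_transversal_model (\<phi> i))"
abbreviation "\<XX> \<equiv> transversal_space X \<nu> \<phi>"

lemma topspace_K: "i < \<nu> \<Longrightarrow> topspace (K i) = local_transversal_model (\<phi> i)"
  using compactin_subset_topspace[OF compact_model] by (simp add: Int_absorb1)

lemma topspace_transversal_space: "topspace \<XX> = Sigma {..<\<nu>} (\<lambda>i. topspace (K i))"
  unfolding transversal_space_def by (simp add: comp_def)

lemma compact_transversal_space: "compact_space \<XX>"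
proof -
  have "compactin \<XX> (Pair i ` topspace (K i))" if "i \<in> {..<\<nu>}" for i
    using that compact_model[of i] topspace_K[of i]
    unfolding transversal_space_def
    by (intro image_compactin[OF _ continuous_map_component_injection]) (auto simp: compactin_subtopology)
  then have "compactin \<XX> (\<Union>i\<in>{..<\<nu>}. Pair i ` topspace (K i))"
    by (intro compactin_Union) auto
  also have "(\<Union>i\<in>{..<\<nu>}. Pair i ` topspace (K i)) = topspace \<XX>"
    unfolding topspace_transversal_space by auto
  finally show ?thesis unfolding compact_space_def .
qed

lemma continuous_transversal_space_fst: "continuous_map \<XX> (discrete_topology {..<\<nu>}) fst"
  unfolding transversal_space_def by (rule continuous_map_sum_topology_fst)

lemma continuous_transversal_space_snd: "continuous_map \<XX> (mtopology_of X) snd"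
  unfolding transversal_space_def
  by (rule continuous_map_sum_topology_snd) (simp add: continuous_map_from_subtopology)

text \<open>The identity maps the disjoint union continuously and injectively into the product of a
  discrete space with the space of \<open>X\<close>, which is Hausdorff.\<close>

lemma Hausdorff_transversal_space: "Hausdorff_space \<XX>"
proof -
  have "continuous_map \<XX> (prod_topology (discrete_topology {..<\<nu>}) (mtopology_of X)) id"
    using continuous_transversal_space_fst continuous_transversal_space_snd
    by (simp add: continuous_map_pairwise)
  moreover have "Hausdorff_space (prod_topology (discrete_topology {..<\<nu>}) (mtopology_of X))"
    using Metric_space.Hausdorff_space_mtopology[OF Metric_space_mspace_mdist[of X]]
    by (simp add: Hausdorff_space_prod_topology mtopology_of_def)
  ultimately show ?thesis by (metis Hausdorff_space_injective_preimage inj_on_id)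
qed

lemma totally_disconnected_transversal_space: "totally_disconnected_space \<XX>"
  unfolding totally_disconnected_space_def
proof (intro allI impI)
  fix C assume C: "connectedin \<XX> C"
  obtain i where "fst ` C \<subseteq> {i}"
    using connectedin_continuous_map_image[OF continuous_transversal_space_fst C]
    unfolding connectedin_discrete_topology by blast
  moreover obtain w where "snd ` C \<subseteq> {w}"
    using connectedin_continuous_map_image[OF continuous_transversal_space_snd C] totally_disconnected_X
    unfolding totally_disconnected_space_def by blast
  ultimately have "C \<subseteq> {(i, w)}" by force
  then show "\<exists>a. C \<subseteq> {a}" ..
qed

text \<open>Realizes \<XX> inside the matchbox manifold, each transverse point by the point with
  leaf coordinate 0 on its plaque, so that \<open>f\<close> can be applied to it.\<close>

definition center :: "nat \<times> 'x \<Rightarrow> 'm" where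
  "center p = inv_into (U (fst p)) (snd (\<phi> (fst p))) (0, snd p)"

lemma center:
  assumes "p \<in> topspace \<XX>"
  shows "center p \<in> U (fst p)" "snd (\<phi> (fst p)) (center p) = (0, snd p)"
    "center p \<in> topspace MM"
proof -
  have p: "fst p < \<nu>" "snd p \<in> topspace (K (fst p))"
    using assms unfolding topspace_transversal_space by auto
  interpret flat_chart MM "U (fst p)" "K (fst p)" "snd (\<phi> (fst p))" using flat p(1) .
  show "center p \<in> U (fst p)" "snd (\<phi> (fst p)) (center p) = (0, snd p)"
    unfolding center_def using p(2) inverse_in[of "(0, snd p)"] chart_inverse[of "(0, snd p)"] by auto
  then show "center p \<in> topspace MM" using domain_subset by blast
qed

lemma continuous_center: "continuous_map \<XX> MM center"
  unfolding continuous_map_def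
proof (intro conjI allI impI Pi_I)
  show "center p \<in> topspace MM" if "p \<in> topspace \<XX>" for p using center(3) that .
  fix P assume P: "openin MM P"
  have "openin (K i) {w. (i, w) \<in> {p \<in> topspace \<XX>. center p \<in> P}}" if "i \<in> {..<\<nu>}" for i
  proof -
    interpret flat_chart MM "U i" "K i" "snd (\<phi> i)" using flat that by simp
    have "openin (K i) {w \<in> topspace (K i). inv_into (U i) (snd (\<phi> i)) (0, w) \<in> P}"
      by (rule openin_continuous_map_preimage[OF continuous_section P]) simp
    then show ?thesis
      by (rule back_subst[of "openin (K i)"]) (use that in \<open>auto simp: topspace_transversal_space center_def\<close>)
  qed
  moreover have "{p \<in> topspace \<XX>. center p \<in> P} \<subseteq> Sigma {..<\<nu>} (topspace \<circ> K)"
    unfolding topspace_transversal_space by auto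
  ultimately show "openin \<XX> {p \<in> topspace \<XX>. center p \<in> P}"
    unfolding transversal_space_def openin_sum_topology by blast
qed

lemma openin_center_preimage:
  assumes "openin MM P" shows "openin \<XX> {p \<in> topspace \<XX>. fst p = i \<and> center p \<in> P}"
proof -
  have "openin \<XX> {p \<in> topspace \<XX>. fst p \<in> {i} \<inter> {..<\<nu>}}"
    by (rule openin_continuous_map_preimage[OF continuous_transversal_space_fst]) simp
  then have "openin \<XX> ({p \<in> topspace \<XX>. fst p \<in> {i} \<inter> {..<\<nu>}} \<inter> {p \<in> topspace \<XX>. center p \<in> P})"
    using openin_continuous_map_preimage[OF continuous_center assms] by (rule openin_Int)
  then show ?thesis
    by (rule back_subst[of "openin \<XX>"]) (auto simp: topspace_transversal_space)
qed

text \<open>Provides the local maps for the metric construction. Injectivity holds because near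
  \<open>center c\<close> equal \<psi>-coordinates mean equal plaques, and a plaque determines its
  point of \<XX>.\<close>

lemma transverse_coordinate_embedding:
  assumes c: "c \<in> topspace \<XX>"
  obtains V \<psi> N where "(V, \<psi>) \<in> F" "openin \<XX> N" "c \<in> N"
    "\<And>p. p \<in> N \<Longrightarrow> f (center p) \<in> V"
    "continuous_map (subtopology \<XX> N) euclidean (\<lambda>p. snd (\<psi> (f (center p))))"
    "inj_on (\<lambda>p. snd (\<psi> (f (center p)))) N"
proof -
  define i where "i = fst c"
  have i: "i < \<nu>" using c unfolding topspace_transversal_space i_def by auto
  obtain V \<psi> where V: "(V, \<psi>) \<in> F" "f (center c) \<in> V"
    using f_in_chart center(3)[OF c] by blast
  interpret v: topological_chart M V "top_of_set chart_box" \<psi> using chart V(1) .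
  have "center c \<in> U i" using center(1)[OF c] by (simp add: i_def)
  then obtain N where N: "openin MM N" "center c \<in> N" "N \<subseteq> U i" "f ` N \<subseteq> V"
    "\<And>a b. \<lbrakk>a \<in> N; b \<in> N\<rbrakk> \<Longrightarrow> snd (\<psi> (f a)) = snd (\<psi> (f b)) \<longleftrightarrow> \<pi> i a = \<pi> i b"
    using transverse_iff_leaf_constant[OF flat[OF i] V(1) _ V(2)] by metis
  define N' where "N' = {p \<in> topspace \<XX>. fst p = i \<and> center p \<in> N}"
  show thesis
  proof (rule that[OF V(1)])
    show "openin \<XX> N'" unfolding N'_def by (rule openin_center_preimage[OF N(1)])
    show "c \<in> N'" using c N(2) by (simp add: N'_def i_def)
    show "f (center p) \<in> V" if "p \<in> N'" for p using that N(4) by (auto simp: N'_def)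
    have "continuous_map (subtopology \<XX> N') (subtopology M V) (\<lambda>p. f (center p))"
      using continuous_map_compose[OF continuous_center continuous_f] N(4)
      by (auto simp: continuous_map_in_subtopology comp_def N'_def intro: continuous_map_from_subtopology)
    from continuous_map_compose[OF this v.continuous_chart]
    have "continuous_map (subtopology \<XX> N') euclidean (\<lambda>p. \<psi> (f (center p)))"
      by (simp add: continuous_map_in_subtopology comp_def)
    moreover have "continuous_map euclidean euclidean (snd :: (real^'k) \<times> (real^'q) \<Rightarrow> real^'q)"
      using continuous_on_snd[OF continuous_on_id, of UNIV] by simp
    ultimately have "continuous_map (subtopology \<XX> N') euclidean (snd \<circ> (\<lambda>p. \<psi> (f (center p))))"
      by (rule continuous_map_compose)
    then show "continuous_map (subtopology \<XX> N') euclidean (\<lambda>p. snd (\<psi> (f (center p))))"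
      by (simp only: comp_def)
    show "inj_on (\<lambda>p. snd (\<psi> (f (center p)))) N'"
    proof (rule inj_onI)
      fix p q assume pq: "p \<in> N'" "q \<in> N'" "snd (\<psi> (f (center p))) = snd (\<psi> (f (center q)))"
      then have "\<pi> i (center p) = \<pi> i (center q)" using N(5)[of "center p" "center q"] by (simp add: N'_def)
      then show "p = q"
        using pq(1,2) center(2)[of p] center(2)[of q] by (auto simp: N'_def prod_eq_iff)
    qed
  qed
qed

lemma holonomy_mapE:
  assumes "(p, q) \<in> holonomy_map \<phi> i j" "i < \<nu>" "j < \<nu>"
  obtains y where "y \<in> U i" "y \<in> U j" "p = (i, \<pi> i y)" "q = (j, \<pi> j y)"
    "p \<in> topspace \<XX>" "q \<in> topspace \<XX>"
proof -
  obtain y where y: "y \<in> U i" "y \<in> U j" "p = (i, \<pi> i y)" "q = (j, \<pi> j y)"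
    using assms(1) unfolding holonomy_map_def by blast
  interpret ui: flat_chart MM "U i" "K i" "snd (\<phi> i)" using flat assms(2) .
  interpret uj: flat_chart MM "U j" "K j" "snd (\<phi> j)" using flat assms(3) .
  show thesis
    by (rule that[OF y])
       (use y ui.coordinates(2)[OF y(1)] uj.coordinates(2)[OF y(2)] assms(2,3) in
         \<open>simp_all only: topspace_transversal_space mem_Sigma_iff lessThan_iff simp_thms\<close>)
qed

text \<open>Holonomy at \<open>p\<close> is sliding in \<open>U i\<close> from
  \<open>center p\<close> to a common point \<open>y\<close>, then sliding in \<open>U j\<close>
  from \<open>y\<close> to \<open>center q\<close>; a foliation chart at \<open>f y\<close> links
  the two estimates. The clause on \<open>Q\<close> records continuity.\<close>

lemma holonomy_locally_Lipschitz:
  assumes ij: "i < \<nu>" "j < \<nu>" and pq: "(p, q) \<in> holonomy_map \<phi> i j"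
    and V: "(V, \<psi>) \<in> F" "f (center p) \<in> V" and V': "(V', \<psi>') \<in> F" "f (center q) \<in> V'"
    and Q: "openin \<XX> Q" "q \<in> Q"
  obtains W C where "openin \<XX> W" "p \<in> W" "C \<ge> 0"
    "\<And>p1 q1. \<lbrakk>p1 \<in> W; (p1, q1) \<in> holonomy_map \<phi> i j\<rbrakk> \<Longrightarrow> q1 \<in> Q"
    "\<And>p1 q1 p2 q2. \<lbrakk>p1 \<in> W; p2 \<in> W; (p1, q1) \<in> holonomy_map \<phi> i j; (p2, q2) \<in> holonomy_map \<phi> i j\<rbrakk> \<Longrightarrow>
       dist (snd (\<psi>' (f (center q1)))) (snd (\<psi>' (f (center q2))))
         \<le> C * dist (snd (\<psi> (f (center p1)))) (snd (\<psi> (f (center p2))))"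
proof -
  obtain y where y: "y \<in> U i" "y \<in> U j" "p = (i, \<pi> i y)" "q = (j, \<pi> j y)"
    and p: "p \<in> topspace \<XX>" and q: "q \<in> topspace \<XX>"
    using holonomy_mapE[OF pq ij] by metis
  interpret ui: flat_chart MM "U i" "K i" "snd (\<phi> i)" using flat ij(1) .
  interpret uj: flat_chart MM "U j" "K j" "snd (\<phi> j)" using flat ij(2) .
  obtain Vy \<psi>y where Vy: "(Vy, \<psi>y) \<in> F" "f y \<in> Vy"
    using f_in_chart y ui.domain_subset by blast
  have "center p \<in> U i" "\<pi> i (center p) = \<pi> i y" "center q \<in> U j" "\<pi> j (center q) = \<pi> j y"
    using center[OF p] center[OF q] y(3,4) by simp_all
  then have Lip: "transversely_Lipschitz (U i) (snd (\<phi> i)) (center p) y"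
      "transversely_Lipschitz (U j) (snd (\<phi> j)) y (center q)"
    using transversely_Lipschitz_plaque[OF flat[OF ij(1)], of "center p" y]
      transversely_Lipschitz_plaque[OF flat[OF ij(2)], of y "center q"] y(1,2) by simp_all
  obtain N N' C where N: "openin MM N" "openin MM N'" "center p \<in> N" "y \<in> N'" "C \<ge> 0"
    "\<And>a b a' b'. \<lbrakk>a \<in> N; b \<in> N; a' \<in> N'; b' \<in> N'; \<pi> i a = \<pi> i a'; \<pi> i b = \<pi> i b'\<rbrakk>
       \<Longrightarrow> dist (snd (\<psi>y (f a'))) (snd (\<psi>y (f b'))) \<le> C * dist (snd (\<psi> (f a))) (snd (\<psi> (f b)))"
    using transversely_LipschitzE[OF Lip(1) V(1) Vy(1) V(2) Vy(2)] by metis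
  obtain P P' C' where P: "openin MM P" "openin MM P'" "y \<in> P" "center q \<in> P'" "C' \<ge> 0"
    "\<And>a b a' b'. \<lbrakk>a \<in> P; b \<in> P; a' \<in> P'; b' \<in> P'; \<pi> j a = \<pi> j a'; \<pi> j b = \<pi> j b'\<rbrakk>
       \<Longrightarrow> dist (snd (\<psi>' (f a'))) (snd (\<psi>' (f b'))) \<le> C' * dist (snd (\<psi>y (f a))) (snd (\<psi>y (f b)))"
    using transversely_LipschitzE[OF Lip(2) Vy(1) V'(1) Vy(2) V'(2)] by metis
  \<comment> \<open>Shrinking \<open>Q\<close> puts the centers of the images into
    \<open>P'\<close>, where the second sliding estimate is valid.\<close>
  define Q' where "Q' = Q \<inter> {p \<in> topspace \<XX>. fst p = j \<and> center p \<in> P'}"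
  have Q': "openin \<XX> Q'" unfolding Q'_def using Q(1) openin_center_preimage[OF P(2)] by (rule openin_Int)
  have qQ': "q \<in> Q'" using Q(2) q P(4) y(4) by (simp add: Q'_def)
  have "openin (K j) {w. (j, w) \<in> Q'}"
    using Q' ij(2) unfolding transversal_space_def openin_sum_topology by simp
  from uj.openin_transverse_preimage[OF this] have open_hol: "openin MM {a \<in> U j. (j, \<pi> j a) \<in> Q'}" by simp
  define D where "D = U i \<inter> N' \<inter> P \<inter> {a \<in> U j. (j, \<pi> j a) \<in> Q'}"
  have D: "openin MM D"
    unfolding D_def by (intro openin_Int ui.openin_domain N P open_hol)
  have "y \<in> D" using y N P qQ' by (simp add: D_def)
  define x where "x = fst (snd (\<phi> i) y)"
  have x: "x \<in> box (-1) 1" using y(1) by (simp add: x_def)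
  \<comment> \<open>\<open>W\<close> consists of transverse points whose plaque in
    \<open>U i\<close> still meets \<open>D\<close> at the leaf coordinate \<open>x\<close> of
    \<open>y\<close>; that point serves as the intermediate one.\<close>
  define W where "W = {p \<in> topspace \<XX>. fst p = i \<and> center p \<in> N \<inter> {a \<in> U i. ui.\<sigma> (x, \<pi> i a) \<in> D}}"
  have W: "\<exists>y1. y1 \<in> D \<and> \<pi> i (center p1) = \<pi> i y1 \<and> \<pi> j y1 = \<pi> j (center q1) \<and> q1 \<in> Q' \<and> center p1 \<in> N \<and> center q1 \<in> P'"
    if p1: "p1 \<in> W" and pq1: "(p1, q1) \<in> holonomy_map \<phi> i j" for p1 q1
  proof -
    obtain y' where y': "y' \<in> U i" "y' \<in> U j" "p1 = (i, \<pi> i y')" "q1 = (j, \<pi> j y')"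
      and top: "p1 \<in> topspace \<XX>" "q1 \<in> topspace \<XX>"
      using holonomy_mapE[OF pq1 ij] by metis
    define y1 where "y1 = ui.\<sigma> (x, \<pi> i (center p1))"
    have cp: "center p1 \<in> U i" "\<pi> i (center p1) = \<pi> i y'" using center[OF top(1)] y'(3) by simp_all
    have y1D: "y1 \<in> D" using p1 by (simp add: W_def y1_def)
    have \<pi>y1: "\<pi> i y1 = \<pi> i (center p1)"
    proof -
      have "(x, \<pi> i (center p1)) \<in> topspace (prod_topology (top_of_set (box (-1) 1)) (K i))"
        using x ui.coordinates(2)[OF cp(1)]
        by (simp only: topspace_prod_topology mem_Sigma_iff topspace_euclidean_subtopology simp_thms)
      from ui.chart_inverse[OF this] show ?thesis unfolding y1_def by simp
    qed
    have "y1 \<in> U i \<inter> U j" "y' \<in> U i \<inter> U j" using y1D y' by (simp_all add: D_def)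
    \<comment> \<open>The common point \<open>y'\<close> witnessing the holonomy may be far from
      \<open>y\<close>. It can be replaced by \<open>y1\<close>, since both lie on the same plaque
      of \<open>U i\<close> and therefore of \<open>U j\<close>.\<close>
    then have "\<pi> j y1 = \<pi> j y'" using plaques_meet[OF ij] \<pi>y1 cp(2) by metis
    moreover have "\<pi> j (center q1) = \<pi> j y'" using center(2)[OF top(2)] y'(4) by simp
    moreover have "(j, \<pi> j y1) \<in> Q'" using y1D by (simp add: D_def)
    ultimately have "\<pi> j y1 = \<pi> j (center q1)" "q1 \<in> Q'" using y'(4) by simp_all
    moreover have "center p1 \<in> N" using p1 by (simp add: W_def)
    moreover have "center q1 \<in> P'" using \<open>q1 \<in> Q'\<close> by (simp add: Q'_def)
    ultimately show ?thesis using y1D \<pi>y1 by (intro exI[of _ y1]) simp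
  qed
  show thesis
  proof (rule that)
    show "openin \<XX> W"
      unfolding W_def by (intro openin_center_preimage openin_Int N ui.openin_section_preimage D x)
    have "ui.\<sigma> (x, \<pi> i (center p)) = y"
      using y(1) \<open>\<pi> i (center p) = \<pi> i y\<close> by (simp add: x_def)
    then show "p \<in> W"
      using p y(3) N(3) \<open>y \<in> D\<close> \<open>center p \<in> U i\<close> by (simp add: W_def)
    show "C' * C \<ge> 0" using N(5) P(5) by simp
    show "q1 \<in> Q" if "p1 \<in> W" "(p1, q1) \<in> holonomy_map \<phi> i j" for p1 q1
      using W[OF that] by (auto simp: Q'_def)
    fix p1 q1 p2 q2
    assume pq12: "p1 \<in> W" "p2 \<in> W" "(p1, q1) \<in> holonomy_map \<phi> i j" "(p2, q2) \<in> holonomy_map \<phi> i j"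
    obtain y1 where y1: "y1 \<in> D" "\<pi> i (center p1) = \<pi> i y1" "\<pi> j y1 = \<pi> j (center q1)"
      "center p1 \<in> N" "center q1 \<in> P'"
      using W[OF pq12(1,3)] by blast
    obtain y2 where y2: "y2 \<in> D" "\<pi> i (center p2) = \<pi> i y2" "\<pi> j y2 = \<pi> j (center q2)"
      "center p2 \<in> N" "center q2 \<in> P'"
      using W[OF pq12(2,4)] by blast
    have D12: "y1 \<in> N'" "y2 \<in> N'" "y1 \<in> P" "y2 \<in> P" using y1(1) y2(1) by (simp_all add: D_def)
    have "dist (snd (\<psi>' (f (center q1)))) (snd (\<psi>' (f (center q2)))) \<le> C' * dist (snd (\<psi>y (f y1))) (snd (\<psi>y (f y2)))"
      by (rule P(6)[OF D12(3,4) y1(5) y2(5) y1(3) y2(3)])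
    also have "\<dots> \<le> C' * (C * dist (snd (\<psi> (f (center p1)))) (snd (\<psi> (f (center p2)))))"
      by (rule mult_left_mono[OF N(6)[OF y1(4) y2(4) D12(1,2) y1(2) y2(2)] P(5)])
    finally show "dist (snd (\<psi>' (f (center q1)))) (snd (\<psi>' (f (center q2))))
         \<le> C' * C * dist (snd (\<psi> (f (center p1)))) (snd (\<psi> (f (center p2))))"
      by (simp add: mult.assoc)
  qed
qed

end

section \<open>Generators of the holonomy pseudogroup and the global metric\<close>

context transversal_embedding
begin

text \<open>A function with graph \<open>holonomy_map\<close>, as homeomorphisms and Lipschitz
  bounds require one. On the overlap the chosen \<open>y\<close> is immaterial by
  \<open>plaques_meet\<close>.\<close>

definition holonomy :: "nat \<Rightarrow> nat \<Rightarrow> nat \<times> 'x \<Rightarrow> nat \<times> 'x" where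
  "holonomy i j p = (j, \<pi> j (SOME y. y \<in> U i \<inter> U j \<and> \<pi> i y = snd p))"

abbreviation holonomy_domain :: "nat \<Rightarrow> nat \<Rightarrow> (nat \<times> 'x) set" where
  "holonomy_domain i j \<equiv> {i} \<times> overlap_transversal \<phi> i j"

lemma holonomy_map_eq_graph:
  assumes ij: "i < \<nu>" "j < \<nu>"
  shows "holonomy_map \<phi> i j = graph_on (holonomy_domain i j) (holonomy i j)"
proof -
  have hol: "holonomy i j (i, \<pi> i y) = (j, \<pi> j y)" if y: "y \<in> U i \<inter> U j" for y
  proof -
    have "\<exists>z. z \<in> U i \<inter> U j \<and> \<pi> i z = snd (i, \<pi> i y)" using y by auto
    from someI_ex[OF this] show ?thesis
      unfolding holonomy_def using plaques_meet[OF ij _ y] by auto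
  qed
  show ?thesis
  proof (intro subset_antisym subsetI)
    fix r assume "r \<in> holonomy_map \<phi> i j"
    then obtain y where y: "y \<in> U i \<inter> U j" "r = ((i, \<pi> i y), (j, \<pi> j y))"
      unfolding holonomy_map_def by blast
    moreover have "(i, \<pi> i y) \<in> holonomy_domain i j"
      using y(1) by (auto simp: overlap_transversal_def)
    ultimately show "r \<in> graph_on (holonomy_domain i j) (holonomy i j)"
      unfolding graph_on_def using hol[OF y(1)] by (intro CollectI exI[of _ "(i, \<pi> i y)"]) simp
  next
    fix r assume "r \<in> graph_on (holonomy_domain i j) (holonomy i j)"
    then obtain p where p: "p \<in> holonomy_domain i j" "r = (p, holonomy i j p)"
      unfolding graph_on_def by blast
    then obtain y where y: "y \<in> U i \<inter> U j" "p = (i, \<pi> i y)"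
      by (auto simp: overlap_transversal_def)
    then show "r \<in> holonomy_map \<phi> i j"
      unfolding p(2) holonomy_map_def using hol[OF y(1)] by (intro CollectI exI[of _ y]) simp
  qed
qed

lemma holonomy_in_map:
  assumes "i < \<nu>" "j < \<nu>" "p \<in> holonomy_domain i j"
  shows "(p, holonomy i j p) \<in> holonomy_map \<phi> i j"
  using assms(3) unfolding holonomy_map_eq_graph[OF assms(1,2)] graph_on_def by blast

lemma holonomy_map_eqD:
  assumes "i < \<nu>" "j < \<nu>" "(p, q) \<in> holonomy_map \<phi> i j"
  shows "p \<in> holonomy_domain i j" "q = holonomy i j p"
  using assms(3) unfolding holonomy_map_eq_graph[OF assms(1,2)] graph_on_def by blast+

lemma holonomy_map_sym: "(p, q) \<in> holonomy_map \<phi> i j \<Longrightarrow> (q, p) \<in> holonomy_map \<phi> j i"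
  unfolding holonomy_map_def by blast

lemma holonomy_inverse:
  assumes ij: "i < \<nu>" "j < \<nu>" and p: "p \<in> holonomy_domain i j"
  shows "holonomy i j p \<in> holonomy_domain j i" "holonomy j i (holonomy i j p) = p"
proof -
  have "(holonomy i j p, p) \<in> holonomy_map \<phi> j i"
    using holonomy_map_sym[OF holonomy_in_map[OF ij p]] .
  from holonomy_map_eqD[OF ij(2,1) this]
  show "holonomy i j p \<in> holonomy_domain j i" "holonomy j i (holonomy i j p) = p" by simp_all
qed

lemma clopen_holonomy_domain:
  assumes ij: "i < \<nu>" "j < \<nu>" shows "clopenin \<XX> (holonomy_domain i j)"
proof -
  have O: "openin (K i) (overlap_transversal \<phi> i j)" "closedin (K i) (overlap_transversal \<phi> i j)"
    using clopen_overlap[OF ij] unfolding clopenin_def by blast+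
  have slice: "{w. (k, w) \<in> holonomy_domain i j} = (if k = i then overlap_transversal \<phi> i j else {})" for k
    by auto
  have "holonomy_domain i j \<subseteq> Sigma {..<\<nu>} (topspace \<circ> K)"
    using openin_subset[OF O(1)] ij(1) by auto
  then show ?thesis
    unfolding clopenin_def transversal_space_def openin_sum_topology closedin_sum_topology slice
    using O by simp
qed

lemma holonomy_domain_subset: "i < \<nu> \<Longrightarrow> j < \<nu> \<Longrightarrow> holonomy_domain i j \<subseteq> topspace \<XX>"
  using clopen_holonomy_domain openin_subset unfolding clopenin_def by blast

text \<open>Follows from the clause on \<open>Q\<close> in
  \<open>holonomy_locally_Lipschitz\<close>, with arbitrary foliation charts at both ends.\<close>

lemma continuous_holonomy:
  assumes ij: "i < \<nu>" "j < \<nu>"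
  shows "continuous_map (subtopology \<XX> (holonomy_domain i j)) (subtopology \<XX> (holonomy_domain j i)) (holonomy i j)"
proof -
  have preimage: "openin \<XX> {p \<in> holonomy_domain i j. holonomy i j p \<in> Q}" if Q: "openin \<XX> Q" for Q
  proof (subst openin_subopen, rule ballI)
    fix p assume p: "p \<in> {p \<in> holonomy_domain i j. holonomy i j p \<in> Q}"
    then have pd: "p \<in> holonomy_domain i j" and pQ: "holonomy i j p \<in> Q" by simp_all
    note pq = holonomy_in_map[OF ij pd]
    have top: "p \<in> topspace \<XX>" "holonomy i j p \<in> topspace \<XX>"
      using pd pQ holonomy_domain_subset[OF ij] openin_subset[OF Q] by blast+
    obtain V \<psi> where V: "(V, \<psi>) \<in> F" "f (center p) \<in> V" using f_in_chart center(3)[OF top(1)] by blast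
    obtain V' \<psi>' where V': "(V', \<psi>') \<in> F" "f (center (holonomy i j p)) \<in> V'"
      using f_in_chart center(3)[OF top(2)] by blast
    obtain W where W: "openin \<XX> W" "p \<in> W"
      "\<And>p1 q1. \<lbrakk>p1 \<in> W; (p1, q1) \<in> holonomy_map \<phi> i j\<rbrakk> \<Longrightarrow> q1 \<in> Q"
      using holonomy_locally_Lipschitz[OF ij pq V V' Q pQ] by metis
    have "W \<inter> holonomy_domain i j \<subseteq> {p \<in> holonomy_domain i j. holonomy i j p \<in> Q}"
      using W(3) holonomy_in_map[OF ij] by blast
    moreover have "openin \<XX> (W \<inter> holonomy_domain i j)"
      using W(1) clopen_holonomy_domain[OF ij] unfolding clopenin_def by blast
    ultimately show "\<exists>T. openin \<XX> T \<and> p \<in> T \<and> T \<subseteq> {p \<in> holonomy_domain i j. holonomy i j p \<in> Q}"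
      using W(2) pd by blast
  qed
  have "continuous_map (subtopology \<XX> (holonomy_domain i j)) \<XX> (holonomy i j)"
    unfolding continuous_map_def
  proof (intro conjI allI impI Pi_I)
    fix p assume "p \<in> topspace (subtopology \<XX> (holonomy_domain i j))"
    then have "p \<in> holonomy_domain i j" by (simp only: topspace_subtopology Int_iff)
    then show "holonomy i j p \<in> topspace \<XX>"
      using holonomy_inverse(1)[OF ij] holonomy_domain_subset[OF ij(2,1)] by blast
  next
    fix Q assume Q: "openin \<XX> Q"
    have "topspace (subtopology \<XX> (holonomy_domain i j)) = holonomy_domain i j"
      using holonomy_domain_subset[OF ij] by (simp only: topspace_subtopology Int_absorb1)
    then show "openin (subtopology \<XX> (holonomy_domain i j))
        {p \<in> topspace (subtopology \<XX> (holonomy_domain i j)). holonomy i j p \<in> Q}"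
      using preimage[OF Q] clopen_holonomy_domain[OF ij] unfolding clopenin_def
      by (simp add: openin_open_subtopology)
  qed
  then show ?thesis
    using holonomy_inverse(1)[OF ij] by (auto simp: continuous_map_in_subtopology simp del: mem_Sigma_iff)
qed

lemma homeomorphic_holonomy:
  assumes ij: "i < \<nu>" "j < \<nu>"
  shows "homeomorphic_map (subtopology \<XX> (holonomy_domain i j)) (subtopology \<XX> (holonomy_domain j i)) (holonomy i j)"
proof -
  have "homeomorphic_maps (subtopology \<XX> (holonomy_domain i j)) (subtopology \<XX> (holonomy_domain j i))
      (holonomy i j) (holonomy j i)"
    unfolding homeomorphic_maps_def
    using continuous_holonomy[OF ij] continuous_holonomy[OF ij(2,1)]
      holonomy_inverse(2)[OF ij] holonomy_inverse(2)[OF ij(2,1)] by (simp del: mem_Sigma_iff)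
  then show ?thesis using homeomorphic_map_maps by blast
qed

text \<open>Near a point and near its image the metric may be pulled back by different maps
  \<open>e c0\<close> and \<open>e c1\<close>, which is why the local holonomy estimate allows
  independent foliation charts at the two ends.\<close>

lemma Lipschitz_metric_exists:
  "\<exists>d. Metric_space (topspace \<XX>) d \<and> Metric_space.mtopology (topspace \<XX>) d = \<XX> \<and>
     lipschitz_pseudogroup \<XX> d (holonomy_pseudogroup X \<nu> \<phi>)"
proof -
  \<comment> \<open>All conditions are bundled so that chart and neighbourhood are chosen
    simultaneously for each \<open>c\<close>.\<close>
  define adapted where "adapted c V \<psi> N \<longleftrightarrow> (V, \<psi>) \<in> F \<and> openin \<XX> N \<and> c \<in> N \<and> (\<forall>p\<in>N. f (center p) \<in> V) \<and>
      continuous_map (subtopology \<XX> N) euclidean (\<lambda>p. snd (\<psi> (f (center p)))) \<and>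
      inj_on (\<lambda>p. snd (\<psi> (f (center p)))) N"
    for c and V :: "'p set" and \<psi> :: "'p \<Rightarrow> (real^'k) \<times> (real^'q)" and N
  have "\<exists>V \<psi> N. adapted c V \<psi> N" if "c \<in> topspace \<XX>" for c
    unfolding adapted_def by (rule transverse_coordinate_embedding[OF that]) blast
  then obtain V \<psi> N where "\<And>c. c \<in> topspace \<XX> \<Longrightarrow> adapted c (V c) (\<psi> c) (N c)"
    by metis
  then have c:
    "\<And>c. c \<in> topspace \<XX> \<Longrightarrow> (V c, \<psi> c) \<in> F"
    "\<And>c. c \<in> topspace \<XX> \<Longrightarrow> openin \<XX> (N c) \<and> c \<in> N c"
    "\<And>c p. \<lbrakk>c \<in> topspace \<XX>; p \<in> N c\<rbrakk> \<Longrightarrow> f (center p) \<in> V c"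
    "\<And>c. c \<in> topspace \<XX> \<Longrightarrow> continuous_map (subtopology \<XX> (N c)) euclidean (\<lambda>p. snd (\<psi> c (f (center p))))"
    "\<And>c. c \<in> topspace \<XX> \<Longrightarrow> inj_on (\<lambda>p. snd (\<psi> c (f (center p)))) (N c)"
    unfolding adapted_def by blast+
  define e where "e c p = snd (\<psi> c (f (center p)))" for c p
  have e: "e c = (\<lambda>p. snd (\<psi> c (f (center p))))" for c
    by (rule ext) (simp only: e_def)
  have cont: "continuous_map (subtopology \<XX> (N c)) euclidean (e c)" and inj: "inj_on (e c) (N c)"
    if "c \<in> topspace \<XX>" for c
    unfolding e using c(4,5)[OF that] .
  obtain d where d: "Metric_space (topspace \<XX>) d" "Metric_space.mtopology (topspace \<XX>) d = \<XX>"
    "\<And>x y. d x y \<le> 1"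
    and local_d: "\<And>p. p \<in> topspace \<XX> \<Longrightarrow> \<exists>c W. c \<in> topspace \<XX> \<and> openin \<XX> W \<and> p \<in> W \<and> W \<subseteq> N c \<and>
       (\<forall>a\<in>W. \<forall>b\<in>W. d a b = dist (e c a) (e c b))"
  proof (rule metric_from_local_embeddings[where N = N and e = e, OF compact_transversal_space
        Hausdorff_transversal_space totally_disconnected_transversal_space c(2) cont inj])
    fix d assume "Metric_space (topspace \<XX>) d" "Metric_space.mtopology (topspace \<XX>) d = \<XX>"
      "\<And>x y. d x y \<le> 1"
      "\<And>p. p \<in> topspace \<XX> \<Longrightarrow> \<exists>c W. c \<in> topspace \<XX> \<and> openin \<XX> W \<and> p \<in> W \<and> W \<subseteq> N c \<and>
       (\<forall>a\<in>W. \<forall>b\<in>W. d a b = dist (e c a) (e c b))"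
    then show thesis by (rule that)
  qed
  interpret Metric_space "topspace \<XX>" d using d(1) .
  have Lip: "\<exists>C\<ge>0. \<forall>a\<in>holonomy_domain i j. \<forall>b\<in>holonomy_domain i j. d (holonomy i j a) (holonomy i j b) \<le> C * d a b"
    if ij: "i < \<nu>" "j < \<nu>" for i j
  \<comment> \<open>The bound 1 is the cutoff of the glued metric.\<close>
  proof (rule locally_Lipschitz_imp_Lipschitz[where B = 1])
    show "compactin mtopology (holonomy_domain i j)"
      unfolding d(2) using clopen_holonomy_domain[OF ij] compact_transversal_space closedin_compact_space
      unfolding clopenin_def by blast
    show "d (holonomy i j a) (holonomy i j b) \<le> 1" for a b using d(3) .
    fix p assume pd: "p \<in> holonomy_domain i j"
    define q where "q = holonomy i j p"
    have pq: "(p, q) \<in> holonomy_map \<phi> i j" unfolding q_def using holonomy_in_map[OF ij pd] .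
    have top: "p \<in> topspace \<XX>" "q \<in> topspace \<XX>"
      unfolding q_def using subsetD[OF holonomy_domain_subset[OF ij] pd]
        subsetD[OF holonomy_domain_subset[OF ij(2,1)] holonomy_inverse(1)[OF ij pd]] .
    obtain c0 W0 where W0: "c0 \<in> topspace \<XX>" "openin \<XX> W0" "p \<in> W0" "W0 \<subseteq> N c0"
      "\<forall>a\<in>W0. \<forall>b\<in>W0. d a b = dist (e c0 a) (e c0 b)"
      using local_d[OF top(1)] by metis
    obtain c1 W1 where W1: "c1 \<in> topspace \<XX>" "openin \<XX> W1" "q \<in> W1" "W1 \<subseteq> N c1"
      "\<forall>a\<in>W1. \<forall>b\<in>W1. d a b = dist (e c1 a) (e c1 b)"
      using local_d[OF top(2)] by metis
    have in_charts: "f (center p) \<in> V c0" "f (center q) \<in> V c1"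
      using c(3) W0 W1 by blast+
    \<comment> \<open>Taking \<open>W1\<close> as the target neighbourhood keeps the images where
      \<open>d\<close> is pulled back by \<open>e c1\<close>.\<close>
    obtain W C where W: "openin \<XX> W" "p \<in> W" "C \<ge> 0"
      "\<And>p1 q1. \<lbrakk>p1 \<in> W; (p1, q1) \<in> holonomy_map \<phi> i j\<rbrakk> \<Longrightarrow> q1 \<in> W1"
      "\<And>p1 q1 p2 q2. \<lbrakk>p1 \<in> W; p2 \<in> W; (p1, q1) \<in> holonomy_map \<phi> i j; (p2, q2) \<in> holonomy_map \<phi> i j\<rbrakk> \<Longrightarrow>
         dist (e c1 q1) (e c1 q2) \<le> C * dist (e c0 p1) (e c0 p2)"
      by (rule holonomy_locally_Lipschitz[OF ij pq c(1)[OF W0(1)] in_charts(1) c(1)[OF W1(1)] in_charts(2) W1(2,3)])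
         (rule that[unfolded e_def])
    have "d (holonomy i j a) (holonomy i j b) \<le> C * d a b"
      if "a \<in> (W \<inter> W0) \<inter> holonomy_domain i j" "b \<in> (W \<inter> W0) \<inter> holonomy_domain i j" for a b
    proof -
      have ab: "a \<in> W" "b \<in> W" "a \<in> W0" "b \<in> W0" "a \<in> holonomy_domain i j" "b \<in> holonomy_domain i j"
        using that by blast+
      note hol = holonomy_in_map[OF ij ab(5)] holonomy_in_map[OF ij ab(6)]
      have "d (holonomy i j a) (holonomy i j b) = dist (e c1 (holonomy i j a)) (e c1 (holonomy i j b))"
        using W1(5) W(4)[OF ab(1) hol(1)] W(4)[OF ab(2) hol(2)] by blast
      also have "\<dots> \<le> C * dist (e c0 a) (e c0 b)" by (rule W(5)[OF ab(1,2) hol])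
      also have "dist (e c0 a) (e c0 b) = d a b" using W0(5) ab(3,4) by simp
      finally show ?thesis .
    qed
    then show "\<exists>W C. openin mtopology W \<and> p \<in> W \<and> C \<ge> 0 \<and>
      (\<forall>a\<in>W \<inter> holonomy_domain i j. \<forall>b\<in>W \<inter> holonomy_domain i j. d (holonomy i j a) (holonomy i j b) \<le> C * d a b)"
      unfolding d(2) using W(1-3) W0(2,3) by (intro exI[of _ "W \<inter> W0"] exI[of _ C] conjI ballI openin_Int) simp_all
  qed
  then obtain L where L: "\<And>i j. \<lbrakk>i < \<nu>; j < \<nu>\<rbrakk> \<Longrightarrow> L i j \<ge> 0"
    "\<And>i j a b. \<lbrakk>i < \<nu>; j < \<nu>; a \<in> holonomy_domain i j; b \<in> holonomy_domain i j\<rbrakk> \<Longrightarrow>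
       d (holonomy i j a) (holonomy i j b) \<le> L i j * d a b"
    by metis
  \<comment> \<open>The sum dominates the constants of all generators at once, and the summand 1
    gives \<open>C \<ge> 1\<close>.\<close>
  define C where "C = 1 + (\<Sum>i<\<nu>. \<Sum>j<\<nu>. L i j)"
  have C: "L i j \<le> C" if "i < \<nu>" "j < \<nu>" for i j
  proof -
    have "L i j \<le> (\<Sum>j<\<nu>. L i j)" using that L(1) by (intro member_le_sum) auto
    also have "\<dots> \<le> (\<Sum>i<\<nu>. \<Sum>j<\<nu>. L i j)"
      using that L(1) by (intro member_le_sum[of i _ "\<lambda>i. \<Sum>j<\<nu>. L i j"] sum_nonneg) auto
    finally show ?thesis by (simp add: C_def)
  qed
  have C1: "C \<ge> 1" using L(1) by (auto simp: C_def intro!: sum_nonneg)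
  have upper: "d (holonomy i j a) (holonomy i j b) \<le> C * d a b"
    if ij: "i < \<nu>" "j < \<nu>" and ab: "a \<in> holonomy_domain i j" "b \<in> holonomy_domain i j" for i j a b
    using L(2)[OF ij ab] mult_right_mono[OF C[OF ij], of "d a b"] by simp
  \<comment> \<open>This is the upper bound for the opposite generator \<open>holonomy j i\<close>,
    evaluated at the image points.\<close>
  have lower: "inverse C * d a b \<le> d (holonomy i j a) (holonomy i j b)"
    if ij: "i < \<nu>" "j < \<nu>" and ab: "a \<in> holonomy_domain i j" "b \<in> holonomy_domain i j" for i j a b
  proof -
    have "d a b \<le> C * d (holonomy i j a) (holonomy i j b)"
      using upper[OF ij(2,1) holonomy_inverse(1)[OF ij ab(1)] holonomy_inverse(1)[OF ij ab(2)]]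
      unfolding holonomy_inverse(2)[OF ij ab(1)] holonomy_inverse(2)[OF ij ab(2)] .
    then show ?thesis using C1 by (simp add: field_simps)
  qed
  define H where "H = {holonomy_map \<phi> i j | i j. i < \<nu> \<and> j < \<nu> \<and> U i \<inter> U j \<noteq> {}}"
  have "H \<subseteq> (\<lambda>(i, j). holonomy_map \<phi> i j) ` ({..<\<nu>} \<times> {..<\<nu>})"
    unfolding H_def by auto
  then have "finite H" using finite_subset by blast
  have "lipschitz_pseudogroup \<XX> d (holonomy_pseudogroup X \<nu> \<phi>)"
    unfolding lipschitz_pseudogroup_def
  proof (intro exI[of _ H] exI[of _ C] conjI ballI)
    show "finite H" by fact
    show "pseudogroup_generated \<XX> H = holonomy_pseudogroup X \<nu> \<phi>"
      unfolding holonomy_pseudogroup_def H_def ..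
    show "C \<ge> 1" by fact
    fix h assume "h \<in> H"
    then obtain i j where ij: "i < \<nu>" "j < \<nu>" "h = holonomy_map \<phi> i j" unfolding H_def by blast
    have "\<forall>w\<in>holonomy_domain i j. \<forall>w'\<in>holonomy_domain i j.
        inverse C * d w w' \<le> d (holonomy i j w) (holonomy i j w') \<and>
        d (holonomy i j w) (holonomy i j w') \<le> C * d w w'"
      by (intro ballI conjI upper lower ij)
    then show "\<exists>U V f. clopenin \<XX> U \<and> clopenin \<XX> V \<and>
        homeomorphic_map (subtopology \<XX> U) (subtopology \<XX> V) f \<and> h = graph_on U f \<and>
        (\<forall>w\<in>U. \<forall>w'\<in>U. inverse C * d w w' \<le> d (f w) (f w') \<and> d (f w) (f w') \<le> C * d w w')"
      unfolding ij(3)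
      by (intro exI[of _ "holonomy_domain i j"] exI[of _ "holonomy_domain j i"] exI[of _ "holonomy i j"] conjI
        clopen_holonomy_domain homeomorphic_holonomy holonomy_map_eq_graph ij(1,2))
  qed
  then show ?thesis using d(1,2) by blast
qed

end

theorem proposition4p2:
  fixes MM :: "'m topology" and X :: "'x metric"
    and A :: "('m, (real^'n) \<times> 'x) chart set" and g :: "('m, 'n, 'x) leaf_tensor"
    and \<nu> :: nat and \<phi> :: "nat \<Rightarrow> ('m, (real^'n) \<times> 'x) chart"
    and M :: "'p topology" and S :: "('p, 'e::euclidean_space) chart set"
    and G :: "('p, 'e) chart \<Rightarrow> 'e \<Rightarrow> 'e \<Rightarrow> 'e \<Rightarrow> real"
    and F :: "('p, (real^'k) \<times> (real^'q)) chart set"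
    and Z :: "'p set" and f :: "'m \<Rightarrow> 'p"
  defines "\<XX> \<equiv> transversal_space X \<nu> \<phi>"
  assumes "matchbox_manifold MM X A" and "minimal_foliated_space MM A"
    and "leafwise_riemannian_metric X A g"
    and "regular_foliated_covering MM X A g \<nu> \<phi>"
    and "smooth_manifold M S" and "riemannian_metric S G"
    and "C1_foliation M S F"
    and "exceptional_minimal_set M F Z"
    and "homeomorphic_map MM (subtopology M Z) f"
  shows "\<exists>d. Metric_space (topspace \<XX>) d \<and> Metric_space.mtopology (topspace \<XX>) d = \<XX> \<and>
           lipschitz_pseudogroup \<XX> d (holonomy_pseudogroup X \<nu> \<phi>)"
proof -
  have cover:
    "\<forall>i<\<nu>. \<phi> i \<in> A"
    "\<forall>i<\<nu>. \<forall>j<\<nu>.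
        clopenin (subtopology (mtopology_of X) (local_transversal_model (\<phi> i))) (overlap_transversal \<phi> i j)"
    "\<forall>i<\<nu>. \<forall>j<\<nu>. \<forall>y\<in>fst (\<phi> i) \<inter> fst (\<phi> j). \<forall>z\<in>fst (\<phi> i) \<inter> fst (\<phi> j).
        snd (snd (\<phi> i) y) = snd (snd (\<phi> i) z) \<longleftrightarrow> snd (snd (\<phi> j) y) = snd (snd (\<phi> j) z)"
    using assms(5)[unfolded regular_foliated_covering_def, THEN conjunct1]
      assms(5)[unfolded regular_foliated_covering_def, THEN conjunct2, THEN conjunct2, THEN conjunct2, THEN conjunct1]
      assms(5)[unfolded regular_foliated_covering_def, THEN conjunct2, THEN conjunct2, THEN conjunct2, THEN conjunct2] .
  interpret transversal_embedding M S F Z MM f X \<nu> \<phi>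
  proof (intro transversal_embedding.intro transversal_embedding_axioms.intro exceptional_embedding.intro
      exceptional_embedding_axioms.intro foliated_manifold.intro)
    show "smooth_manifold M S" "C1_foliation M S F" "exceptional_minimal_set M F Z"
      "homeomorphic_map MM (subtopology M Z) f" by fact+
    fix i assume i: "i < \<nu>"
    then have "(fst (\<phi> i), snd (\<phi> i)) \<in> A" using cover(1) by simp
    from matchbox_chart[OF assms(2) this]
    show "flat_chart MM (fst (\<phi> i)) (subtopology (mtopology_of X) (local_transversal_model (\<phi> i))) (snd (\<phi> i))"
      "compactin (mtopology_of X) (local_transversal_model (\<phi> i))"
      by simp_all
    show "clopenin (subtopology (mtopology_of X) (local_transversal_model (\<phi> i))) (overlap_transversal \<phi> i j)"
      if "j < \<nu>" for j
      using cover(2) i that by blast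
    show "snd (snd (\<phi> i) y) = snd (snd (\<phi> i) z) \<longleftrightarrow> snd (snd (\<phi> j) y) = snd (snd (\<phi> j) z)"
      if "j < \<nu>" "y \<in> fst (\<phi> i) \<inter> fst (\<phi> j)" "z \<in> fst (\<phi> i) \<inter> fst (\<phi> j)" for j y z
      using cover(3)[rule_format, OF i that] .
  next
    show "totally_disconnected_space (mtopology_of X)"
      using assms(2) unfolding matchbox_manifold_def by blast
  qed
  show ?thesis unfolding \<XX>_def by (rule Lipschitz_metric_exists)
qed

end
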